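(* Let $\sigma>0$ and let $\theta\in S^1e_++S^1e_-$ with $\theta\ne\pm1,\pm ij$. For every $\psi\in L^{2,\sigma}_{\mathbb{T}}(\mathbb{R})$ we have $$\|\mathcal{F}^\sigma_\theta\psi\|_{L^{2,\sigma}_{\mathbb{T}}(\mathbb{R})}=\|\psi\|_{L^{2,\sigma}_{\mathbb{T}}(\mathbb{R})},$$ and $\mathcal{F}^\sigma_\theta\psi_n=\theta^n\psi_n$ for every integer $n\ge0$, where $$\psi_n(x)=\left(\frac{1}{2^n\sigma^nn!}\right)^{1/2}H_n^\sigma(x),\qquad H_n^\sigma(x)=(-1)^ne^{\sigma x^2}\frac{d^n}{dx^n}\left(e^{-\sigma x^2}\right).$$
   Context: Bicomplex numbers: $\mathbb{T}=\{Z=z_1+jz_2:\ z_1,z_2\in\mathbb{C}\}$ is the commutative algebra in which $i^2=j^2=-1$, $ij=ji$ and $\mathbb{C}=\mathbb{R}+i\mathbb{R}$. Put $e_\pm=\frac{1\pm ij}{2}$; then $e_\pm^2=e_\pm$, $e_+e_-=0$, $e_++e_-=1$, $e_+-e_-=ij$. Every $Z=z_1+jz_2$ is uniquely $Z=\alpha e_++\beta e_-$ with $\alpha=z_1-iz_2$, $\beta=z_1+iz_2\in\mathbb{C}$; algebraic operations are componentwise in $(\alpha,\beta)$, $e^Z=e^\alpha e_++e^\beta e_-$, and $\sqrt{\alpha e_++\beta e_-}=\sqrt{\alpha}\,e_++\sqrt{\beta}\,e_-$ with principal square roots. Set $Z^*=\overline{\alpha}e_++\overline{\beta}e_-$. $S^1=\{\xi\in\mathbb{C}:|\xi|=1\}$,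 and $S^1e_++S^1e_-=\{\alpha e_++\beta e_-:\alpha,\beta\in S^1\}$. $L^{2,\sigma}_{\mathbb{T}}(\mathbb{R})$ is the space of (classes modulo a.e. equality of) functions $\varphi=\varphi^+e_++\varphi^-e_-:\mathbb{R}\to\mathbb{T}$ with $\varphi^\pm:\mathbb{R}\to\mathbb{C}$ square integrable for $e^{-\sigma x^2}dx$, with inner product $\langle\varphi,\psi\rangle=\left(\frac{\sigma}{\pi}\right)^{1/2}\int_{\mathbb{R}}\varphi(x)\psi(x)^*e^{-\sigma x^2}dx$ and norm $\|\varphi\|^2=\frac{a+b}{2}$ where $\langle\varphi,\varphi\rangle=a\,e_++b\,e_-$. The bicomplex fractional Fourier transform is $$\mathcal{F}^\sigma_\theta\psi(y)=\frac{(\sigma/\pi)^{1/2}}{\sqrt{1-\theta^2}}\int_{\mathbb{R}}\psi(x)\,e^{-\frac{\sigma}{1-\theta^2}(x-\theta y)^2}\,dx,\qquad \psi\in L^{2,\sigma}_{\mathbb{T}}(\mathbb{R}).$$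
   Formalization: The integral over R is read as the norm limit of integrals over [-R,R]; where exactly one idempotent component of θ is ±1, so that 1-θ² is a zero divisor and the formula is undefined, the transform is taken as the norm limit of the formula at rθ as r→1-. *)

theory Defs
  imports "HOL-Analysis.Analysis"
begin

section \<open>Bicomplex numbers\<close>

text \<open>\<open>Bicomplex z1 z2\<close> stands for $z_1 + j z_2$.\<close>

datatype bicomplex = Bicomplex (bc_fst: complex) (bc_snd: complex)

lemma bicomplex_eq_iff: "Z = W \<longleftrightarrow> bc_fst Z = bc_fst W \<and> bc_snd Z = bc_snd W"
  by (cases Z; cases W) simp

instantiation bicomplex :: comm_ring_1
begin

definition zero_bicomplex :: bicomplex where "0 = Bicomplex 0 0"
definition one_bicomplex :: bicomplex where "1 = Bicomplex 1 0"
definition plus_bicomplex :: "bicomplex \<Rightarrow> bicomplex \<Rightarrow> bicomplex" where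
  "Z + W = Bicomplex (bc_fst Z + bc_fst W) (bc_snd Z + bc_snd W)"
definition uminus_bicomplex :: "bicomplex \<Rightarrow> bicomplex" where
  "- Z = Bicomplex (- bc_fst Z) (- bc_snd Z)"
definition minus_bicomplex :: "bicomplex \<Rightarrow> bicomplex \<Rightarrow> bicomplex" where
  "Z - W = Bicomplex (bc_fst Z - bc_fst W) (bc_snd Z - bc_snd W)"
definition times_bicomplex :: "bicomplex \<Rightarrow> bicomplex \<Rightarrow> bicomplex" where
  "Z * W = Bicomplex (bc_fst Z * bc_fst W - bc_snd Z * bc_snd W)
                     (bc_fst Z * bc_snd W + bc_snd Z * bc_fst W)"

instance
  by standard
    (simp_all add: bicomplex_eq_iff zero_bicomplex_def one_bicomplex_def plus_bicomplex_def
      uminus_bicomplex_def minus_bicomplex_def times_bicomplex_def algebra_simps)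

end

instantiation bicomplex :: real_algebra_1
begin

definition scaleR_bicomplex :: "real \<Rightarrow> bicomplex \<Rightarrow> bicomplex" where
  "r *\<^sub>R Z = Bicomplex (r *\<^sub>R bc_fst Z) (r *\<^sub>R bc_snd Z)"

instance
  by standard
    (simp_all add: bicomplex_eq_iff plus_bicomplex_def times_bicomplex_def
      scaleR_bicomplex_def algebra_simps)

end

definition bc_of_complex :: "complex \<Rightarrow> bicomplex" where
  "bc_of_complex z = Bicomplex z 0"

definition bc_i :: bicomplex where "bc_i = bc_of_complex \<i>"
definition bc_j :: bicomplex where "bc_j = Bicomplex 0 1"

definition e_plus :: bicomplex where "e_plus = (1 / 2) *\<^sub>R (1 + bc_i * bc_j)"
definition e_minus :: bicomplex where "e_minus = (1 / 2) *\<^sub>R (1 - bc_i * bc_j)"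

definition bc_idem :: "complex \<Rightarrow> complex \<Rightarrow> bicomplex" where
  "bc_idem a b = bc_of_complex a * e_plus + bc_of_complex b * e_minus"

definition bc_plus :: "bicomplex \<Rightarrow> complex" where
  "bc_plus Z = bc_fst Z - \<i> * bc_snd Z"
definition bc_minus :: "bicomplex \<Rightarrow> complex" where
  "bc_minus Z = bc_fst Z + \<i> * bc_snd Z"

lemmas bicomplex_defs = zero_bicomplex_def one_bicomplex_def plus_bicomplex_def
  uminus_bicomplex_def minus_bicomplex_def times_bicomplex_def scaleR_bicomplex_def
  bc_of_complex_def bc_i_def bc_j_def e_plus_def e_minus_def bc_idem_def

lemma bc_i_square: "bc_i * bc_i = -1" and bc_j_square: "bc_j * bc_j = -1"
  by (simp_all add: bicomplex_eq_iff bicomplex_defs)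

lemma e_plus_minus:
  "e_plus * e_plus = e_plus" "e_minus * e_minus = e_minus" "e_plus * e_minus = 0"
  "e_plus + e_minus = 1" "e_plus - e_minus = bc_i * bc_j"
  by (simp_all add: bicomplex_eq_iff bicomplex_defs complex_eq_iff)

lemma bc_idem_components [simp]: "bc_plus (bc_idem a b) = a" "bc_minus (bc_idem a b) = b"
  by (simp_all add: bc_plus_def bc_minus_def bicomplex_defs complex_eq_iff field_simps)

lemma bc_idem_decomposition: "bc_idem (bc_plus Z) (bc_minus Z) = Z"
  by (simp add: bicomplex_eq_iff bc_plus_def bc_minus_def bicomplex_defs complex_eq_iff field_simps)

lemma bc_plus_arith [simp]:
  "bc_plus 0 = 0" "bc_plus 1 = 1" "bc_plus (Z + W) = bc_plus Z + bc_plus W"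
  "bc_plus (Z - W) = bc_plus Z - bc_plus W" "bc_plus (- Z) = - bc_plus Z"
  "bc_plus (Z * W) = bc_plus Z * bc_plus W" "bc_plus (r *\<^sub>R Z) = r *\<^sub>R bc_plus Z"
  by (simp_all add: bc_plus_def bicomplex_defs algebra_simps)

lemma bc_minus_arith [simp]:
  "bc_minus 0 = 0" "bc_minus 1 = 1" "bc_minus (Z + W) = bc_minus Z + bc_minus W"
  "bc_minus (Z - W) = bc_minus Z - bc_minus W" "bc_minus (- Z) = - bc_minus Z"
  "bc_minus (Z * W) = bc_minus Z * bc_minus W" "bc_minus (r *\<^sub>R Z) = r *\<^sub>R bc_minus Z"
  by (simp_all add: bc_minus_def bicomplex_defs algebra_simps)

text \<open>Division is componentwise. It is the division of the ring only when the divisor is a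
  unit (both idempotent components nonzero); a zero component is inverted to zero.\<close>

instantiation bicomplex :: inverse
begin

definition inverse_bicomplex :: "bicomplex \<Rightarrow> bicomplex" where
  "inverse Z = bc_idem (inverse (bc_plus Z)) (inverse (bc_minus Z))"
definition divide_bicomplex :: "bicomplex \<Rightarrow> bicomplex \<Rightarrow> bicomplex" where
  "Z div W = Z * inverse (W::bicomplex)"

instance ..

end

lemma bicomplex_unit_iff: "Z dvd 1 \<longleftrightarrow> bc_plus Z \<noteq> 0 \<and> bc_minus Z \<noteq> (0::complex)"
proof
  assume "Z dvd 1"
  then obtain W where "1 = Z * W" by (elim dvdE)
  then have "bc_plus Z * bc_plus W = 1" "bc_minus Z * bc_minus W = 1"
    by (metis bc_plus_arith(2,6), metis bc_minus_arith(2,6))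
  then show "bc_plus Z \<noteq> 0 \<and> bc_minus Z \<noteq> 0" by auto
next
  assume "bc_plus Z \<noteq> 0 \<and> bc_minus Z \<noteq> 0"
  then have "bc_plus (Z * inverse Z) = bc_plus 1" "bc_minus (Z * inverse Z) = bc_minus 1"
    by (simp_all add: inverse_bicomplex_def)
  then have "Z * inverse Z = 1" by (metis bc_idem_decomposition)
  then show "Z dvd 1" by (metis dvd_triv_left)
qed

definition bc_exp :: "bicomplex \<Rightarrow> bicomplex" where
  "bc_exp Z = bc_idem (exp (bc_plus Z)) (exp (bc_minus Z))"

definition bc_sqrt :: "bicomplex \<Rightarrow> bicomplex" where
  "bc_sqrt Z = bc_idem (csqrt (bc_plus Z)) (csqrt (bc_minus Z))"

definition bc_star :: "bicomplex \<Rightarrow> bicomplex" where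
  "bc_star Z = bc_idem (cnj (bc_plus Z)) (cnj (bc_minus Z))"

definition bc_torus :: "bicomplex set" where
  "bc_torus = {bc_idem a b | a b. a \<in> sphere 0 1 \<and> b \<in> sphere 0 1}"

definition bc_integral :: "real set \<Rightarrow> (real \<Rightarrow> bicomplex) \<Rightarrow> bicomplex" where
  "bc_integral A f = bc_idem (LINT x:A|lborel. bc_plus (f x)) (LINT x:A|lborel. bc_minus (f x))"

section \<open>The weighted $L^2$ space\<close>

text \<open>Functions rather than classes modulo almost everywhere equality; every class has a Borel
  representative.\<close>

definition L2 :: "real \<Rightarrow> (real \<Rightarrow> complex) set" where
  "L2 \<sigma> = {f \<in> borel_measurable lborel.
     integrable lborel (\<lambda>x. (cmod (f x))\<^sup>2 * exp (- \<sigma> * x\<^sup>2))}"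

definition L2T :: "real \<Rightarrow> (real \<Rightarrow> bicomplex) set" where
  "L2T \<sigma> = {\<phi>. (\<lambda>x. bc_plus (\<phi> x)) \<in> L2 \<sigma> \<and> (\<lambda>x. bc_minus (\<phi> x)) \<in> L2 \<sigma>}"

definition L2T_inner :: "real \<Rightarrow> (real \<Rightarrow> bicomplex) \<Rightarrow> (real \<Rightarrow> bicomplex) \<Rightarrow> bicomplex" where
  "L2T_inner \<sigma> \<phi> \<psi> = of_real ((\<sigma> / pi) powr (1 / 2)) *
     bc_integral UNIV (\<lambda>x. \<phi> x * bc_star (\<psi> x) * of_real (exp (- \<sigma> * x\<^sup>2)))"

text \<open>Both idempotent components of \<open>L2T_inner \<sigma> \<phi> \<phi>\<close> are nonnegative reals.\<close>

definition L2T_norm :: "real \<Rightarrow> (real \<Rightarrow> bicomplex) \<Rightarrow> real" where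
  "L2T_norm \<sigma> \<phi> =
     sqrt ((Re (bc_plus (L2T_inner \<sigma> \<phi> \<phi>)) + Re (bc_minus (L2T_inner \<sigma> \<phi> \<phi>))) / 2)"

definition L2T_tendsto ::
  "real \<Rightarrow> ('i \<Rightarrow> real \<Rightarrow> bicomplex) \<Rightarrow> (real \<Rightarrow> bicomplex) \<Rightarrow> 'i filter \<Rightarrow> bool" where
  "L2T_tendsto \<sigma> f g F \<longleftrightarrow> g \<in> L2T \<sigma> \<and> (\<forall>\<^sub>F t in F. f t \<in> L2T \<sigma>) \<and>
     ((\<lambda>t. L2T_norm \<sigma> (\<lambda>x. f t x - g x)) \<longlongrightarrow> 0) F"

section \<open>The bicomplex fractional Fourier transform\<close>

definition frft_on :: "real set \<Rightarrow> real \<Rightarrow> bicomplex \<Rightarrow> (real \<Rightarrow> bicomplex) \<Rightarrow> real \<Rightarrow> bicomplex" where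
  "frft_on A \<sigma> \<theta> \<psi> y = of_real ((\<sigma> / pi) powr (1 / 2)) / bc_sqrt (1 - \<theta>\<^sup>2) *
     bc_integral A (\<lambda>x. \<psi> x *
       bc_exp (- (of_real \<sigma> / (1 - \<theta>\<^sup>2)) * (of_real x - \<theta> * of_real y)\<^sup>2))"

text \<open>\<open>frft_on UNIV \<sigma> \<theta> \<psi>\<close> is the defining formula of the transform. When the idempotent
  components of \<open>\<theta>\<close> lie on the unit circle, the kernel has modulus
  $e^{-\sigma x^2/2 + \sigma y^2/2}$ in each component, so for a general \<open>\<psi>\<close> in \<open>L2T \<sigma>\<close> the
  integral is not absolutely convergent and, as for the classical Fourier-Plancherel transform,
  is understood as the limit in the norm of the integrals over $[-R, R]$.

  The formula moreover divides by $1 - \theta^2$, which may be a nonzero zero divisor (exactly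
  one idempotent component of \<open>\<theta>\<close> being $\pm 1$). At such \<open>\<theta>\<close> the transform is the radial
  limit, in the norm, of the formula at \<open>r \<theta>\<close> for $r \to 1-$, where $1 - (r\theta)^2$ is a unit
  and the integral converges absolutely.\<close>

definition has_frft :: "real \<Rightarrow> bicomplex \<Rightarrow> (real \<Rightarrow> bicomplex) \<Rightarrow> (real \<Rightarrow> bicomplex) \<Rightarrow> bool" where
  "has_frft \<sigma> \<theta> \<psi> g \<longleftrightarrow>
     (if (1 - \<theta>\<^sup>2) dvd 1
      then L2T_tendsto \<sigma> (\<lambda>R. frft_on {-R..R} \<sigma> \<theta> \<psi>) g at_top
      else L2T_tendsto \<sigma> (\<lambda>r. frft_on UNIV \<sigma> (r *\<^sub>R \<theta>) \<psi>) g (at_left 1))"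

text \<open>Determined only up to almost everywhere equality.\<close>

definition frft :: "real \<Rightarrow> bicomplex \<Rightarrow> (real \<Rightarrow> bicomplex) \<Rightarrow> real \<Rightarrow> bicomplex" where
  "frft \<sigma> \<theta> \<psi> = (SOME g. has_frft \<sigma> \<theta> \<psi> g)"

section \<open>Hermite functions\<close>

definition hermite :: "real \<Rightarrow> nat \<Rightarrow> real \<Rightarrow> real" where
  "hermite \<sigma> n x = (-1) ^ n * exp (\<sigma> * x\<^sup>2) * (deriv ^^ n) (\<lambda>t. exp (- \<sigma> * t\<^sup>2)) x"

definition hermite_psi :: "real \<Rightarrow> nat \<Rightarrow> real \<Rightarrow> bicomplex" where
  "hermite_psi \<sigma> n x = of_real ((1 / (2 ^ n * \<sigma> ^ n * fact n)) powr (1 / 2) * hermite \<sigma> n x)"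

end

theory Submission
  imports Defs "HOL-Probability.Distributions" "HOL-Complex_Analysis.Conformal_Mappings"
    "HOL-Real_Asymp.Real_Asymp"
begin

text \<open>
  All operations of \<open>bicomplex\<close> act on the two idempotent components separately, and so does the
  transform: on a component \<open>f\<close> it acts with the component \<open>a\<close> of \<open>\<theta>\<close>, a complex number of modulus
  1. The task is therefore to show that the scalar transform with parameter \<open>a\<close>
  is isometric on the space \<open>L\<^sup>2\<close> of the Gaussian probability measure \<open>gauss \<sigma>\<close>, and multiplies the
  \<open>n\<close>-th Hermite polynomial by \<open>a ^ n\<close>. Moving the weight into the kernel turns the defining
  formula with parameter \<open>z\<close> into integration against the Mehler kernel \<open>mehler \<sigma> z\<close>.

  Everything is read off from the coherent states \<open>coh \<sigma> t\<close>, the generating functions of the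
  Hermite polynomials. A Gaussian integral (\<open>complex_gaussian_integral\<close>, obtained by analytic
  continuation) shows that the Mehler kernel sends \<open>coh \<sigma> t\<close> to \<open>coh \<sigma> (z * t)\<close> for
  \<open>|z| \<le> 1\<close>, \<open>z\<^sup>2 \<noteq> 1\<close> (\<open>mehler_coh\<close>). As the inner product of \<open>coh \<sigma> s\<close> and \<open>coh \<sigma> t\<close> is
  \<open>exp (2 \<sigma> s (cnj t))\<close>, expanding the exponential writes the squared norm of a linear combination of
  coherent states as a power series in \<open>|z|\<^sup>2\<close> with nonnegative coefficients after all parameters are
  multiplied by \<open>z\<close> (\<open>l2norm_comb_sums\<close>). Hence \<open>t \<mapsto> z * t\<close> is contractive on these combinations
  for \<open>|z| \<le> 1\<close> and isometric for \<open>|z| = 1\<close>.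

  The combinations are dense (\<open>comb_dense\<close>): they contain all trigonometric polynomials, and those
  approximate every bounded measurable function boundedly and almost everywhere. So for \<open>|a| = 1\<close>
  the map \<open>coh \<sigma> t \<mapsto> coh \<sigma> (a * t)\<close> extends to an isometry of the whole space; \<open>rotated \<sigma> a f g\<close>
  says that \<open>g\<close> is the image of \<open>f\<close>. Both limits in the definition of the transform are limits of
  contractions that converge on coherent states, so they converge to this isometry
  (\<open>rotated_limit\<close>). For the radial limit the contractions are the Mehler transforms at \<open>r * a\<close> with
  \<open>r < 1\<close>; for truncation to \<open>[-R, R]\<close> contractivity follows by letting \<open>r\<close> tend to 1 under the
  integral over a bounded set and applying Fatou's lemma.

  Finally, integration by parts gives \<open>(2 \<sigma> (cnj t)) ^ n\<close> as the inner product of the \<open>n\<close>-th Hermite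
  polynomial with \<open>coh \<sigma> t\<close>. The factor \<open>a ^ n\<close> is exactly what makes this compatible with the
  rotation of \<open>t\<close> by \<open>a\<close>, and density identifies the image.
\<close>

section \<open>Square integrable functions on a measure space\<close>

definition sq_integrable :: "'a measure \<Rightarrow> ('a \<Rightarrow> complex) \<Rightarrow> bool" where
  "sq_integrable M f \<longleftrightarrow> f \<in> borel_measurable M \<and> integrable M (\<lambda>x. (cmod (f x))\<^sup>2)"

definition l2norm :: "'a measure \<Rightarrow> ('a \<Rightarrow> complex) \<Rightarrow> real" where
  "l2norm M f = sqrt (\<integral>x. (cmod (f x))\<^sup>2 \<partial>M)"

definition l2inner :: "'a measure \<Rightarrow> ('a \<Rightarrow> complex) \<Rightarrow> ('a \<Rightarrow> complex) \<Rightarrow> complex" where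
  "l2inner M f g = (\<integral>x. f x * cnj (g x) \<partial>M)"

lemma sq_integrable_bound:
  assumes "integrable M g" "f \<in> borel_measurable M" "\<And>x. x \<in> space M \<Longrightarrow> (cmod (f x))\<^sup>2 \<le> g x"
  shows "sq_integrable M f"
proof -
  have [measurable]: "f \<in> borel_measurable M" by fact
  have "integrable M (\<lambda>x. (cmod (f x))\<^sup>2)"
    by (rule Bochner_Integration.integrable_bound[OF assms(1)])
       (auto intro!: AE_I2 order_trans[OF assms(3)])
  then show ?thesis using assms by (simp add: sq_integrable_def)
qed

lemma sq_integrable_cmult: "sq_integrable M f \<Longrightarrow> sq_integrable M (\<lambda>x. c * f x)"
  by (auto simp: sq_integrable_def norm_mult power_mult_distrib)

lemma sq_integrable_add:
  assumes "sq_integrable M f" "sq_integrable M g"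
  shows "sq_integrable M (\<lambda>x. f x + g x)"
proof (rule sq_integrable_bound)
  show "integrable M (\<lambda>x. 2 * (cmod (f x))\<^sup>2 + 2 * (cmod (g x))\<^sup>2)"
    using assms by (auto simp: sq_integrable_def)
  show "(\<lambda>x. f x + g x) \<in> borel_measurable M"
    using assms by (auto simp: sq_integrable_def)
  fix x
  have "(cmod (f x + g x))\<^sup>2 \<le> (cmod (f x) + cmod (g x))\<^sup>2"
    by (intro power_mono norm_triangle_ineq) auto
  also have "\<dots> \<le> 2 * (cmod (f x))\<^sup>2 + 2 * (cmod (g x))\<^sup>2"
    using sum_squares_bound[of "cmod (f x)" "cmod (g x)"] by (simp add: power2_sum)
  finally show "(cmod (f x + g x))\<^sup>2 \<le> 2 * (cmod (f x))\<^sup>2 + 2 * (cmod (g x))\<^sup>2" .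
qed

lemma sq_integrable_diff:
  assumes "sq_integrable M f" "sq_integrable M g"
  shows "sq_integrable M (\<lambda>x. f x - g x)"
  using sq_integrable_add[OF assms(1) sq_integrable_cmult[OF assms(2), of "-1"]] by simp

lemma sq_integrable_restrict:
  assumes "sq_integrable M f" "A \<in> sets M"
  shows "sq_integrable M (\<lambda>x. indicator A x * f x)"
proof (rule sq_integrable_bound)
  show "integrable M (\<lambda>x. (cmod (f x))\<^sup>2)" "(\<lambda>x. indicator A x * f x) \<in> borel_measurable M"
    using assms by (auto simp: sq_integrable_def)
qed (auto simp: indicator_def)

lemma l2norm_nonneg [simp]: "0 \<le> l2norm M f"
  by (simp add: l2norm_def)

lemma l2norm_square: "(l2norm M f)\<^sup>2 = (\<integral>x. (cmod (f x))\<^sup>2 \<partial>M)"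
  by (simp add: l2norm_def)

lemma l2inner_self: "l2inner M f f = complex_of_real ((l2norm M f)\<^sup>2)"
  by (simp add: l2inner_def l2norm_square complex_norm_square[symmetric]
      flip: integral_complex_of_real)

lemma l2norm_mono:
  assumes "sq_integrable M g" "\<And>x. x \<in> space M \<Longrightarrow> cmod (f x) \<le> cmod (g x)"
  shows "l2norm M f \<le> l2norm M g"
  unfolding l2norm_def
  by (intro real_sqrt_le_mono integral_mono_AE' AE_I2 power_mono assms)
     (use assms in \<open>auto simp: sq_integrable_def\<close>)

lemma l2norm_cmult: "l2norm M (\<lambda>x. c * f x) = cmod c * l2norm M f"
  by (simp add: l2norm_def norm_mult power_mult_distrib real_sqrt_mult)

lemma l2norm_minus_commute: "l2norm M (\<lambda>x. f x - g x) = l2norm M (\<lambda>x. g x - f x)"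
  by (simp add: l2norm_def norm_minus_commute)

lemma l2norm_cong_AE:
  assumes "AE x in M. f x = g x" "f \<in> borel_measurable M" "g \<in> borel_measurable M"
  shows "l2norm M f = l2norm M g"
  unfolding l2norm_def using assms by (intro arg_cong[where f=sqrt] integral_cong_AE) auto

lemma integrable_mult_sq:
  assumes "sq_integrable M f" "sq_integrable M g"
  shows "integrable M (\<lambda>x. f x * g x)"
proof (rule Bochner_Integration.integrable_bound)
  show "integrable M (\<lambda>x. (cmod (f x))\<^sup>2 + (cmod (g x))\<^sup>2)"
    using assms by (auto simp: sq_integrable_def)
  show "(\<lambda>x. f x * g x) \<in> borel_measurable M"
    using assms by (auto simp: sq_integrable_def)
  have "cmod (f x * g x) \<le> (cmod (f x))\<^sup>2 + (cmod (g x))\<^sup>2" for x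
  proof -
    have "0 \<le> cmod (f x) * cmod (g x)" by simp
    then show ?thesis
    using sum_squares_bound[of "cmod (f x)" "cmod (g x)"] unfolding norm_mult by linarith
  qed
  then show "AE x in M. cmod (f x * g x) \<le> norm ((cmod (f x))\<^sup>2 + (cmod (g x))\<^sup>2)"
    by (auto intro!: AE_I2 simp: order_trans[OF _ abs_ge_self])
qed

lemma sq_integrable_cnj: "sq_integrable M f \<Longrightarrow> sq_integrable M (\<lambda>x. cnj (f x))"
  using measurable_compose[OF _ borel_measurable_continuous_onI[OF continuous_on_cnj[OF continuous_on_id]]]
  by (auto simp: sq_integrable_def)

lemma integrable_inner:
  "sq_integrable M f \<Longrightarrow> sq_integrable M g \<Longrightarrow> integrable M (\<lambda>x. f x * cnj (g x))"
  by (intro integrable_mult_sq sq_integrable_cnj)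

lemma l2inner_commute: "l2inner M g f = cnj (l2inner M f g)"
  unfolding l2inner_def
  by (subst Bochner_Integration.integral_cnj[symmetric]) (simp add: mult.commute)

lemma l2inner_add_left:
  assumes "sq_integrable M f" "sq_integrable M g" "sq_integrable M h"
  shows "l2inner M (\<lambda>x. f x + g x) h = l2inner M f h + l2inner M g h"
  unfolding l2inner_def using assms
  by (simp add: ring_distribs Bochner_Integration.integral_add[OF integrable_inner integrable_inner])

lemma l2inner_diff_left:
  assumes "sq_integrable M f" "sq_integrable M g" "sq_integrable M h"
  shows "l2inner M (\<lambda>x. f x - g x) h = l2inner M f h - l2inner M g h"
  unfolding l2inner_def using assms
  by (simp add: ring_distribs Bochner_Integration.integral_diff[OF integrable_inner integrable_inner])

lemma l2inner_cmult_left: "l2inner M (\<lambda>x. c * f x) h = c * l2inner M f h"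
  by (simp add: l2inner_def mult.assoc)

lemma l2inner_add_right:
  assumes "sq_integrable M f" "sq_integrable M g" "sq_integrable M h"
  shows "l2inner M h (\<lambda>x. f x + g x) = l2inner M h f + l2inner M h g"
  by (metis l2inner_commute l2inner_add_left[OF assms] complex_cnj_add)

lemma l2inner_cmult_right: "l2inner M h (\<lambda>x. c * f x) = cnj c * l2inner M h f"
  by (metis l2inner_commute l2inner_cmult_left complex_cnj_mult)

text \<open>For every \<open>s > 0\<close> the pointwise bound \<open>2 |f g| \<le> s |f|\<^sup>2 + |g|\<^sup>2 / s\<close> integrates; the
  Cauchy-Schwarz inequality is the optimal choice of \<open>s\<close>.\<close>

lemma Cauchy_Schwarz_integral:
  assumes "sq_integrable M f" "sq_integrable M g"
  shows "(\<integral>x. cmod (f x * g x) \<partial>M) \<le> l2norm M f * l2norm M g"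
proof -
  let ?I = "\<integral>x. cmod (f x * g x) \<partial>M" and ?a = "l2norm M f" and ?b = "l2norm M g"
  have main: "2 * ?I \<le> s * ?a\<^sup>2 + ?b\<^sup>2 / s" if "s > 0" for s
  proof -
    have "?I \<le> (\<integral>x. (s * (cmod (f x))\<^sup>2 + (cmod (g x))\<^sup>2 / s) / 2 \<partial>M)"
    proof (rule integral_mono)
      show "integrable M (\<lambda>x. cmod (f x * g x))"
        using integrable_mult_sq[OF assms] by simp
      show "integrable M (\<lambda>x. (s * (cmod (f x))\<^sup>2 + (cmod (g x))\<^sup>2 / s) / 2)"
        using assms by (auto simp: sq_integrable_def)
      fix x
      have "0 \<le> (s * cmod (f x) - cmod (g x))\<^sup>2 / s" using that by simp
      also have "\<dots> = s * (cmod (f x))\<^sup>2 + (cmod (g x))\<^sup>2 / s - 2 * (cmod (f x) * cmod (g x))"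
        using that by (simp add: power2_eq_square field_simps)
      finally show "cmod (f x * g x) \<le> (s * (cmod (f x))\<^sup>2 + (cmod (g x))\<^sup>2 / s) / 2"
        by (simp add: norm_mult)
    qed
    also have "\<dots> = (s * ?a\<^sup>2 + ?b\<^sup>2 / s) / 2"
      using assms by (simp add: sq_integrable_def l2norm_square)
    finally show ?thesis by simp
  qed
  have nn: "0 \<le> ?a" "0 \<le> ?b" by simp_all
  consider "?a > 0" "?b > 0" | "?a = 0" | "?b = 0" using nn by linarith
  then show ?thesis
  proof cases
    case 1
    then show ?thesis using main[of "?b / ?a"] by (simp add: power2_eq_square)
  next
    case 2
    have "?I \<le> e" if "e > 0" for e
    proof -
      have "2 * ?I \<le> ?b\<^sup>2 / ((?b\<^sup>2 + 1) / e)"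
        using main[of "(?b\<^sup>2 + 1) / e"] 2 that by (simp add: add_nonneg_pos)
      also have "\<dots> = e * (?b\<^sup>2 / (?b\<^sup>2 + 1))" by simp
      also have "\<dots> \<le> e * 1"
        using that by (intro mult_left_mono) (auto simp: divide_le_eq_1 add_nonneg_pos)
      finally show ?thesis using that by simp
    qed
    then show ?thesis using 2 by (simp add: field_le_epsilon)
  next
    case 3
    have "?I \<le> e" if "e > 0" for e
    proof -
      have "2 * ?I \<le> (e / (?a\<^sup>2 + 1)) * ?a\<^sup>2"
        using main[of "e / (?a\<^sup>2 + 1)"] 3 that by (simp add: add_nonneg_pos)
      also have "\<dots> = e * (?a\<^sup>2 / (?a\<^sup>2 + 1))" by simp
      also have "\<dots> \<le> e * 1"
        using that by (intro mult_left_mono) (auto simp: divide_le_eq_1 add_nonneg_pos)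
      finally show ?thesis using that by simp
    qed
    then show ?thesis using 3 by (simp add: field_le_epsilon)
  qed
qed

lemma norm_l2inner_le:
  assumes "sq_integrable M f" "sq_integrable M g"
  shows "cmod (l2inner M f g) \<le> l2norm M f * l2norm M g"
proof -
  have "cmod (l2inner M f g) \<le> (\<integral>x. cmod (f x * cnj (g x)) \<partial>M)"
    unfolding l2inner_def by (rule integral_norm_bound)
  also have "\<dots> \<le> l2norm M f * l2norm M (\<lambda>x. cnj (g x))"
    by (intro Cauchy_Schwarz_integral assms sq_integrable_cnj)
  finally show ?thesis by (simp add: l2norm_def)
qed

lemma l2norm_triangle:
  assumes f: "sq_integrable M f" and g: "sq_integrable M g"
  shows "l2norm M (\<lambda>x. f x + g x) \<le> l2norm M f + l2norm M g"
proof (rule power2_le_imp_le)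
  have "(l2norm M (\<lambda>x. f x + g x))\<^sup>2 \<le>
      (\<integral>x. (cmod (f x))\<^sup>2 + (cmod (g x))\<^sup>2 + 2 * cmod (f x * g x) \<partial>M)"
    unfolding l2norm_square
  proof (rule integral_mono)
    show "integrable M (\<lambda>x. (cmod (f x + g x))\<^sup>2)"
      using sq_integrable_add[OF f g] by (simp add: sq_integrable_def)
    show "integrable M (\<lambda>x. (cmod (f x))\<^sup>2 + (cmod (g x))\<^sup>2 + 2 * cmod (f x * g x))"
      using f g integrable_mult_sq[OF f g] by (simp add: sq_integrable_def)
    fix x
    have "(cmod (f x + g x))\<^sup>2 \<le> (cmod (f x) + cmod (g x))\<^sup>2"
      by (intro power_mono norm_triangle_ineq) auto
    then show "(cmod (f x + g x))\<^sup>2 \<le> (cmod (f x))\<^sup>2 + (cmod (g x))\<^sup>2 + 2 * cmod (f x * g x)"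
      by (simp add: power2_sum norm_mult)
  qed
  also have "\<dots> = (l2norm M f)\<^sup>2 + (l2norm M g)\<^sup>2 + 2 * (\<integral>x. cmod (f x * g x) \<partial>M)"
    using f g integrable_mult_sq[OF f g] by (simp add: sq_integrable_def l2norm_square)
  also have "\<dots> \<le> (l2norm M f + l2norm M g)\<^sup>2"
    using Cauchy_Schwarz_integral[OF f g] by (simp add: power2_sum)
  finally show "(l2norm M (\<lambda>x. f x + g x))\<^sup>2 \<le> (l2norm M f + l2norm M g)\<^sup>2" .
qed simp

lemma l2norm_triangle_diff:
  assumes "sq_integrable M f" "sq_integrable M g" "sq_integrable M h"
  shows "l2norm M (\<lambda>x. f x - h x) \<le> l2norm M (\<lambda>x. f x - g x) + l2norm M (\<lambda>x. g x - h x)"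
  using l2norm_triangle[OF sq_integrable_diff[OF assms(1,2)] sq_integrable_diff[OF assms(2,3)]]
  by simp

lemma l2norm_diff_ge:
  assumes "sq_integrable M f" "sq_integrable M g"
  shows "\<bar>l2norm M f - l2norm M g\<bar> \<le> l2norm M (\<lambda>x. f x - g x)"
  using l2norm_triangle[OF sq_integrable_diff[OF assms] assms(2)]
        l2norm_triangle[OF sq_integrable_diff[OF assms(2,1)] assms(1)]
        l2norm_minus_commute[of M f g]
  by simp

lemma l2norm_zero_iff_AE:
  assumes "sq_integrable M f"
  shows "l2norm M f = 0 \<longleftrightarrow> (AE x in M. f x = 0)"
  using integral_nonneg_eq_0_iff_AE[of M "\<lambda>x. (cmod (f x))\<^sup>2"] assms
  by (simp add: l2norm_def sq_integrable_def)

text \<open>Fatou's lemma, in the form in which it is used throughout: a norm bound survives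
  almost everywhere convergence.\<close>

lemma l2_Fatou:
  assumes F: "\<And>n. sq_integrable M (F n)" and [measurable]: "f \<in> borel_measurable M"
    and lim: "AE x in M. (\<lambda>n. F n x) \<longlonglongrightarrow> f x" and le: "\<And>n. l2norm M (F n) \<le> C"
  shows "sq_integrable M f \<and> l2norm M f \<le> C"
proof -
  have [measurable]: "F n \<in> borel_measurable M" for n
    using F by (simp add: sq_integrable_def)
  have C: "0 \<le> C" using le[of 0] l2norm_nonneg[of M "F 0"] by linarith
  have "(\<integral>\<^sup>+x. ennreal ((cmod (f x))\<^sup>2) \<partial>M) =
      (\<integral>\<^sup>+x. liminf (\<lambda>n. ennreal ((cmod (F n x))\<^sup>2)) \<partial>M)"
  proof (rule nn_integral_cong_AE)
    show "AE x in M. ennreal ((cmod (f x))\<^sup>2) = liminf (\<lambda>n. ennreal ((cmod (F n x))\<^sup>2))"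
      using lim
    proof eventually_elim
      case (elim x)
      then have "(\<lambda>n. ennreal ((cmod (F n x))\<^sup>2)) \<longlonglongrightarrow> ennreal ((cmod (f x))\<^sup>2)"
        by (intro tendsto_intros)
      then show ?case by (intro lim_imp_Liminf[symmetric]) simp_all
    qed
  qed
  also have "\<dots> \<le> liminf (\<lambda>n. \<integral>\<^sup>+x. ennreal ((cmod (F n x))\<^sup>2) \<partial>M)"
    by (rule nn_integral_liminf) simp
  also have "\<dots> \<le> limsup (\<lambda>n. \<integral>\<^sup>+x. ennreal ((cmod (F n x))\<^sup>2) \<partial>M)"
    by (rule Liminf_le_Limsup) simp
  also have "\<dots> \<le> ennreal (C\<^sup>2)"
  proof (rule Limsup_bounded, rule always_eventually, rule allI)
    fix n
    have "(\<integral>\<^sup>+x. ennreal ((cmod (F n x))\<^sup>2) \<partial>M) = ennreal ((l2norm M (F n))\<^sup>2)"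
      unfolding l2norm_square using F[of n]
      by (intro nn_integral_eq_integral) (auto simp: sq_integrable_def)
    also have "\<dots> \<le> ennreal (C\<^sup>2)"
      using le[of n] by (intro ennreal_leI power_mono) auto
    finally show "(\<integral>\<^sup>+x. ennreal ((cmod (F n x))\<^sup>2) \<partial>M) \<le> ennreal (C\<^sup>2)" .
  qed
  finally have bd: "(\<integral>\<^sup>+x. ennreal ((cmod (f x))\<^sup>2) \<partial>M) \<le> ennreal (C\<^sup>2)" .
  then have int: "integrable M (\<lambda>x. (cmod (f x))\<^sup>2)"
    by (intro integrableI_bounded) (auto simp: less_top[symmetric] top_unique)
  moreover have "l2norm M f \<le> C"
  proof (rule power2_le_imp_le)
    show "(l2norm M f)\<^sup>2 \<le> C\<^sup>2"
      using bd unfolding l2norm_square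
      by (subst (asm) nn_integral_eq_integral[OF int]) auto
  qed fact
  ultimately show ?thesis by (simp add: sq_integrable_def)
qed

text \<open>Riesz-Fischer. The speed \<open>4 ^ (- k)\<close> leaves room for the weight \<open>2 ^ k\<close>: since
  \<open>\<Sum>k. 2 ^ k * |F (k + 1) - F k|\<^sup>2\<close> has finite integral, it is finite almost everywhere, and there
  the increments are at most of order \<open>2 ^ (- k / 2)\<close>.\<close>

lemma l2_complete:
  assumes F: "\<And>n. sq_integrable M (F n)"
    and C: "\<And>k m. k \<le> m \<Longrightarrow> l2norm M (\<lambda>x. F m x - F k x) \<le> (1/4) ^ k"
  shows "\<exists>g. sq_integrable M g \<and> (\<lambda>k. l2norm M (\<lambda>x. F k x - g x)) \<longlonglongrightarrow> 0"
proof -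
  have [measurable]: "F n \<in> borel_measurable M" for n
    using F by (simp add: sq_integrable_def)
  define D where "D k x = F (Suc k) x - F k x" for k x
  have D: "sq_integrable M (D k)" for k
    unfolding D_def by (intro sq_integrable_diff F)
  have [measurable]: "D k \<in> borel_measurable M" for k
    using D by (simp add: sq_integrable_def)
  have "(\<integral>\<^sup>+x. (\<Sum>k. ennreal (2 ^ k * (cmod (D k x))\<^sup>2)) \<partial>M) =
      (\<Sum>k. \<integral>\<^sup>+x. ennreal (2 ^ k * (cmod (D k x))\<^sup>2) \<partial>M)"
    by (rule nn_integral_suminf) simp
  also have "\<dots> \<le> (\<Sum>k. ennreal ((1/8) ^ k))"
  proof (rule suminf_le)
    fix k
    have "(\<integral>\<^sup>+x. ennreal (2 ^ k * (cmod (D k x))\<^sup>2) \<partial>M) = ennreal (2 ^ k * (l2norm M (D k))\<^sup>2)"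
      using D[of k]
      by (subst nn_integral_eq_integral) (auto simp: sq_integrable_def l2norm_square)
    also have "\<dots> \<le> ennreal (2 ^ k * ((1/4) ^ k)\<^sup>2)"
      using C[of k "Suc k"] by (intro ennreal_leI mult_left_mono power_mono) (auto simp: D_def[abs_def])
    also have "2 ^ k * ((1/4) ^ k)\<^sup>2 = (1/8::real) ^ k"
      by (simp add: power2_eq_square flip: power_mult_distrib)
    finally show "(\<integral>\<^sup>+x. ennreal (2 ^ k * (cmod (D k x))\<^sup>2) \<partial>M) \<le> ennreal ((1/8) ^ k)" .
  qed auto
  also have "\<dots> < \<infinity>"
    by (subst suminf_ennreal_eq[OF _ geometric_sums]) auto
  finally have "AE x in M. (\<Sum>k. ennreal (2 ^ k * (cmod (D k x))\<^sup>2)) \<noteq> \<infinity>"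
    by (intro nn_integral_PInf_AE) auto
  then have conv: "AE x in M. convergent (\<lambda>n. F n x)"
  proof eventually_elim
    case (elim x)
    then have "summable (\<lambda>k. 2 ^ k * (cmod (D k x))\<^sup>2)"
      by (intro summable_suminf_not_top) auto
    then have "Bseq (\<lambda>k. 2 ^ k * (cmod (D k x))\<^sup>2)"
      using summable_LIMSEQ_zero convergent_imp_Bseq convergentI by blast
    then obtain B where B: "\<And>k. norm (2 ^ k * (cmod (D k x))\<^sup>2) \<le> B"
      by (auto simp: Bseq_def)
    have "summable (\<lambda>k. D k x)"
    proof (rule summable_comparison_test')
      show "summable (\<lambda>k. sqrt B * (1 / sqrt 2) ^ k)"
        by (intro summable_mult summable_geometric) auto
      fix k
      have "(cmod (D k x))\<^sup>2 \<le> B / 2 ^ k"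
        using B[of k] by (simp add: field_simps abs_mult)
      then have "cmod (D k x) \<le> sqrt (B / 2 ^ k)"
        by (rule real_le_rsqrt)
      then show "norm (D k x) \<le> sqrt B * (1 / sqrt 2) ^ k"
        by (simp add: real_sqrt_divide real_sqrt_power power_one_over divide_simps)
    qed
    then have "convergent (\<lambda>n. \<Sum>k<n. D k x)"
      by (simp add: summable_iff_convergent)
    moreover have "(\<Sum>k<n. D k x) = F n x - F 0 x" for n
      unfolding D_def by (rule sum_lessThan_telescope)
    ultimately have "convergent (\<lambda>n. F n x - F 0 x + F 0 x)"
      by (intro convergent_add convergent_const) simp
    then show ?case by simp
  qed
  define g where "g x = lim (\<lambda>n. F n x)" for x
  have [measurable]: "g \<in> borel_measurable M"
    unfolding g_def by measurable
  have lim: "AE x in M. (\<lambda>n. F n x) \<longlonglongrightarrow> g x"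
    using conv by eventually_elim (simp add: g_def convergent_LIMSEQ_iff)
  have gk: "sq_integrable M (\<lambda>x. F k x - g x) \<and> l2norm M (\<lambda>x. F k x - g x) \<le> (1/4) ^ k" for k
  proof (rule l2_Fatou)
    show "sq_integrable M (\<lambda>x. F k x - F (n + k) x)" for n
      by (intro sq_integrable_diff F)
    show "l2norm M (\<lambda>x. F k x - F (n + k) x) \<le> (1/4) ^ k" for n
      using C[of k "n + k"] by (simp add: l2norm_minus_commute)
    show "AE x in M. (\<lambda>n. F k x - F (n + k) x) \<longlonglongrightarrow> F k x - g x"
      using lim by eventually_elim (intro tendsto_intros LIMSEQ_ignore_initial_segment)
  qed simp
  have "sq_integrable M g"
    using sq_integrable_diff[OF F[of 0] conjunct1[OF gk[of 0]]] by simp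
  moreover have "(\<lambda>k. l2norm M (\<lambda>x. F k x - g x)) \<longlonglongrightarrow> 0"
  proof (rule tendsto_sandwich[OF _ _ tendsto_const])
    show "(\<lambda>k. (1/4::real) ^ k) \<longlonglongrightarrow> 0" by (intro LIMSEQ_power_zero) auto
  qed (use gk in auto)
  ultimately show ?thesis by auto
qed

section \<open>Gaussian integrals with complex parameters\<close>

text \<open>Since \<open>|exp k - 1| \<le> |k| exp |k|\<close>, the difference quotients of the integrand near \<open>z\<close> are bounded
  by a multiple of its absolute values at the two points \<open>z \<plusminus> 2 d\<close> on the real direction, which are
  integrable as soon as these points lie in the open set. Dominated convergence then gives complex
  differentiability.\<close>

lemma holomorphic_exp_integral:
  fixes u :: "'a \<Rightarrow> complex" and h :: "'a \<Rightarrow> real"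
  assumes [measurable]: "u \<in> borel_measurable M" "h \<in> borel_measurable M"
    and S: "open S"
    and int: "\<And>z. z \<in> S \<Longrightarrow> integrable M (\<lambda>x. u x * exp (z * of_real (h x)))"
  shows "(\<lambda>z. \<integral>x. u x * exp (z * of_real (h x)) \<partial>M) holomorphic_on S"
proof -
  let ?F = "\<lambda>z. \<integral>x. u x * exp (z * of_real (h x)) \<partial>M"
  have "(?F has_field_derivative (\<integral>x. u x * of_real (h x) * exp (z * of_real (h x)) \<partial>M)) (at z)"
    if z: "z \<in> S" for z
  proof -
    obtain e where e: "e > 0" "cball z e \<subseteq> S"
      using open_contains_cball S z by meson
    define d where "d = e / 2"
    have d: "d > 0" using e by (simp add: d_def)
    have zd: "z + of_real (2 * d) \<in> S" "z - of_real (2 * d) \<in> S"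
      using e by (auto simp: d_def dist_norm)
    let ?w = "\<lambda>x. (cmod (u x * exp ((z + of_real (2*d)) * of_real (h x)))
       + cmod (u x * exp ((z - of_real (2*d)) * of_real (h x)))) / d"
    have w: "integrable M ?w"
      by (intro Bochner_Integration.integrable_divide Bochner_Integration.integrable_add integrable_norm int zd)
    have bound: "cmod ((u x * exp (y * of_real (h x)) - u x * exp (z * of_real (h x))) / (y - z)) \<le> ?w x"
      if y: "y \<noteq> z" "cmod (y - z) < d" for x y
    proof -
      define k where "k = (y - z) * of_real (h x)"
      have "cmod (exp k - 1) \<le> exp (cmod k) * cmod k"
        using Taylor_exp_field[of k 0] by simp
      have "(u x * exp (y * of_real (h x)) - u x * exp (z * of_real (h x))) =
          u x * exp (z * of_real (h x)) * (exp k - 1)"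
        by (simp add: k_def algebra_simps flip: exp_add)
      then have "cmod ((u x * exp (y * of_real (h x)) - u x * exp (z * of_real (h x))) / (y - z)) =
          cmod (u x) * exp (Re z * h x) * (cmod (exp k - 1) / cmod (y - z))"
        by (simp add: norm_mult norm_divide)
      also have "cmod (exp k - 1) / cmod (y - z) \<le> exp (cmod k) * cmod k / cmod (y - z)"
        by (intro divide_right_mono) (fact, simp)
      also have "\<dots> = exp (cmod (y - z) * \<bar>h x\<bar>) * \<bar>h x\<bar>"
        using y by (simp add: k_def norm_mult)
      also have "\<dots> \<le> exp (d * \<bar>h x\<bar>) * (exp (d * \<bar>h x\<bar>) / d)"
      proof (intro mult_mono)
        have "d * \<bar>h x\<bar> \<le> exp (d * \<bar>h x\<bar>)"
          using exp_ge_add_one_self[of "d * \<bar>h x\<bar>"] by linarith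
        then show "\<bar>h x\<bar> \<le> exp (d * \<bar>h x\<bar>) / d"
          using d by (simp add: pos_le_divide_eq mult.commute)
      qed (use y d in \<open>auto intro!: mult_right_mono\<close>)
      also have "\<dots> = exp (2 * d * \<bar>h x\<bar>) / d"
        by (simp flip: exp_add)
      also have "\<dots> \<le> (exp (2 * d * h x) + exp (- (2 * d * h x))) / d"
        using d by (intro divide_right_mono) (auto simp: abs_if)
      finally have "cmod ((u x * exp (y * of_real (h x)) - u x * exp (z * of_real (h x))) / (y - z)) \<le>
          cmod (u x) * exp (Re z * h x) * ((exp (2 * d * h x) + exp (- (2 * d * h x))) / d)"
        by (simp add: mult_left_mono)
      also have "\<dots> = ?w x"
        by (simp add: norm_mult ring_distribs add_divide_distrib mult.assoc mult_exp_exp)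
      finally show ?thesis .
    qed
    show ?thesis
      unfolding has_field_derivative_iff tendsto_at_iff_sequentially comp_def
    proof (intro allI impI)
      fix X assume X: "\<forall>i. X i \<in> UNIV - {z}" "X \<longlonglongrightarrow> z"
      have "eventually (\<lambda>n. dist (X n) z < d) sequentially"
        using X(2) d by (rule tendstoD)
      then obtain N where N: "\<And>n. n \<ge> N \<Longrightarrow> cmod (X n - z) < d"
        by (auto simp: eventually_sequentially dist_norm)
      have Xat: "filterlim (\<lambda>n. X (n + N)) (at z) sequentially"
        using X(1) LIMSEQ_ignore_initial_segment[OF X(2), of N] by (simp add: filterlim_at)
      have lim: "(\<lambda>n. \<integral>x. (u x * exp (X (n + N) * of_real (h x)) - u x * exp (z * of_real (h x))) / (X (n + N) - z) \<partial>M)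
         \<longlonglongrightarrow> (\<integral>x. u x * of_real (h x) * exp (z * of_real (h x)) \<partial>M)"
      proof (rule integral_dominated_convergence[OF _ _ w])
        show "AE x in M. (\<lambda>n. (u x * exp (X (n + N) * of_real (h x)) - u x * exp (z * of_real (h x))) / (X (n + N) - z))
           \<longlonglongrightarrow> u x * of_real (h x) * exp (z * of_real (h x))"
        proof (rule AE_I2)
          fix x
          have "((\<lambda>y. u x * exp (y * of_real (h x))) has_field_derivative
              u x * of_real (h x) * exp (z * of_real (h x))) (at z)"
            by (rule derivative_eq_intros refl | simp)+
          then have "((\<lambda>y. (u x * exp (y * of_real (h x)) - u x * exp (z * of_real (h x))) / (y - z)) \<longlongrightarrow>
              u x * of_real (h x) * exp (z * of_real (h x))) (at z)"
            by (simp add: has_field_derivative_iff)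
          then show "(\<lambda>n. (u x * exp (X (n + N) * of_real (h x)) - u x * exp (z * of_real (h x))) / (X (n + N) - z))
           \<longlonglongrightarrow> u x * of_real (h x) * exp (z * of_real (h x))"
            using Xat by (rule filterlim_compose)
        qed
        show "AE x in M. cmod ((u x * exp (X (n + N) * of_real (h x)) - u x * exp (z * of_real (h x))) / (X (n + N) - z)) \<le> ?w x" for n
          using bound N[of "n + N"] X(1) by (intro AE_I2) auto
      qed measurable
      have "eventually (\<lambda>n. X (n + N) \<in> S) sequentially"
        using LIMSEQ_ignore_initial_segment[OF X(2), of N] S z by (rule topological_tendstoD)
      then have "eventually (\<lambda>n. (\<integral>x. (u x * exp (X (n + N) * of_real (h x)) - u x * exp (z * of_real (h x))) / (X (n + N) - z) \<partial>M)
          = (?F (X (n + N)) - ?F z) / (X (n + N) - z)) sequentially"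
        by eventually_elim (use int z in simp)
      with lim have "(\<lambda>n. (?F (X (n + N)) - ?F z) / (X (n + N) - z)) \<longlonglongrightarrow> (\<integral>x. u x * of_real (h x) * exp (z * of_real (h x)) \<partial>M)"
        by (rule Lim_transform_eventually)
      then show "(\<lambda>n. (?F (X n) - ?F z) / (X n - z)) \<longlonglongrightarrow> (\<integral>x. u x * of_real (h x) * exp (z * of_real (h x)) \<partial>M)"
        by (rule LIMSEQ_offset)
    qed
  qed
  then show ?thesis
    using S by (auto simp: holomorphic_on_open)
qed

lemma real_gaussian_integral:
  fixes c b :: real
  assumes c: "c > 0"
  shows "integrable lborel (\<lambda>x. exp (b * x - c * x\<^sup>2))"
    and "(\<integral>x. exp (b * x - c * x\<^sup>2) \<partial>lborel) = sqrt (pi / c) * exp (b\<^sup>2 / (4 * c))"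
proof -
  let ?K = "sqrt (pi / c) * exp (b\<^sup>2 / (4 * c))"
  have eq: "exp (b * x - c * x\<^sup>2) = ?K * normal_density (b / (2 * c)) (1 / sqrt (2 * c)) x" for x
  proof -
    have nd: "normal_density (b / (2 * c)) (1 / sqrt (2 * c)) x = sqrt (c / pi) * exp (- c * (x - b / (2*c))\<^sup>2)"
    proof -
      have "(1 / sqrt (2 * c))\<^sup>2 = 1 / (2 * c)"
        using c by (simp add: power_divide)
      then show ?thesis
        using c by (simp add: normal_density_def real_sqrt_divide mult.commute)
    qed
    have "b * x - c * x\<^sup>2 = b\<^sup>2 / (4 * c) + (- c * (x - b / (2*c))\<^sup>2)"
      using c by (simp add: power2_eq_square field_simps)
    then have "exp (b * x - c * x\<^sup>2) = exp (b\<^sup>2 / (4 * c)) * exp (- c * (x - b / (2*c))\<^sup>2)"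
      by (simp only: exp_add)
    moreover have "sqrt (pi / c) * sqrt (c / pi) = 1"
      using c by (simp flip: real_sqrt_mult)
    ultimately show ?thesis unfolding nd by algebra
  qed
  show "integrable lborel (\<lambda>x. exp (b * x - c * x\<^sup>2))"
    unfolding eq using c by simp
  show "(\<integral>x. exp (b * x - c * x\<^sup>2) \<partial>lborel) = ?K"
    unfolding eq using c by simp
qed

lemma complex_gaussian_integrable:
  fixes c b :: complex
  assumes c: "Re c > 0"
  shows "integrable lborel (\<lambda>x. exp (b * of_real x - c * of_real (x\<^sup>2)))"
  using real_gaussian_integral(1)[OF c, of "Re b"]
  by (rule Bochner_Integration.integrable_bound) (auto simp: norm_exp_eq_Re)

text \<open>Two analytic continuations from the real formula: for \<open>c > 0\<close> both sides are entire in \<open>b\<close>, and for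
  each fixed complex \<open>b\<close> they are holomorphic in \<open>c\<close> on the right half plane. The principal root is
  the correct branch because it is holomorphic there and positive for positive \<open>c\<close>.\<close>

lemma complex_gaussian_integral:
  fixes c b :: complex
  assumes c: "Re c > 0"
  shows "csqrt c * (\<integral>x. exp (b * of_real x - c * of_real (x\<^sup>2)) \<partial>lborel) =
    of_real (sqrt pi) * exp (b\<^sup>2 / (4 * c))"
proof -
  let ?G = "\<lambda>b c. \<integral>x. exp (b * of_real x - c * of_real (x\<^sup>2)) \<partial>lborel"
  have posreal_limpt: "(1::complex) islimpt of_real ` {0<..}"
    unfolding islimpt_sequential
  proof (intro exI conjI allI)
    let ?r = "\<lambda>n. 1 + inverse (real (Suc n))"
    show "(\<lambda>n. complex_of_real (?r n)) \<longlonglongrightarrow> 1"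
      using tendsto_of_real[OF LIMSEQ_inverse_real_of_nat_add[of 1], where 'a = complex] by simp
    fix n :: nat
    have r: "?r n > 0" "?r n \<noteq> 1" by (simp_all add: add_pos_pos del: of_nat_Suc)
    from r(2) have "complex_of_real (?r n) \<noteq> of_real 1" by (simp only: of_real_eq_iff not_False_eq_True)
    then show "complex_of_real (?r n) \<in> of_real ` {0<..} - {1}"
      using r(1) by (simp only: of_real_1 Diff_iff singleton_iff not_False_eq_True) blast
  qed
  have 1: "csqrt (of_real t) * ?G b (of_real t) = of_real (sqrt pi) * exp (b\<^sup>2 / (4 * of_real t))"
    if t: "t > 0" for t :: real and b
  proof -
    let ?f = "\<lambda>b. csqrt (of_real t) * ?G b (of_real t) - of_real (sqrt pi) * exp (b\<^sup>2 / (4 * of_real t))"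
    have eq1: "exp (- of_real (t * x\<^sup>2)) * exp (z * complex_of_real x) =
        exp (z * of_real x - of_real t * of_real (x\<^sup>2))" for z x
      by (simp add: mult_exp_exp)
    have "(\<lambda>b. \<integral>x. exp (- of_real (t * x\<^sup>2)) * exp (b * complex_of_real x) \<partial>lborel) holomorphic_on UNIV"
    proof (rule holomorphic_exp_integral)
      show "complex_integrable lborel (\<lambda>x. exp (- of_real (t * x\<^sup>2)) * exp (z * complex_of_real x))" for z
        unfolding eq1 using t by (intro complex_gaussian_integrable) simp
    qed auto
    then have "(\<lambda>b. ?G b (of_real t)) holomorphic_on UNIV"
      unfolding eq1 .
    moreover have "(\<lambda>b. exp (b\<^sup>2 / (4 * complex_of_real t))) holomorphic_on UNIV"
      using t by (intro holomorphic_intros) auto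
    ultimately have hol: "?f holomorphic_on UNIV"
      by (intro holomorphic_on_diff holomorphic_on_mult holomorphic_on_const)
    have "?f b = 0"
    proof (rule analytic_continuation[OF hol open_UNIV connected_UNIV _ _ posreal_limpt])
      \<comment> \<open>On the positive reals the identity is the real Gaussian integral.\<close>
      fix z :: complex assume "z \<in> of_real ` {0<..}"
      then obtain s where s: "z = of_real s" by auto
      have "exp (z * of_real x - of_real t * of_real (x\<^sup>2)) = complex_of_real (exp (s * x - t * x\<^sup>2))" for x
        unfolding s by (simp flip: exp_of_real)
      then have "?G z (of_real t) = (\<integral>x. complex_of_real (exp (s * x - t * x\<^sup>2)) \<partial>lborel)"
        by (simp only:)
      also have "\<dots> = of_real (sqrt (pi / t) * exp (s\<^sup>2 / (4 * t)))"
        using real_gaussian_integral(2)[OF t, of s] by (simp only: integral_complex_of_real)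
      finally have "csqrt (of_real t) * ?G z (of_real t) =
          of_real (sqrt t * (sqrt (pi / t) * exp (s\<^sup>2 / (4 * t))))"
        by (simp only: of_real_sqrt[OF less_imp_le[OF t], symmetric] of_real_mult)
      also have "sqrt t * (sqrt (pi / t) * exp (s\<^sup>2 / (4 * t))) = sqrt pi * exp (s\<^sup>2 / (4 * t))"
        using t by (simp add: real_sqrt_divide)
      finally show "?f z = 0"
        using t by (simp add: s flip: exp_of_real)
    qed auto
    then show ?thesis by simp
  qed
  let ?S = "{c::complex. 0 < Re c}"
  let ?f = "\<lambda>c. csqrt c * ?G b c - of_real (sqrt pi) * exp (b\<^sup>2 / (4 * c))"
  have eq2: "exp (b * complex_of_real x) * exp (z * complex_of_real (- x\<^sup>2)) =
      exp (b * of_real x - z * of_real (x\<^sup>2))" for z x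
    by (simp add: mult_exp_exp)
  have "(\<lambda>c. \<integral>x. exp (b * complex_of_real x) * exp (c * complex_of_real (- x\<^sup>2)) \<partial>lborel) holomorphic_on ?S"
  proof (rule holomorphic_exp_integral)
    show "complex_integrable lborel (\<lambda>x. exp (b * complex_of_real x) * exp (z * complex_of_real (- x\<^sup>2)))"
      if "z \<in> ?S" for z
      unfolding eq2 using that by (intro complex_gaussian_integrable) simp
  qed (auto simp: open_halfspace_Re_gt)
  then have "?G b holomorphic_on ?S"
    unfolding eq2 .
  moreover have "csqrt holomorphic_on ?S"
    by (intro holomorphic_on_subset[OF holomorphic_on_csqrt]) (auto simp: complex_nonpos_Reals_iff)
  moreover have "(\<lambda>c. exp (b\<^sup>2 / (4 * c))) holomorphic_on ?S"
    by (intro holomorphic_intros) auto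
  ultimately have hol: "?f holomorphic_on ?S"
    by (intro holomorphic_on_diff holomorphic_on_mult holomorphic_on_const)
  have "?f c = 0"
  proof (rule analytic_continuation[OF hol _ _ _ _ posreal_limpt])
    show "open ?S" by (rule open_halfspace_Re_gt)
    show "connected ?S" by (intro convex_connected convex_halfspace_Re_gt)
    fix z :: complex assume "z \<in> of_real ` {0<..}"
    then show "?f z = 0" using 1 by auto
  qed (use c in auto)
  then show ?thesis by simp
qed

section \<open>Coherent states and their Gram form\<close>

text \<open>Normalised to a probability measure, so that its norm is the component of \<open>L2T_norm\<close> without a
  further factor.\<close>

definition gauss :: "real \<Rightarrow> real measure" where
  "gauss \<sigma> = density lborel (\<lambda>x. ennreal (sqrt (\<sigma> / pi) * exp (- \<sigma> * x\<^sup>2)))"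

text \<open>Coherent states: \<open>coh \<sigma> t x\<close> is the sum of \<open>t ^ n / n! * H\<^sub>n x\<close> over \<open>n\<close>, where \<open>H\<^sub>n\<close> are the Hermite
  polynomials of the weight \<open>exp (- \<sigma> x\<^sup>2)\<close>.\<close>

definition coh :: "real \<Rightarrow> complex \<Rightarrow> real \<Rightarrow> complex" where
  "coh \<sigma> t x = exp (2 * of_real \<sigma> * t * of_real x - of_real \<sigma> * t\<^sup>2)"

lemma sets_gauss [simp, measurable_cong]: "sets (gauss \<sigma>) = sets borel"
  by (simp add: gauss_def)

lemma measurable_gauss [simp]: "measurable (gauss \<sigma>) N = measurable borel N"
  by (rule measurable_cong_sets) simp_all

lemma space_gauss [simp]: "space (gauss \<sigma>) = UNIV"
  by (simp add: gauss_def)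

lemma integral_gauss:
  fixes f :: "real \<Rightarrow> 'b::{banach, second_countable_topology}"
  assumes "\<sigma> > 0" "f \<in> borel_measurable borel"
  shows "(\<integral>x. f x \<partial>gauss \<sigma>) = (\<integral>x. (sqrt (\<sigma> / pi) * exp (- \<sigma> * x\<^sup>2)) *\<^sub>R f x \<partial>lborel)"
  unfolding gauss_def using assms by (intro integral_density) auto

lemma integrable_gauss:
  fixes f :: "real \<Rightarrow> 'b::{banach, second_countable_topology}"
  assumes "\<sigma> > 0" "f \<in> borel_measurable borel"
  shows "integrable (gauss \<sigma>) f \<longleftrightarrow> integrable lborel (\<lambda>x. (sqrt (\<sigma> / pi) * exp (- \<sigma> * x\<^sup>2)) *\<^sub>R f x)"
  unfolding gauss_def using assms by (intro integrable_density) auto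

lemma AE_gauss_iff:
  assumes "\<sigma> > 0"
  shows "(AE x in gauss \<sigma>. P x) \<longleftrightarrow> (AE x in lborel. P x)"
  unfolding gauss_def using assms by (subst AE_density) (auto simp: ennreal_less_zero_iff)

text \<open>The weight adds \<open>\<sigma>\<close> to the quadratic coefficient, so \<open>c\<close> may go down to real part \<open>- \<sigma>\<close>.\<close>

lemma gauss_exp_integral:
  fixes b c :: complex
  assumes \<sigma>: "\<sigma> > 0" and c: "Re c > - \<sigma>"
  shows "integrable (gauss \<sigma>) (\<lambda>x. exp (b * of_real x - c * of_real (x\<^sup>2)))"
    and "csqrt (of_real \<sigma> + c) * (\<integral>x. exp (b * of_real x - c * of_real (x\<^sup>2)) \<partial>gauss \<sigma>) =
      of_real (sqrt \<sigma>) * exp (b\<^sup>2 / (4 * (of_real \<sigma> + c)))"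
proof -
  have c': "Re (of_real \<sigma> + c) > 0" using c by simp
  have [measurable]: "(\<lambda>x. exp (b * of_real x - c * of_real (x\<^sup>2))) \<in> borel_measurable borel"
    by simp
  have eq: "(sqrt (\<sigma> / pi) * exp (- \<sigma> * x\<^sup>2)) *\<^sub>R exp (b * of_real x - c * of_real (x\<^sup>2)) =
      of_real (sqrt (\<sigma> / pi)) * exp (b * of_real x - (of_real \<sigma> + c) * of_real (x\<^sup>2))" for x
    by (simp add: scaleR_conv_of_real mult_exp_exp algebra_simps flip: exp_of_real)
  show "integrable (gauss \<sigma>) (\<lambda>x. exp (b * of_real x - c * of_real (x\<^sup>2)))"
    unfolding integrable_gauss[OF \<sigma> \<open>_ \<in> borel_measurable borel\<close>] eq
    by (intro integrable_mult_right complex_gaussian_integrable c')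
  have "(\<integral>x. exp (b * of_real x - c * of_real (x\<^sup>2)) \<partial>gauss \<sigma>) =
      of_real (sqrt (\<sigma> / pi)) * (\<integral>x. exp (b * of_real x - (of_real \<sigma> + c) * of_real (x\<^sup>2)) \<partial>lborel)"
    unfolding integral_gauss[OF \<sigma> \<open>_ \<in> borel_measurable borel\<close>] eq
    by (rule integral_mult_right_zero)
  then have "csqrt (of_real \<sigma> + c) * (\<integral>x. exp (b * of_real x - c * of_real (x\<^sup>2)) \<partial>gauss \<sigma>) =
      of_real (sqrt (\<sigma> / pi)) * (csqrt (of_real \<sigma> + c) *
        (\<integral>x. exp (b * of_real x - (of_real \<sigma> + c) * of_real (x\<^sup>2)) \<partial>lborel))"
    by (simp only: mult.left_commute)
  also have "\<dots> = of_real (sqrt (\<sigma> / pi) * sqrt pi) * exp (b\<^sup>2 / (4 * (of_real \<sigma> + c)))"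
    by (simp only: complex_gaussian_integral[OF c'] of_real_mult mult.assoc)
  also have "sqrt (\<sigma> / pi) * sqrt pi = sqrt \<sigma>"
    by (simp add: real_sqrt_divide)
  finally show "csqrt (of_real \<sigma> + c) * (\<integral>x. exp (b * of_real x - c * of_real (x\<^sup>2)) \<partial>gauss \<sigma>) =
      of_real (sqrt \<sigma>) * exp (b\<^sup>2 / (4 * (of_real \<sigma> + c)))" .
qed

lemma coh_measurable [measurable]: "coh \<sigma> t \<in> borel_measurable borel"
  unfolding coh_def[abs_def] by simp

lemma coh_0 [simp]: "coh \<sigma> 0 x = 1"
  by (simp add: coh_def)

lemma coh_mult: "coh \<sigma> s x * coh \<sigma> t x = exp (2 * of_real \<sigma> * s * t) * coh \<sigma> (s + t) x"
  by (simp add: coh_def mult_exp_exp power2_eq_square algebra_simps)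

lemma cnj_coh: "cnj (coh \<sigma> t x) = coh \<sigma> (cnj t) x"
  by (simp add: coh_def exp_cnj)

lemma coh_integral:
  assumes \<sigma>: "\<sigma> > 0"
  shows "integrable (gauss \<sigma>) (coh \<sigma> t)" and "(\<integral>x. coh \<sigma> t x \<partial>gauss \<sigma>) = 1"
proof -
  have eq: "coh \<sigma> t x = exp (- of_real \<sigma> * t\<^sup>2) * exp ((2 * of_real \<sigma> * t) * of_real x - 0 * of_real (x\<^sup>2))" for x
    by (simp add: coh_def mult_exp_exp)
  note G = gauss_exp_integral[OF \<sigma>, of 0 "2 * of_real \<sigma> * t"]
  show "integrable (gauss \<sigma>) (coh \<sigma> t)"
    unfolding eq[abs_def] using \<sigma> by (intro integrable_mult_right G) simp
  have "(\<integral>x. exp ((2 * of_real \<sigma> * t) * of_real x - 0 * of_real (x\<^sup>2)) \<partial>gauss \<sigma>) = exp (of_real \<sigma> * t\<^sup>2)"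
    using G(2) \<sigma> by (simp add: power2_eq_square csqrt_of_real_nonneg mult_ac)
  then have "(\<integral>x. coh \<sigma> t x \<partial>gauss \<sigma>) = exp (- of_real \<sigma> * t\<^sup>2) * exp (of_real \<sigma> * t\<^sup>2)"
    by (simp only: eq integral_mult_right_zero)
  then show "(\<integral>x. coh \<sigma> t x \<partial>gauss \<sigma>) = 1"
    by (simp add: mult_exp_exp)
qed

lemma sq_integrable_coh:
  assumes \<sigma>: "\<sigma> > 0"
  shows "sq_integrable (gauss \<sigma>) (coh \<sigma> t)"
proof -
  have "complex_of_real ((cmod (coh \<sigma> t x))\<^sup>2) = exp (2 * of_real \<sigma> * t * cnj t) * coh \<sigma> (t + cnj t) x" for x
    unfolding complex_norm_square cnj_coh by (rule coh_mult)
  then have "integrable (gauss \<sigma>) (\<lambda>x. complex_of_real ((cmod (coh \<sigma> t x))\<^sup>2))"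
    using coh_integral(1)[OF \<sigma>] by simp
  then have "integrable (gauss \<sigma>) (\<lambda>x. (cmod (coh \<sigma> t x))\<^sup>2)"
    by (simp only: complex_of_real_integrable_eq)
  then show ?thesis by (simp add: sq_integrable_def)
qed

lemma l2inner_coh:
  assumes \<sigma>: "\<sigma> > 0"
  shows "l2inner (gauss \<sigma>) (coh \<sigma> s) (coh \<sigma> t) = exp (2 * of_real \<sigma> * s * cnj t)"
  unfolding l2inner_def cnj_coh coh_mult using coh_integral(2)[OF \<sigma>] by simp

text \<open>A list of pairs (coefficient, parameter) is a formal linear combination of coherent states, and
  \<open>comb \<sigma> z xs\<close> is its value after every parameter is multiplied by \<open>z\<close>. Formal combinations are used
  so that the effect of the parameter change is defined without proving coherent states to be
  linearly independent.\<close>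

definition comb :: "real \<Rightarrow> complex \<Rightarrow> (complex \<times> complex) list \<Rightarrow> real \<Rightarrow> complex" where
  "comb \<sigma> z xs x = (\<Sum>(c, t) \<leftarrow> xs. c * coh \<sigma> (z * t) x)"

text \<open>Up to a constant factor the \<open>n\<close>-th Hermite coefficient of the combination.\<close>

definition moment :: "(complex \<times> complex) list \<Rightarrow> nat \<Rightarrow> complex" where
  "moment xs n = (\<Sum>(c, t) \<leftarrow> xs. c * t ^ n)"

lemma comb_Nil [simp]: "comb \<sigma> z [] x = 0"
  and comb_Cons: "comb \<sigma> z ((c, t) # xs) x = c * coh \<sigma> (z * t) x + comb \<sigma> z xs x"
  by (simp_all add: comb_def)

lemma comb_append: "comb \<sigma> z (xs @ ys) x = comb \<sigma> z xs x + comb \<sigma> z ys x"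
  by (simp add: comb_def)

lemma comb_cmult: "comb \<sigma> z (map (\<lambda>(c, t). (a * c, t)) xs) x = a * comb \<sigma> z xs x"
  by (induction xs) (auto simp: comb_Cons algebra_simps)

lemma comb_diff:
  "comb \<sigma> z (xs @ map (\<lambda>(c, t). (- 1 * c, t)) ys) x = comb \<sigma> z xs x - comb \<sigma> z ys x"
  by (simp only: comb_append comb_cmult) simp

lemma sq_integrable_comb:
  assumes "\<sigma> > 0"
  shows "sq_integrable (gauss \<sigma>) (comb \<sigma> z xs)"
proof (induction xs)
  case Nil
  then show ?case by (simp add: sq_integrable_def comb_def[abs_def])
next
  case (Cons a xs)
  obtain c t where "a = (c, t)" by force
  then show ?case
    using sq_integrable_add[OF sq_integrable_cmult[OF sq_integrable_coh[OF assms]] Cons]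
    by (simp add: comb_Cons[abs_def])
qed

text \<open>By sesquilinearity this reduces to two coherent states, where it is the exponential series of
  \<open>l2inner_coh\<close>. The modulus of \<open>z\<close> enters only through \<open>|z|\<^sup>2\<close>, the phase cancels.\<close>

lemma l2inner_comb_sums:
  assumes \<sigma>: "\<sigma> > 0"
  shows "(\<lambda>n. of_real ((2 * \<sigma> * (cmod z)\<^sup>2) ^ n / fact n) * (moment xs n * cnj (moment ys n)))
    sums l2inner (gauss \<sigma>) (comb \<sigma> z xs) (comb \<sigma> z ys)"
proof (induction xs)
  case Nil
  then show ?case by (simp add: moment_def l2inner_def)
next
  case (Cons a xs)
  obtain c s where a: "a = (c, s)" by force
  have single: "(\<lambda>n. of_real ((2 * \<sigma> * (cmod z)\<^sup>2) ^ n / fact n) * (s ^ n * cnj (moment ys n)))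
    sums l2inner (gauss \<sigma>) (coh \<sigma> (z * s)) (comb \<sigma> z ys)"
  proof (induction ys)
    case Nil
    then show ?case by (simp add: moment_def l2inner_def)
  next
    case (Cons b ys)
    obtain d t where b: "b = (d, t)" by force
    have "(\<lambda>n. (2 * of_real \<sigma> * (z * s) * cnj (z * t)) ^ n /\<^sub>R fact n) sums exp (2 * of_real \<sigma> * (z * s) * cnj (z * t))"
      by (rule exp_converges)
    moreover have "(2 * of_real \<sigma> * (z * s) * cnj (z * t)) ^ n /\<^sub>R fact n =
        of_real ((2 * \<sigma> * (cmod z)\<^sup>2) ^ n / fact n) * (s ^ n * cnj (t ^ n))" for n
    proof -
      have "2 * of_real \<sigma> * (z * s) * cnj (z * t) = of_real (2 * \<sigma> * (cmod z)\<^sup>2) * s * cnj t"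
        by (simp only: of_real_mult complex_norm_square) simp
      moreover have "(of_real r * s * cnj t) ^ n = of_real (r ^ n) * (s ^ n * cnj (t ^ n))" for r
        by (simp add: power_mult_distrib)
      ultimately have "(2 * of_real \<sigma> * (z * s) * cnj (z * t)) ^ n =
          of_real ((2 * \<sigma> * (cmod z)\<^sup>2) ^ n) * (s ^ n * cnj (t ^ n))"
        by (simp only:)
      then show ?thesis
        by (simp only: scaleR_conv_of_real divide_inverse of_real_mult mult_ac)
    qed
    ultimately have 1: "(\<lambda>n. of_real ((2 * \<sigma> * (cmod z)\<^sup>2) ^ n / fact n) * (s ^ n * cnj (t ^ n)))
        sums l2inner (gauss \<sigma>) (coh \<sigma> (z * s)) (coh \<sigma> (z * t))"
      by (simp add: l2inner_coh[OF \<sigma>])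
    have "comb \<sigma> z (b # ys) = (\<lambda>x. d * coh \<sigma> (z * t) x + comb \<sigma> z ys x)"
      by (simp add: b comb_Cons fun_eq_iff)
    then have 2: "l2inner (gauss \<sigma>) (coh \<sigma> (z * s)) (comb \<sigma> z (b # ys)) =
        cnj d * l2inner (gauss \<sigma>) (coh \<sigma> (z * s)) (coh \<sigma> (z * t)) +
        l2inner (gauss \<sigma>) (coh \<sigma> (z * s)) (comb \<sigma> z ys)"
      using l2inner_add_right[OF sq_integrable_cmult[OF sq_integrable_coh[OF \<sigma>]] sq_integrable_comb[OF \<sigma>]
          sq_integrable_coh[OF \<sigma>]]
      by (simp add: l2inner_cmult_right)
    show ?case
      unfolding 2 using sums_add[OF sums_mult[OF 1, of "cnj d"] Cons]
      by (simp add: moment_def b algebra_simps)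
  qed
  have "comb \<sigma> z (a # xs) = (\<lambda>x. c * coh \<sigma> (z * s) x + comb \<sigma> z xs x)"
    by (simp add: a comb_Cons fun_eq_iff)
  then have 2: "l2inner (gauss \<sigma>) (comb \<sigma> z (a # xs)) (comb \<sigma> z ys) =
      c * l2inner (gauss \<sigma>) (coh \<sigma> (z * s)) (comb \<sigma> z ys) +
      l2inner (gauss \<sigma>) (comb \<sigma> z xs) (comb \<sigma> z ys)"
    using l2inner_add_left[OF sq_integrable_cmult[OF sq_integrable_coh[OF \<sigma>]] sq_integrable_comb[OF \<sigma>]
        sq_integrable_comb[OF \<sigma>]]
    by (simp add: l2inner_cmult_left)
  show ?case
    unfolding 2 using sums_add[OF sums_mult[OF single, of c] Cons]
    by (simp add: moment_def a algebra_simps)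
qed

lemma l2norm_comb_sums:
  assumes \<sigma>: "\<sigma> > 0"
  shows "(\<lambda>n. (2 * \<sigma> * (cmod z)\<^sup>2) ^ n / fact n * (cmod (moment xs n))\<^sup>2)
    sums (l2norm (gauss \<sigma>) (comb \<sigma> z xs))\<^sup>2"
proof -
  have "of_real ((2 * \<sigma> * (cmod z)\<^sup>2) ^ n / fact n) * (moment xs n * cnj (moment xs n)) =
    complex_of_real ((2 * \<sigma> * (cmod z)\<^sup>2) ^ n / fact n * (cmod (moment xs n))\<^sup>2)" for n
    by (simp only: of_real_mult complex_norm_square)
  then show ?thesis
    using l2inner_comb_sums[OF \<sigma>, of z xs xs] by (simp only: l2inner_self sums_of_real_iff)
qed

text \<open>The series of the squared norm is termwise increasing in \<open>|z|\<close>.\<close>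

lemma l2norm_comb_le:
  assumes \<sigma>: "\<sigma> > 0" and z: "cmod z \<le> 1"
  shows "l2norm (gauss \<sigma>) (comb \<sigma> z xs) \<le> l2norm (gauss \<sigma>) (comb \<sigma> 1 xs)"
proof (rule power2_le_imp_le)
  show "(l2norm (gauss \<sigma>) (comb \<sigma> z xs))\<^sup>2 \<le> (l2norm (gauss \<sigma>) (comb \<sigma> 1 xs))\<^sup>2"
  proof (rule sums_le[OF _ l2norm_comb_sums[OF \<sigma>] l2norm_comb_sums[OF \<sigma>]])
    fix n
    have "2 * \<sigma> * (cmod z)\<^sup>2 \<le> 2 * \<sigma> * (cmod 1)\<^sup>2"
      using z \<sigma> by (simp add: power_le_one)
    then show "(2 * \<sigma> * (cmod z)\<^sup>2) ^ n / fact n * (cmod (moment xs n))\<^sup>2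
        \<le> (2 * \<sigma> * (cmod 1)\<^sup>2) ^ n / fact n * (cmod (moment xs n))\<^sup>2"
      using \<sigma> by (intro mult_right_mono divide_right_mono power_mono) auto
  qed
qed simp

lemma l2norm_comb_unimodular:
  assumes "\<sigma> > 0" "cmod z = 1"
  shows "l2norm (gauss \<sigma>) (comb \<sigma> z xs) = l2norm (gauss \<sigma>) (comb \<sigma> 1 xs)"
proof -
  have "(\<lambda>n. (2 * \<sigma> * (cmod z)\<^sup>2) ^ n / fact n * (cmod (moment xs n))\<^sup>2)
    sums (l2norm (gauss \<sigma>) (comb \<sigma> 1 xs))\<^sup>2"
    using l2norm_comb_sums[OF assms(1), of 1 xs] by (simp only: assms(2) norm_one)
  from sums_unique2[OF this l2norm_comb_sums[OF assms(1)]]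
  show ?thesis by (simp add: power2_eq_iff_nonneg)
qed

section \<open>Density of the coherent states\<close>

lemma comb_1_closed_add:
  assumes "f \<in> range (comb \<sigma> 1)" "g \<in> range (comb \<sigma> 1)"
  shows "(\<lambda>x. f x + g x) \<in> range (comb \<sigma> 1)"
proof -
  obtain xs ys where "f = comb \<sigma> 1 xs" "g = comb \<sigma> 1 ys" using assms by auto
  then have "(\<lambda>x. f x + g x) = comb \<sigma> 1 (xs @ ys)" by (simp add: comb_append fun_eq_iff)
  then show ?thesis by simp
qed

lemma comb_1_closed_cmult:
  assumes "f \<in> range (comb \<sigma> 1)"
  shows "(\<lambda>x. a * f x) \<in> range (comb \<sigma> 1)"
proof -
  obtain xs where "f = comb \<sigma> 1 xs" using assms by auto
  then have "(\<lambda>x. a * f x) = comb \<sigma> 1 (map (\<lambda>(c, t). (a * c, t)) xs)"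
    by (simp add: comb_cmult fun_eq_iff)
  then show ?thesis by simp
qed

lemma coh_in_comb: "coh \<sigma> t \<in> range (comb \<sigma> 1)"
proof -
  have "coh \<sigma> t = comb \<sigma> 1 [(1, t)]" by (simp add: comb_Cons fun_eq_iff)
  then show ?thesis by simp
qed

lemma comb_1_closed_const: "(\<lambda>x. a) \<in> range (comb \<sigma> 1)"
  using comb_1_closed_cmult[OF coh_in_comb[of \<sigma> 0], of a] by simp

text \<open>The combinations form an algebra because, by \<open>coh_mult\<close>, a product of two coherent states is a
  multiple of a third.\<close>

lemma comb_1_closed_mult:
  assumes "f \<in> range (comb \<sigma> 1)" "g \<in> range (comb \<sigma> 1)"
  shows "(\<lambda>x. f x * g x) \<in> range (comb \<sigma> 1)"
proof -
  obtain xs ys where f: "f = comb \<sigma> 1 xs" and g: "g = comb \<sigma> 1 ys" using assms by auto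
  have single: "(\<lambda>x. coh \<sigma> s x * comb \<sigma> 1 ys x) \<in> range (comb \<sigma> 1)" for s
  proof (induction ys)
    case Nil
    then show ?case using comb_1_closed_const[of 0] by simp
  next
    case (Cons b ys)
    obtain d t where "b = (d, t)" by force
    then have "(\<lambda>x. coh \<sigma> s x * comb \<sigma> 1 (b # ys) x) =
        (\<lambda>x. d * (coh \<sigma> s x * coh \<sigma> t x) + coh \<sigma> s x * comb \<sigma> 1 ys x)"
      by (simp add: comb_Cons algebra_simps)
    then show ?case
      unfolding coh_mult
      using comb_1_closed_add[OF comb_1_closed_cmult[OF comb_1_closed_cmult[OF coh_in_comb]] Cons]
      by simp
  qed
  show ?thesis
    unfolding f g
  proof (induction xs)
    case Nil
    then show ?case using comb_1_closed_const[of 0] by simp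
  next
    case (Cons a xs)
    obtain c s where "a = (c, s)" by force
    then have "(\<lambda>x. comb \<sigma> 1 (a # xs) x * comb \<sigma> 1 ys x) =
        (\<lambda>x. c * (coh \<sigma> s x * comb \<sigma> 1 ys x) + comb \<sigma> 1 xs x * comb \<sigma> 1 ys x)"
      by (simp add: comb_Cons algebra_simps)
    then show ?case
      using comb_1_closed_add[OF comb_1_closed_cmult[OF single] Cons] by simp
  qed
qed

text \<open>A pure exponential is a multiple of a coherent state: the factor
  \<open>exp (- \<sigma> t\<^sup>2)\<close> does not depend on \<open>x\<close>.\<close>

lemma exp_in_comb:
  assumes "\<sigma> > 0"
  shows "(\<lambda>x. exp (of_real x * w)) \<in> range (comb \<sigma> 1)"
proof -
  define t where "t = w / (2 * of_real \<sigma>)"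
  have "exp (of_real x * w) = exp (of_real \<sigma> * t\<^sup>2) * coh \<sigma> t x" for x
    using assms by (simp add: coh_def mult_exp_exp t_def mult.commute)
  then show ?thesis
    using comb_1_closed_cmult[OF coh_in_comb[of \<sigma> t]] by simp
qed

lemma cis_in_comb:
  assumes "\<sigma> > 0"
  shows "(\<lambda>x. cis (\<omega> * x)) \<in> range (comb \<sigma> 1)"
  using exp_in_comb[OF assms, of "\<i> * of_real \<omega>"] by (simp add: cis_conv_exp mult_ac)

text \<open>Polynomials in the real and imaginary part of \<open>cis (\<omega> x)\<close>; the class of combinations absorbs them
  because it is an algebra containing \<open>cis (\<omega> x)\<close> and its conjugate.\<close>

lemma trig_polynomial_in_comb:
  assumes \<sigma>: "\<sigma> > 0" and p: "real_polynomial_function (p :: complex \<Rightarrow> real)"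
  shows "(\<lambda>x. complex_of_real (p (cis (\<omega> * x)))) \<in> range (comb \<sigma> 1)"
  using p
proof (induction p)
  case (linear f)
  interpret bounded_linear f by fact
  have "f w = Re w * f 1 + Im w * f \<i>" for w
  proof -
    have "w = Re w *\<^sub>R 1 + Im w *\<^sub>R \<i>" by (simp add: complex_eq_iff)
    then have "f w = f (Re w *\<^sub>R 1 + Im w *\<^sub>R \<i>)" by simp
    then show ?thesis by (simp add: add scaleR)
  qed
  note f_eq = this
  have "complex_of_real (f (cis (\<omega> * x))) =
      (of_real (f 1) / 2 + of_real (f \<i>) / (2 * \<i>)) * cis (\<omega> * x) +
      (of_real (f 1) / 2 - of_real (f \<i>) / (2 * \<i>)) * cis ((-\<omega>) * x)" for x
  proof -
    let ?c = "cis (\<omega> * x)"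
    have c: "cis ((-\<omega>) * x) = cnj ?c" by (simp add: cis_cnj)
    have "complex_of_real (Re ?c) = (?c + cnj ?c) / 2" "complex_of_real (Im ?c) = (?c - cnj ?c) / (2 * \<i>)"
      by (simp_all add: complex_eq_iff)
    moreover have "(u + v) / 2 * a + (u - v) / (2 * \<i>) * b =
        (a / 2 + b / (2 * \<i>)) * u + (a / 2 - b / (2 * \<i>)) * v" for u v a b :: complex
      by (simp add: algebra_simps add_divide_distrib diff_divide_distrib)
    moreover have "complex_of_real (f ?c) = of_real (Re ?c) * of_real (f 1) + of_real (Im ?c) * of_real (f \<i>)"
      by (subst f_eq) (simp only: of_real_add of_real_mult)
    ultimately show ?thesis
      unfolding c by (simp only:)
  qed
  then show ?case
    by (simp only:) (intro comb_1_closed_add comb_1_closed_cmult cis_in_comb \<sigma>)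
next
  case (const c)
  then show ?case by (rule comb_1_closed_const)
next
  case (add f g)
  then show ?case using comb_1_closed_add by simp
next
  case (mult f g)
  then show ?case using comb_1_closed_mult by simp
qed

text \<open>Wrapping the interval \<open>(- L, L]\<close> around the unit circle turns \<open>h\<close> into a function on the circle,
  continuous also at \<open>-1\<close> since \<open>h\<close> vanishes near the ends of the interval. The Stone-Weierstrass
  theorem on the circle gives a trigonometric polynomial; by periodicity the bound on the circle is
  a bound on the whole line.\<close>

lemma trig_approximation:
  fixes h :: "real \<Rightarrow> complex"
  assumes \<sigma>: "\<sigma> > 0" and h: "continuous_on UNIV h" and R: "0 \<le> R" "R < L"
    and supp: "\<And>x. R \<le> \<bar>x\<bar> \<Longrightarrow> h x = 0" and B: "\<And>x. cmod (h x) \<le> B" and e: "e > 0"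
  shows "\<exists>p \<in> range (comb \<sigma> 1). (\<forall>x. \<bar>x\<bar> < L \<longrightarrow> cmod (p x - h x) < e) \<and> (\<forall>x. cmod (p x) \<le> B + e)"
proof -
  have L: "L > 0" using R by linarith
  define F where "F w = h (L / pi * Arg w)" for w
  \<comment> \<open>The angle beyond which the wrapped function vanishes.\<close>
  let ?b = "pi * R / L"
  have b: "0 \<le> ?b" "?b < pi" using R L by (auto simp: field_simps)
  \<comment> \<open>\<open>Arg\<close> is continuous on \<open>?A\<close>, and on the sector \<open>?B\<close> around the negative axis \<open>F\<close> is zero.\<close>
  let ?A = "- \<real>\<^sub>\<le>\<^sub>0 :: complex set" and ?B = "{w. Re w < cos ?b * cmod w}"
  have "continuous_on (?A \<union> ?B) F"
  proof (rule continuous_on_open_Un)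
    show "open ?A" by (simp add: open_Compl closed_nonpos_Reals_complex)
    show "open ?B" by (intro open_Collect_less continuous_intros)
    show "continuous_on ?A F"
      unfolding F_def
      by (intro continuous_on_compose2[OF h] continuous_intros continuous_on_Arg) auto
    have "F w = 0" if "w \<in> ?B" for w
    proof -
      have w: "w \<noteq> 0" using that by auto
      have "Re w = cmod w * cos (Arg w)"
        using w by (metis Arg_eq Re_rcis rcis_def cis_conv_exp mult.commute)
      then have "cos \<bar>Arg w\<bar> < cos ?b"
        using that w by (simp add: mult.commute[of "cmod w"])
      then have "?b < \<bar>Arg w\<bar>"
        using b Arg_bounded[of w] cos_monotone_0_pi_le[of "\<bar>Arg w\<bar>" ?b] by (force simp: not_less)
      then have "R \<le> \<bar>L / pi * Arg w\<bar>"
        using L by (simp add: abs_mult field_simps)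
      then show ?thesis unfolding F_def by (rule supp)
    qed
    then show "continuous_on ?B F"
      by (subst continuous_on_cong[OF refl, where g = "\<lambda>_. 0"]) auto
  qed
  moreover have "sphere 0 1 \<subseteq> ?A \<union> ?B"
  proof
    fix w :: complex assume w: "w \<in> sphere 0 1"
    show "w \<in> ?A \<union> ?B"
    proof (cases "w \<in> \<real>\<^sub>\<le>\<^sub>0")
      case True
      then obtain r where r: "w = of_real r" "r \<le> 0" by (auto elim: nonpos_Reals_cases)
      with w have "w = -1" by (auto simp: abs_if split: if_splits)
      moreover have "-1 < cos ?b"
        using cos_monotone_0_pi[of ?b pi] b by simp
      ultimately show ?thesis by simp
    qed auto
  qed
  ultimately have "continuous_on (sphere 0 1) F"
    by (rule continuous_on_subset)
  then obtain g where g: "polynomial_function g" "\<And>w. w \<in> sphere 0 1 \<Longrightarrow> cmod (F w - g w) < e"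
    using Stone_Weierstrass_polynomial_function[of "sphere 0 1" F e] e by auto
  define p where "p x = g (cis (pi / L * x))" for x
  have rp: "real_polynomial_function (\<lambda>w. Re (g w))" "real_polynomial_function (\<lambda>w. Im (g w))"
    using g(1) bounded_linear_Re bounded_linear_Im unfolding polynomial_function_def comp_def by blast+
  have "p x = of_real (Re (g (cis (pi / L * x)))) + \<i> * of_real (Im (g (cis (pi / L * x))))" for x
    by (simp add: p_def complex_eq_iff)
  then have peq: "p = (\<lambda>x. of_real (Re (g (cis (pi / L * x)))) + \<i> * of_real (Im (g (cis (pi / L * x)))))"
    by (simp add: fun_eq_iff)
  have "p \<in> range (comb \<sigma> 1)"
    unfolding peq
    by (intro comb_1_closed_add comb_1_closed_cmult trig_polynomial_in_comb \<sigma> rp)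
  moreover have "cmod (p x - h x) < e" if "\<bar>x\<bar> < L" for x
  proof -
    have "pi * \<bar>x\<bar> < pi * L" using that by simp
    then have "\<bar>pi / L * x\<bar> < pi" using L by (simp add: abs_mult pos_divide_less_eq)
    then have "- pi < pi / L * x" "pi / L * x \<le> pi" unfolding abs_less_iff by linarith+
    then have "Arg (cis (pi / L * x)) = pi / L * x"
      by (intro cis_Arg_unique) simp_all
    then have "F (cis (pi / L * x)) = h x" using L by (simp add: F_def)
    then show ?thesis using g(2)[of "cis (pi / L * x)"] by (simp add: p_def norm_minus_commute)
  qed
  moreover have "cmod (p x) \<le> B + e" for x
  proof -
    have "cmod (p x) \<le> cmod (F (cis (pi / L * x))) + cmod (F (cis (pi / L * x)) - p x)"
      using norm_triangle_ineq4[of "F (cis (pi / L * x))" "F (cis (pi / L * x)) - p x"] by simp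
    also have "\<dots> \<le> B + e"
      using g(2)[of "cis (pi / L * x)"] B by (intro add_mono) (auto simp: F_def p_def)
    finally show ?thesis .
  qed
  ultimately show ?thesis by blast
qed

text \<open>A measurable function is almost everywhere the limit of continuous functions. Projecting these to
  the disc of radius \<open>B\<close> and cutting them off to \<open>[-n, n]\<close> preserves the limit, and the \<open>n\<close>-th one
  is approximated by a trigonometric polynomial of period \<open>2 (n + 1)\<close>. The uniform bound is what
  dominated convergence needs later.\<close>

lemma bounded_approximation:
  fixes f :: "real \<Rightarrow> complex"
  assumes \<sigma>: "\<sigma> > 0" and f: "f \<in> borel_measurable borel" and B: "\<And>x. cmod (f x) \<le> B"
  shows "\<exists>p. (\<forall>n. p n \<in> range (comb \<sigma> 1)) \<and> (\<forall>n x. cmod (p n x) \<le> B + 1) \<and>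
    (AE x in lborel. (\<lambda>n. p n x) \<longlonglongrightarrow> f x)"
proof -
  have B0: "0 \<le> B" using B[of 0] norm_ge_zero order_trans by blast
  have "f measurable_on UNIV"
    using f by (intro lebesgue_measurable_imp_measurable_on measurable_completion) simp_all
  then obtain N g where N: "negligible N" and g: "\<And>n. continuous_on UNIV (g n)"
    and lim: "\<And>x. x \<notin> N \<Longrightarrow> (\<lambda>n. g n x) \<longlonglongrightarrow> f x"
    unfolding measurable_on_def by auto
  \<comment> \<open>The projection onto the disc of radius \<open>B\<close>, which fixes all values of \<open>f\<close>.\<close>
  define cl where "cl = closest_point (cball (0::complex) B)"
  have cl: "continuous_on UNIV cl" unfolding cl_def
    using B0 by (intro continuous_on_closest_point) auto
  define h where "h n x = of_real (max 0 (min 1 (real n - \<bar>x\<bar>))) * cl (g n x)" for n x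
  have hB: "cmod (h n x) \<le> B" for n x
  proof -
    have "cl (g n x) \<in> cball 0 B" unfolding cl_def
      using B0 by (intro closest_point_in_set) auto
    then have "\<bar>max 0 (min 1 (real n - \<bar>x\<bar>))\<bar> * cmod (cl (g n x)) \<le> 1 * B"
      by (intro mult_mono) auto
    then show ?thesis by (simp add: h_def norm_mult)
  qed
  have "\<exists>p \<in> range (comb \<sigma> 1). (\<forall>x. \<bar>x\<bar> < real n + 1 \<longrightarrow> cmod (p x - h n x) < inverse (Suc n)) \<and>
      (\<forall>x. cmod (p x) \<le> B + inverse (Suc n))" for n
  proof (rule trig_approximation[OF \<sigma>])
    show "continuous_on UNIV (h n)"
      unfolding h_def by (intro continuous_intros continuous_on_compose2[OF cl] g) auto
    show "h n x = 0" if "real n \<le> \<bar>x\<bar>" for x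
      using that by (simp add: h_def)
  qed (use hB in auto)
  then obtain p where p: "\<And>n. p n \<in> range (comb \<sigma> 1)"
    "\<And>n x. \<bar>x\<bar> < real n + 1 \<Longrightarrow> cmod (p n x - h n x) < inverse (Suc n)"
    "\<And>n x. cmod (p n x) \<le> B + inverse (Suc n)"
    by metis
  have "cmod (p n x) \<le> B + 1" for n x
  proof -
    have "inverse (real (Suc n)) \<le> 1" by (simp add: field_simps)
    then show ?thesis using p(3)[of n x] by linarith
  qed
  moreover have "AE x in lborel. (\<lambda>n. p n x) \<longlonglongrightarrow> f x"
  proof (rule AE_mp)
    have "N \<in> null_sets lebesgue" using N by (simp add: negligible_iff_null_sets)
    then show "AE x in lborel. x \<notin> N"
      by (metis AE_not_in AE_completion_iff)
    show "AE x in lborel. x \<notin> N \<longrightarrow> (\<lambda>n. p n x) \<longlonglongrightarrow> f x"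
    proof (intro AE_I2 impI)
      fix x assume x: "x \<notin> N"
      have "f x \<in> cball 0 B" using B by simp
      then have fx: "cl (f x) = f x" unfolding cl_def by (rule closest_point_self)
      obtain m :: nat where m: "\<bar>x\<bar> + 1 \<le> real m" using real_arch_simple by blast
      have "(\<lambda>n. cl (g n x)) \<longlonglongrightarrow> cl (f x)"
        using continuous_on_tendsto_compose[OF cl lim[OF x]] by simp
      then have "(\<lambda>n. cl (g n x)) \<longlonglongrightarrow> f x" by (simp add: fx)
      moreover have "eventually (\<lambda>n. cl (g n x) = h n x) sequentially"
        unfolding eventually_sequentially
      proof (intro exI allI impI)
        fix n assume "m \<le> n"
        then have "1 \<le> real n - \<bar>x\<bar>" using m by linarith
        then show "cl (g n x) = h n x" by (simp add: h_def)
      qed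
      ultimately have h: "(\<lambda>n. h n x) \<longlonglongrightarrow> f x"
        by (rule Lim_transform_eventually)
      have "(\<lambda>n. p n x - h n x) \<longlonglongrightarrow> 0"
      proof (rule Lim_null_comparison[OF _ LIMSEQ_inverse_real_of_nat])
        show "eventually (\<lambda>n. cmod (p n x - h n x) \<le> inverse (real (Suc n))) sequentially"
          unfolding eventually_sequentially
        proof (intro exI allI impI)
          fix n assume "m \<le> n"
          then have "\<bar>x\<bar> < real n + 1" using m by linarith
          then show "cmod (p n x - h n x) \<le> inverse (real (Suc n))" using p(2) less_imp_le by blast
        qed
      qed
      from tendsto_add[OF this h] show "(\<lambda>n. p n x) \<longlonglongrightarrow> f x" by simp
    qed
  qed
  ultimately show ?thesis using p(1) by blast
qed

lemma finite_measure_gauss: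
  assumes "\<sigma> > 0"
  shows "finite_measure (gauss \<sigma>)"
proof (rule finite_measureI)
  have "integrable lborel (\<lambda>x. sqrt (\<sigma> / pi) * exp (- \<sigma> * x\<^sup>2))" (is "integrable _ ?g")
    using real_gaussian_integral(1)[OF assms, of 0] by simp
  then have "(\<integral>\<^sup>+x. ennreal (?g x) \<partial>lborel) = ennreal (\<integral>x. ?g x \<partial>lborel)"
    using assms by (intro nn_integral_eq_integral) auto
  then have "emeasure (gauss \<sigma>) UNIV = ennreal (\<integral>x. ?g x \<partial>lborel)"
    unfolding gauss_def by (subst emeasure_density) simp_all
  then show "emeasure (gauss \<sigma>) (space (gauss \<sigma>)) \<noteq> \<infinity>" by simp
qed

text \<open>Truncate the values of \<open>f\<close> to make it bounded, then use \<open>bounded_approximation\<close>; both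
  approximations converge in norm by dominated convergence, since the measure is finite.\<close>

lemma comb_dense:
  assumes \<sigma>: "\<sigma> > 0" and f: "sq_integrable (gauss \<sigma>) f" and e: "e > 0"
  shows "\<exists>xs. l2norm (gauss \<sigma>) (\<lambda>x. f x - comb \<sigma> 1 xs x) < e"
proof -
  let ?M = "gauss \<sigma>"
  interpret finite_measure ?M by (rule finite_measure_gauss[OF \<sigma>])
  have fm[measurable]: "f \<in> borel_measurable borel"
    using f by (simp add: sq_integrable_def)
  have f2: "integrable ?M (\<lambda>x. (cmod (f x))\<^sup>2)" using f by (simp add: sq_integrable_def)
  define F where "F n x = (if cmod (f x) \<le> real n then f x else 0)" for n :: nat and x
  have [measurable]: "F n \<in> borel_measurable borel" for n
    unfolding F_def[abs_def] by measurable
  have Fle: "cmod (F n x) \<le> cmod (f x)" "cmod (F n x) \<le> real n" for n x by (auto simp: F_def)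
  have F: "sq_integrable ?M (F n)" for n
    by (rule sq_integrable_bound[OF f2]) (auto intro!: power_mono Fle)
  have "(\<lambda>n. \<integral>x. (cmod (f x - F n x))\<^sup>2 \<partial>?M) \<longlonglongrightarrow> (\<integral>x. 0 \<partial>?M)"
  proof (rule integral_dominated_convergence[OF _ _ f2])
    show "AE x in ?M. (\<lambda>n. (cmod (f x - F n x))\<^sup>2) \<longlonglongrightarrow> 0"
    proof (rule AE_I2, rule tendsto_eventually)
      fix x
      obtain m :: nat where "cmod (f x) \<le> real m" using real_arch_simple by blast
      then show "eventually (\<lambda>n. (cmod (f x - F n x))\<^sup>2 = 0) sequentially"
        unfolding eventually_sequentially F_def by (intro exI[of _ m]) auto
    qed
  qed (auto simp: F_def)
  then have "(\<lambda>n. l2norm ?M (\<lambda>x. f x - F n x)) \<longlonglongrightarrow> 0"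
    unfolding l2norm_def using tendsto_real_sqrt by fastforce
  then have "eventually (\<lambda>n. l2norm ?M (\<lambda>x. f x - F n x) < e / 2) sequentially"
    using e by (intro order_tendstoD) auto
  then obtain n where n: "l2norm ?M (\<lambda>x. f x - F n x) < e / 2"
    by (auto simp: eventually_sequentially)
  obtain p where p: "\<And>k. p k \<in> range (comb \<sigma> 1)" "\<And>k x. cmod (p k x) \<le> real n + 1"
    "AE x in lborel. (\<lambda>k. p k x) \<longlonglongrightarrow> F n x"
    using bounded_approximation[OF \<sigma>, of "F n" "real n"] Fle(2) by auto
  have psq: "sq_integrable ?M (p k)" for k
    using p(1)[of k] sq_integrable_comb[OF \<sigma>] by auto
  then have [measurable]: "p k \<in> borel_measurable borel" for k
    by (simp add: sq_integrable_def)
  have "(\<lambda>k. \<integral>x. (cmod (F n x - p k x))\<^sup>2 \<partial>?M) \<longlonglongrightarrow> (\<integral>x. 0 \<partial>?M)"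
  proof (rule integral_dominated_convergence)
    show "integrable ?M (\<lambda>x. (2 * real n + 1)\<^sup>2)" by simp
    have "AE x in ?M. (\<lambda>k. p k x) \<longlonglongrightarrow> F n x"
      using p(3) AE_gauss_iff[OF \<sigma>] by blast
    then show "AE x in ?M. (\<lambda>k. (cmod (F n x - p k x))\<^sup>2) \<longlonglongrightarrow> 0"
    proof eventually_elim
      case (elim x)
      from tendsto_power[OF tendsto_norm[OF tendsto_diff[OF tendsto_const[of "F n x"] elim]], of 2]
      show ?case by simp
    qed
    show "AE x in ?M. norm ((cmod (F n x - p k x))\<^sup>2) \<le> (2 * real n + 1)\<^sup>2" for k
    proof (rule AE_I2)
      fix x
      have "cmod (F n x - p k x) \<le> 2 * real n + 1"
        using norm_triangle_ineq4[of "F n x" "p k x"] Fle(2)[of n x] p(2)[of k x] by linarith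
      then show "norm ((cmod (F n x - p k x))\<^sup>2) \<le> (2 * real n + 1)\<^sup>2"
        by (simp add: power_mono)
    qed
  qed auto
  then have "(\<lambda>k. l2norm ?M (\<lambda>x. F n x - p k x)) \<longlonglongrightarrow> 0"
    unfolding l2norm_def using tendsto_real_sqrt by fastforce
  then have "eventually (\<lambda>k. l2norm ?M (\<lambda>x. F n x - p k x) < e / 2) sequentially"
    using e by (intro order_tendstoD) auto
  then obtain k where k: "l2norm ?M (\<lambda>x. F n x - p k x) < e / 2"
    by (auto simp: eventually_sequentially)
  obtain xs where xs: "p k = comb \<sigma> 1 xs" using p(1)[of k] by auto
  have "l2norm ?M (\<lambda>x. f x - p k x) < e"
    using l2norm_triangle_diff[OF f F[of n] psq[of k]] n k by linarith
  then show ?thesis using xs by auto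
qed

section \<open>The Mehler kernel\<close>

text \<open>The kernel of the transform relative to the Gaussian measure: the weight of the measure has been
  divided out, which makes the formula symmetric in \<open>x\<close> and \<open>y\<close>.\<close>

definition mehler :: "real \<Rightarrow> complex \<Rightarrow> real \<Rightarrow> real \<Rightarrow> complex" where
  "mehler \<sigma> z x y =
    exp (- (of_real \<sigma> * (z\<^sup>2 * (of_real (x\<^sup>2) + of_real (y\<^sup>2)) - 2 * z * of_real x * of_real y)) / (1 - z\<^sup>2)) /
      csqrt (1 - z\<^sup>2)"

definition mehler_transform :: "real \<Rightarrow> complex \<Rightarrow> (real \<Rightarrow> complex) \<Rightarrow> real \<Rightarrow> complex" where
  "mehler_transform \<sigma> z f y = (\<integral>x. f x * mehler \<sigma> z x y \<partial>gauss \<sigma>)"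

text \<open>This keeps \<open>1 - z\<^sup>2\<close> and \<open>\<sigma> / (1 - z\<^sup>2)\<close> in the open right half plane: the principal root is
  continuous there, and Gaussians with such a quadratic coefficient are integrable.\<close>

lemma Re_one_minus_square_pos:
  assumes "cmod z \<le> 1" "z\<^sup>2 \<noteq> 1"
  shows "Re (1 - z\<^sup>2) > 0"
proof -
  have n: "cmod (z\<^sup>2) \<le> 1" using assms(1) by (simp add: norm_power power_le_one)
  have "Re (z\<^sup>2) \<noteq> 1"
  proof
    assume r: "Re (z\<^sup>2) = 1"
    have "(cmod (z\<^sup>2))\<^sup>2 \<le> 1" using n by (simp add: power_le_one)
    then have "(Im (z\<^sup>2))\<^sup>2 \<le> 0" using r by (simp only: cmod_power2) simp
    then have "Im (z\<^sup>2) = 0" by simp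
    then show False using r assms(2) by (simp add: complex_eq_iff)
  qed
  then show ?thesis using complex_Re_le_cmod[of "z\<^sup>2"] n by simp
qed

lemma Re_of_real_mult: "Re (of_real r * w) = r * Re w"
  by simp

lemma Re_inverse_pos: "Re w > 0 \<Longrightarrow> Re (inverse w) > 0"
  by (simp add: add_pos_nonneg)

lemma Re_csqrt_pos: "Re v > 0 \<Longrightarrow> Re (csqrt v) > 0"
  using add_nonneg_pos[OF norm_ge_zero[of v]] by simp

text \<open>In the right half plane the principal root is compatible with inversion. This matches the root
  in the normalisation of the kernel with the one produced by the Gaussian integral.\<close>

lemma csqrt_scaled_inverse:
  assumes \<sigma>: "\<sigma> > 0" and w: "Re w > 0"
  shows "csqrt (of_real \<sigma> / w) * csqrt w = of_real (sqrt \<sigma>)"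
proof -
  have w0: "w \<noteq> 0" using w by auto
  have "w \<notin> \<real>\<^sub>\<le>\<^sub>0" using w by (auto simp: complex_nonpos_Reals_iff)
  then have inv: "csqrt (inverse w) = inverse (csqrt w)" by (rule csqrt_inverse)
  have "Re (csqrt (inverse w)) > 0"
    by (intro Re_csqrt_pos Re_inverse_pos w)
  then have "csqrt (of_real \<sigma> / w) = of_real (sqrt \<sigma>) * csqrt (inverse w)"
    using \<sigma> by (intro csqrt_unique)
      (auto simp: power_mult_distrib divide_inverse simp del: csqrt.sel simp flip: of_real_power)
  then show ?thesis using w0 by (simp add: inv)
qed

text \<open>The exponent as a quadratic polynomial in \<open>x\<close>, the form required by \<open>gauss_exp_integral\<close>.\<close>

lemma mehler_eq_exp:
  assumes "z\<^sup>2 \<noteq> 1"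
  shows "mehler \<sigma> z x y = exp (- (of_real \<sigma> * z\<^sup>2 / (1 - z\<^sup>2)) * of_real (y\<^sup>2)) / csqrt (1 - z\<^sup>2) *
    exp ((2 * of_real \<sigma> * z * of_real y / (1 - z\<^sup>2)) * of_real x - (of_real \<sigma> * z\<^sup>2 / (1 - z\<^sup>2)) * of_real (x\<^sup>2))"
proof -
  have "- (of_real \<sigma> * (z\<^sup>2 * (of_real (x\<^sup>2) + of_real (y\<^sup>2)) - 2 * z * of_real x * of_real y)) / (1 - z\<^sup>2) =
     - (of_real \<sigma> * z\<^sup>2 / (1 - z\<^sup>2)) * of_real (y\<^sup>2) +
      ((2 * of_real \<sigma> * z * of_real y / (1 - z\<^sup>2)) * of_real x - (of_real \<sigma> * z\<^sup>2 / (1 - z\<^sup>2)) * of_real (x\<^sup>2))"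
    unfolding divide_inverse by (simp only: of_real_power) algebra
  then show ?thesis by (simp only: mehler_def exp_add) simp
qed

lemma mehler_measurable [measurable]:
  "(\<lambda>(y, x). mehler \<sigma> z x y) \<in> borel_measurable (borel \<Otimes>\<^sub>M borel)"
  unfolding mehler_def split_beta by measurable

lemma mehler_measurable' [measurable]: "(\<lambda>x. mehler \<sigma> z x y) \<in> borel_measurable borel"
  unfolding mehler_def by measurable

text \<open>Completing the square. The quadratic coefficient of the Gaussian integral is \<open>\<sigma> / (1 - z\<^sup>2)\<close>; its
  root cancels the normalisation, and the exponents combine to that of \<open>coh \<sigma> (z * t)\<close>.\<close>

lemma mehler_coh:
  assumes \<sigma>: "\<sigma> > 0" and z: "cmod z \<le> 1" "z\<^sup>2 \<noteq> 1"
  shows "integrable (gauss \<sigma>) (\<lambda>x. coh \<sigma> t x * mehler \<sigma> z x y)"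
    and "mehler_transform \<sigma> z (coh \<sigma> t) y = coh \<sigma> (z * t) y"
proof -
  let ?w = "1 - z\<^sup>2"
  let ?s = "complex_of_real \<sigma>" and ?y = "complex_of_real y"
  let ?c = "?s * z\<^sup>2 / ?w" and ?b = "2 * ?s * z * ?y / ?w + 2 * ?s * t"
  let ?K = "exp (- ?c * ?y\<^sup>2 - ?s * t\<^sup>2) / csqrt ?w"
  have w: "Re ?w > 0" by (rule Re_one_minus_square_pos[OF z])
  have w0: "?w \<noteq> 0" using z by simp
  have sc: "?s + ?c = ?s / ?w" using w0 by (simp add: field_simps)
  have "Re (?s / ?w) > 0"
    using mult_pos_pos[OF \<sigma> Re_inverse_pos[OF w]] by (simp only: divide_inverse Re_of_real_mult)
  then have c: "Re ?c > - \<sigma>" unfolding sc[symmetric] by simp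
  have eq: "coh \<sigma> t x * mehler \<sigma> z x y = ?K * exp (?b * of_real x - ?c * of_real (x\<^sup>2))" for x
    unfolding mehler_eq_exp[OF z(2)] coh_def
    by (simp add: mult_exp_exp algebra_simps)
  note G = gauss_exp_integral[OF \<sigma> c, of ?b]
  show "integrable (gauss \<sigma>) (\<lambda>x. coh \<sigma> t x * mehler \<sigma> z x y)"
    unfolding eq by (intro integrable_mult_right G)
  let ?I = "\<integral>x. exp (?b * of_real x - ?c * of_real (x\<^sup>2)) \<partial>gauss \<sigma>"
  have cs: "csqrt (?s / ?w) * csqrt ?w = of_real (sqrt \<sigma>)"
    by (rule csqrt_scaled_inverse[OF \<sigma> w])
  have ne: "csqrt (?s / ?w) \<noteq> 0" "csqrt ?w \<noteq> 0" using w0 \<sigma> by auto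
  have "csqrt (?s / ?w) * ?I = of_real (sqrt \<sigma>) * exp (?b\<^sup>2 / (4 * (?s / ?w)))"
    using G(2) unfolding sc .
  then have "csqrt (?s / ?w) * ?I = csqrt (?s / ?w) * (csqrt ?w * exp (?b\<^sup>2 / (4 * (?s / ?w))))"
    by (simp only: cs[symmetric] mult.assoc)
  then have I: "?I = csqrt ?w * exp (?b\<^sup>2 / (4 * (?s / ?w)))"
    using ne by simp
  have "mehler_transform \<sigma> z (coh \<sigma> t) y = ?K * ?I"
    unfolding mehler_transform_def eq by (rule integral_mult_right_zero)
  also have "\<dots> = exp (- ?c * ?y\<^sup>2 - ?s * t\<^sup>2 + ?b\<^sup>2 / (4 * (?s / ?w)))"
    unfolding I using ne by (simp add: exp_add)
  also have "- ?c * ?y\<^sup>2 - ?s * t\<^sup>2 + ?b\<^sup>2 / (4 * (?s / ?w)) = 2 * ?s * (z * t) * ?y - ?s * (z * t)\<^sup>2"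
  proof -
    have b: "?b = 2 * ?s * (z * ?y + t * ?w) / ?w" using w0 by (simp add: field_simps)
    have "?b\<^sup>2 / (4 * (?s / ?w)) = ?s * (z * ?y + t * ?w)\<^sup>2 / ?w"
      unfolding b using w0 \<sigma> by (simp add: power2_eq_square divide_simps)
    also have "\<dots> = ?s * (z * ?y)\<^sup>2 / ?w + 2 * ?s * (z * t) * ?y + ?s * t\<^sup>2 * ?w"
      using w0 by (simp add: divide_simps) algebra
    finally show ?thesis using w0 by (simp add: algebra_simps)
  qed
  finally show "mehler_transform \<sigma> z (coh \<sigma> t) y = coh \<sigma> (z * t) y"
    by (simp only: coh_def[of \<sigma> "z * t" y])
qed

lemma mehler_transform_comb:
  assumes \<sigma>: "\<sigma> > 0" and z: "cmod z \<le> 1" "z\<^sup>2 \<noteq> 1"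
  shows "integrable (gauss \<sigma>) (\<lambda>x. comb \<sigma> 1 xs x * mehler \<sigma> z x y) \<and>
    mehler_transform \<sigma> z (comb \<sigma> 1 xs) y = comb \<sigma> z xs y"
proof (induction xs)
  case Nil
  then show ?case by (simp add: mehler_transform_def)
next
  case (Cons a xs)
  obtain c t where a: "a = (c, t)" by force
  have eq: "comb \<sigma> 1 (a # xs) x * mehler \<sigma> z x y =
     c * (coh \<sigma> t x * mehler \<sigma> z x y) + comb \<sigma> 1 xs x * mehler \<sigma> z x y" for x
    by (simp add: a comb_Cons algebra_simps)
  have i: "integrable (gauss \<sigma>) (\<lambda>x. c * (coh \<sigma> t x * mehler \<sigma> z x y))"
    by (intro integrable_mult_right mehler_coh assms)
  have tr: "mehler_transform \<sigma> z (comb \<sigma> 1 (a # xs)) y =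
      c * mehler_transform \<sigma> z (coh \<sigma> t) y + mehler_transform \<sigma> z (comb \<sigma> 1 xs) y"
    unfolding mehler_transform_def eq
    using Bochner_Integration.integral_add[OF i conjunct1[OF Cons]] by simp
  then have "mehler_transform \<sigma> z (comb \<sigma> 1 (a # xs)) y = comb \<sigma> z (a # xs) y"
    unfolding tr using Cons by (simp only: a comb_Cons mehler_coh(2)[OF assms])
  then show ?case
    unfolding eq using i Cons by (intro conjI Bochner_Integration.integrable_add) auto
qed

text \<open>The square of the kernel has quadratic coefficient \<open>2 c\<close> with \<open>c = \<sigma> z\<^sup>2 / (1 - z\<^sup>2)\<close>, and
  \<open>Re (2 c) > - \<sigma>\<close> says that \<open>1 / (1 - z\<^sup>2)\<close> has real part above one half, which is \<open>|z| < 1\<close>.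
  On the unit circle this fails, so that there the transform is only a limit.\<close>

lemma sq_integrable_mehler:
  assumes \<sigma>: "\<sigma> > 0" and z: "cmod z < 1"
  shows "sq_integrable (gauss \<sigma>) (\<lambda>x. mehler \<sigma> z x y)"
proof -
  let ?w = "1 - z\<^sup>2" and ?s = "complex_of_real \<sigma>"
  have n: "cmod (z\<^sup>2) < 1" using z by (simp add: norm_power power_less_one_iff)
  then have z2: "z\<^sup>2 \<noteq> 1" by auto
  have w0: "?w \<noteq> 0" using z2 by simp
  let ?c = "?s * z\<^sup>2 / ?w" and ?b = "2 * ?s * z * of_real y / ?w"
  let ?K = "exp (- ?c * of_real (y\<^sup>2)) / csqrt ?w"
  have "(cmod ?w)\<^sup>2 < 2 * Re ?w"
  proof -
    have "(cmod ?w)\<^sup>2 = 1 - 2 * Re (z\<^sup>2) + (cmod (z\<^sup>2))\<^sup>2"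
      by (simp only: cmod_power2) (simp add: power2_eq_square algebra_simps)
    moreover have "(cmod (z\<^sup>2))\<^sup>2 < 1" using n by (simp only: power_less_one_iff norm_ge_zero) simp
    ultimately show ?thesis by simp
  qed
  moreover have "Re (inverse ?w) = Re ?w / (cmod ?w)\<^sup>2"
    by (simp only: inverse_complex.sel cmod_power2)
  ultimately have "2 * Re (inverse ?w) > 1"
    using w0 by (simp only: times_divide_eq_right less_divide_eq_1_pos zero_less_power zero_less_norm_iff not_False_eq_True)
  then have "\<sigma> * (2 * Re (inverse ?w)) > \<sigma> * 1" using \<sigma> by (intro mult_strict_left_mono)
  moreover have "?c = ?s * inverse ?w - ?s" using w0 by (simp add: field_simps)
  then have "Re ?c = \<sigma> * Re (inverse ?w) - \<sigma>" by (simp only: minus_complex.sel Re_of_real_mult Re_complex_of_real)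
  moreover have "Re (2 * ?c) = 2 * Re ?c"
    using Re_of_real_mult[of 2 ?c] by (simp only: of_real_numeral)
  ultimately have c: "Re (2 * ?c) > - \<sigma>" by linarith
  have "integrable (gauss \<sigma>) (\<lambda>x. (cmod ?K)\<^sup>2 * cmod (exp ((2 * ?b) * of_real x - (2 * ?c) * of_real (x\<^sup>2))))"
    by (intro integrable_mult_right integrable_norm gauss_exp_integral[OF \<sigma> c])
  then show ?thesis
  proof (rule sq_integrable_bound)
    fix x
    have "(2 * ?b) * of_real x - (2 * ?c) * of_real (x\<^sup>2) = 2 * (?b * of_real x - ?c * of_real (x\<^sup>2))"
      by (simp only: ring_distribs mult.assoc right_diff_distrib)
    then have "(exp (?b * of_real x - ?c * of_real (x\<^sup>2)))\<^sup>2 = exp ((2 * ?b) * of_real x - (2 * ?c) * of_real (x\<^sup>2))"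
      by (simp only: exp_double)
    then show "(cmod (mehler \<sigma> z x y))\<^sup>2 \<le> (cmod ?K)\<^sup>2 * cmod (exp ((2 * ?b) * of_real x - (2 * ?c) * of_real (x\<^sup>2)))"
      unfolding mehler_eq_exp[OF z2] by (simp only: norm_mult power_mult_distrib norm_power[symmetric] order_refl)
  qed simp
qed

lemma mehler_transform_measurable [measurable]:
  assumes \<sigma>: "\<sigma> > 0" and [measurable]: "f \<in> borel_measurable borel"
  shows "mehler_transform \<sigma> z f \<in> borel_measurable borel"
proof -
  interpret finite_measure "gauss \<sigma>" by (rule finite_measure_gauss[OF \<sigma>])
  have "(\<lambda>y. \<integral>x. f x * mehler \<sigma> z x y \<partial>gauss \<sigma>) \<in> borel_measurable borel"
    by measurable
  then show ?thesis by (simp add: mehler_transform_def[abs_def])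
qed

lemma mehler_transform_diff:
  assumes "integrable (gauss \<sigma>) (\<lambda>x. f x * mehler \<sigma> z x y)" "integrable (gauss \<sigma>) (\<lambda>x. g x * mehler \<sigma> z x y)"
  shows "mehler_transform \<sigma> z (\<lambda>x. f x - g x) y = mehler_transform \<sigma> z f y - mehler_transform \<sigma> z g y"
  using assms by (simp add: mehler_transform_def left_diff_distrib)

text \<open>On combinations of coherent states this is \<open>l2norm_comb_le\<close>. For general \<open>f\<close> approximate in norm:
  the transforms converge pointwise, because the kernel is square integrable in \<open>x\<close>, and Fatou's
  lemma preserves the bound.\<close>

lemma mehler_transform_contraction:
  assumes \<sigma>: "\<sigma> > 0" and z: "cmod z < 1" and f: "sq_integrable (gauss \<sigma>) f"
  shows "sq_integrable (gauss \<sigma>) (mehler_transform \<sigma> z f)"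
    and "l2norm (gauss \<sigma>) (mehler_transform \<sigma> z f) \<le> l2norm (gauss \<sigma>) f"
proof -
  let ?M = "gauss \<sigma>"
  have fm: "f \<in> borel_measurable borel" using f by (simp add: sq_integrable_def)
  have "cmod (z\<^sup>2) < 1" using z by (simp add: norm_power power_less_one_iff)
  then have z': "cmod z \<le> 1" "z\<^sup>2 \<noteq> 1" using z by auto
  have main: "sq_integrable ?M (mehler_transform \<sigma> z f) \<and> l2norm ?M (mehler_transform \<sigma> z f) \<le> l2norm ?M f + e"
    if e: "e > 0" for e
  proof -
    have "\<exists>xs. l2norm ?M (\<lambda>x. f x - comb \<sigma> 1 xs x) < e * inverse (real (Suc n))" for n
      using e by (intro comb_dense[OF \<sigma> f]) simp
    then obtain xs where xs: "\<And>n. l2norm ?M (\<lambda>x. f x - comb \<sigma> 1 (xs n) x) < e * inverse (real (Suc n))"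
      by metis
    have sq: "sq_integrable ?M (\<lambda>x. f x - comb \<sigma> 1 (xs n) x)" for n
      by (intro sq_integrable_diff f sq_integrable_comb \<sigma>)
    show ?thesis
    proof (rule l2_Fatou)
      show "sq_integrable ?M (comb \<sigma> z (xs n))" for n by (rule sq_integrable_comb[OF \<sigma>])
      show "mehler_transform \<sigma> z f \<in> borel_measurable ?M"
        using mehler_transform_measurable[OF \<sigma> fm] by simp
      show "l2norm ?M (comb \<sigma> z (xs n)) \<le> l2norm ?M f + e" for n
      proof -
        have "l2norm ?M (comb \<sigma> z (xs n)) \<le> l2norm ?M (comb \<sigma> 1 (xs n))"
          by (rule l2norm_comb_le[OF \<sigma> z'(1)])
        also have "\<dots> \<le> l2norm ?M f + e * inverse (real (Suc n))"
          using l2norm_diff_ge[OF f sq_integrable_comb[OF \<sigma>], of 1 "xs n"] xs[of n] by linarith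
        also have "e * inverse (real (Suc n)) \<le> e * 1"
          using e by (intro mult_left_mono) (auto simp: field_simps)
        finally show ?thesis by simp
      qed
      show "AE y in ?M. (\<lambda>n. comb \<sigma> z (xs n) y) \<longlonglongrightarrow> mehler_transform \<sigma> z f y"
      proof (rule AE_I2)
        fix y
        let ?k = "\<lambda>x. mehler \<sigma> z x y"
        have k: "sq_integrable ?M ?k" by (rule sq_integrable_mehler[OF \<sigma> z])
        have "(\<lambda>n. comb \<sigma> z (xs n) y - mehler_transform \<sigma> z f y) \<longlonglongrightarrow> 0"
        proof (rule Lim_null_comparison)
          show "eventually (\<lambda>n. cmod (comb \<sigma> z (xs n) y - mehler_transform \<sigma> z f y) \<le>
              e * inverse (real (Suc n)) * l2norm ?M ?k) sequentially"
          proof (rule always_eventually, rule allI)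
            fix n
            have "mehler_transform \<sigma> z f y - comb \<sigma> z (xs n) y =
                mehler_transform \<sigma> z (\<lambda>x. f x - comb \<sigma> 1 (xs n) x) y"
              using mehler_transform_diff[OF integrable_mult_sq[OF f k]
                  conjunct1[OF mehler_transform_comb[OF \<sigma> z', of "xs n" y]]]
                conjunct2[OF mehler_transform_comb[OF \<sigma> z', of "xs n" y]] by simp
            then have "cmod (comb \<sigma> z (xs n) y - mehler_transform \<sigma> z f y) =
                cmod (mehler_transform \<sigma> z (\<lambda>x. f x - comb \<sigma> 1 (xs n) x) y)"
              by (simp only: norm_minus_commute[of "comb \<sigma> z (xs n) y"])
            also have "\<dots> \<le> (\<integral>x. cmod ((f x - comb \<sigma> 1 (xs n) x) * ?k x) \<partial>?M)"
              unfolding mehler_transform_def by (rule integral_norm_bound)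
            also have "\<dots> \<le> l2norm ?M (\<lambda>x. f x - comb \<sigma> 1 (xs n) x) * l2norm ?M ?k"
              by (rule Cauchy_Schwarz_integral[OF sq k])
            also have "\<dots> \<le> e * inverse (real (Suc n)) * l2norm ?M ?k"
              by (intro mult_right_mono less_imp_le[OF xs] l2norm_nonneg)
            finally show "cmod (comb \<sigma> z (xs n) y - mehler_transform \<sigma> z f y) \<le>
              e * inverse (real (Suc n)) * l2norm ?M ?k" .
          qed
          show "(\<lambda>n. e * inverse (real (Suc n)) * l2norm ?M ?k) \<longlonglongrightarrow> 0"
            by (rule tendsto_mult_left_zero[OF tendsto_mult_right_zero[OF LIMSEQ_inverse_real_of_nat]])
        qed
        then show "(\<lambda>n. comb \<sigma> z (xs n) y) \<longlonglongrightarrow> mehler_transform \<sigma> z f y"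
          by (rule LIM_zero_cancel)
      qed
    qed
  qed
  show "sq_integrable ?M (mehler_transform \<sigma> z f)" using main[of 1] by simp
  show "l2norm ?M (mehler_transform \<sigma> z f) \<le> l2norm ?M f"
    by (rule field_le_epsilon) (rule conjunct2[OF main])
qed

text \<open>The kernel is continuous in \<open>r\<close> and \<open>x\<close> up to \<open>r = 1\<close>, hence bounded on compact sets; this dominates
  the passage to the boundary of the disc.\<close>

lemma mehler_bounded:
  assumes a: "cmod a = 1" "a\<^sup>2 \<noteq> 1"
  shows "\<exists>B. \<forall>r x. 0 \<le> r \<longrightarrow> r \<le> 1 \<longrightarrow> \<bar>x\<bar> \<le> R \<longrightarrow> cmod (mehler \<sigma> (of_real r * a) x y) \<le> B"
    and "isCont (\<lambda>r. mehler \<sigma> (of_real r * a) x y) 1"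
proof -
  have pos: "Re (1 - (of_real r * a)\<^sup>2) > 0" if "0 \<le> r" "r \<le> 1" for r
  proof (cases "r = 1")
    case True
    then show ?thesis using Re_one_minus_square_pos[of a] a by simp
  next
    case False
    then have "cmod ((of_real r * a)\<^sup>2) < 1"
      using a that by (simp add: norm_power norm_mult power_less_one_iff)
    then have "(of_real r * a)\<^sup>2 \<noteq> 1" by auto
    then show ?thesis
      using a that by (intro Re_one_minus_square_pos) (auto simp: norm_mult)
  qed
  have "continuous_on ({0..1} \<times> {-R..R}) (\<lambda>(r, x). mehler \<sigma> (of_real r * a) x y)"
    unfolding mehler_def split_beta
    by (intro continuous_intros continuous_on_compose2[OF continuous_on_csqrt])
      (use pos in \<open>force simp: complex_nonpos_Reals_iff\<close>)+
  then have "compact ((\<lambda>(r, x). mehler \<sigma> (of_real r * a) x y) ` ({0..1} \<times> {-R..R}))"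
    by (intro compact_continuous_image compact_Times) auto
  then obtain B where "\<And>v. v \<in> (\<lambda>(r, x). mehler \<sigma> (of_real r * a) x y) ` ({0..1} \<times> {-R..R}) \<Longrightarrow> cmod v \<le> B"
    using compact_imp_bounded bounded_iff by metis
  moreover have "mehler \<sigma> (of_real r * a) x y \<in> (\<lambda>(r, x). mehler \<sigma> (of_real r * a) x y) ` ({0..1} \<times> {-R..R})"
    if "0 \<le> r" "r \<le> 1" "\<bar>x\<bar> \<le> R" for r x
    using that by (intro image_eqI[of _ _ "(r, x)"]) auto
  ultimately have "\<forall>r x. 0 \<le> r \<longrightarrow> r \<le> 1 \<longrightarrow> \<bar>x\<bar> \<le> R \<longrightarrow> cmod (mehler \<sigma> (of_real r * a) x y) \<le> B"
    by blast
  then show "\<exists>B. \<forall>r x. 0 \<le> r \<longrightarrow> r \<le> 1 \<longrightarrow> \<bar>x\<bar> \<le> R \<longrightarrow> cmod (mehler \<sigma> (of_real r * a) x y) \<le> B" ..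
  have p1: "Re (1 - a\<^sup>2) > 0" using pos[of 1] by simp
  have n1: "1 - a\<^sup>2 \<notin> \<real>\<^sub>\<le>\<^sub>0" using p1 by (auto simp: complex_nonpos_Reals_iff)
  have "1 - a\<^sup>2 \<noteq> 0" "csqrt (1 - a\<^sup>2) \<noteq> 0" using a by auto
  then show "isCont (\<lambda>r. mehler \<sigma> (of_real r * a) x y) 1"
    unfolding mehler_def using n1
    by (intro continuous_intros isCont_o2[OF _ continuous_at_csqrt]) auto
qed

lemma integrable_mehler_compact_support:
  assumes \<sigma>: "\<sigma> > 0" and a: "cmod a = 1" "a\<^sup>2 \<noteq> 1" and f: "sq_integrable (gauss \<sigma>) f"
    and supp: "\<And>x. \<bar>x\<bar> > R \<Longrightarrow> f x = 0"
  shows "integrable (gauss \<sigma>) (\<lambda>x. f x * mehler \<sigma> a x y)"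
    and "(\<lambda>n. mehler_transform \<sigma> (of_real (1 - inverse (real (Suc n))) * a) f y) \<longlonglongrightarrow> mehler_transform \<sigma> a f y"
proof -
  let ?M = "gauss \<sigma>"
  have [measurable]: "f \<in> borel_measurable borel" using f by (simp add: sq_integrable_def)
  obtain B where B: "\<And>r x. 0 \<le> r \<Longrightarrow> r \<le> 1 \<Longrightarrow> \<bar>x\<bar> \<le> R \<Longrightarrow> cmod (mehler \<sigma> (of_real r * a) x y) \<le> B"
    using mehler_bounded(1)[OF a] by metis
  have le: "cmod (f x * mehler \<sigma> (of_real r * a) x y) \<le> cmod (f x) * B" if "0 \<le> r" "r \<le> 1" for r x
  proof (cases "\<bar>x\<bar> \<le> R")
    case True
    then show ?thesis using B[OF that True] by (simp add: norm_mult mult_left_mono)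
  next
    case False
    then show ?thesis using supp by simp
  qed
  have "integrable ?M (\<lambda>x. f x * coh \<sigma> 0 x)"
    by (intro integrable_mult_sq f sq_integrable_coh \<sigma>)
  then have w: "integrable ?M (\<lambda>x. cmod (f x) * B)"
    by (intro integrable_mult_left integrable_norm) simp
  have "AE x in ?M. cmod (f x * mehler \<sigma> a x y) \<le> norm (cmod (f x) * B)"
  proof (rule AE_I2)
    fix x show "cmod (f x * mehler \<sigma> a x y) \<le> norm (cmod (f x) * B)"
      using le[of 1 x] by (simp add: order_trans[OF _ abs_ge_self])
  qed
  then show "integrable ?M (\<lambda>x. f x * mehler \<sigma> a x y)"
    by (intro Bochner_Integration.integrable_bound[OF w]) simp_all
  have r: "0 \<le> 1 - inverse (real (Suc n))" "1 - inverse (real (Suc n)) \<le> 1" for n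
    by (auto simp: field_simps)
  show "(\<lambda>n. mehler_transform \<sigma> (of_real (1 - inverse (real (Suc n))) * a) f y) \<longlonglongrightarrow> mehler_transform \<sigma> a f y"
    unfolding mehler_transform_def
  proof (rule integral_dominated_convergence[OF _ _ w])
    show "AE x in ?M. (\<lambda>n. f x * mehler \<sigma> (of_real (1 - inverse (real (Suc n))) * a) x y) \<longlonglongrightarrow> f x * mehler \<sigma> a x y"
    proof (rule AE_I2)
      fix x
      have "(\<lambda>n. 1 - inverse (real (Suc n))) \<longlonglongrightarrow> 1 - 0"
        by (intro tendsto_intros LIMSEQ_inverse_real_of_nat)
      then have "(\<lambda>n. mehler \<sigma> (of_real (1 - inverse (real (Suc n))) * a) x y) \<longlonglongrightarrow> mehler \<sigma> (of_real 1 * a) x y"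
        using isCont_tendsto_compose[OF mehler_bounded(2)[OF a, of \<sigma> x y],
            of "\<lambda>n. 1 - inverse (real (Suc n))" sequentially]
        by (simp only: diff_zero)
      then show "(\<lambda>n. f x * mehler \<sigma> (of_real (1 - inverse (real (Suc n))) * a) x y) \<longlonglongrightarrow> f x * mehler \<sigma> a x y"
        by (intro tendsto_mult_left) simp
    qed
    show "AE x in ?M. cmod (f x * mehler \<sigma> (of_real (1 - inverse (real (Suc n))) * a) x y) \<le> cmod (f x) * B" for n
      by (intro AE_I2 le r)
  qed simp_all
qed

text \<open>Pointwise limit of the contractions at \<open>r * a\<close> as \<open>r\<close> tends to 1; the bounded support is what makes
  the pointwise limit exist.\<close>

lemma mehler_transform_contraction_boundary:
  assumes \<sigma>: "\<sigma> > 0" and a: "cmod a = 1" "a\<^sup>2 \<noteq> 1" and f: "sq_integrable (gauss \<sigma>) f"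
    and supp: "\<And>x. \<bar>x\<bar> > R \<Longrightarrow> f x = 0"
  shows "sq_integrable (gauss \<sigma>) (mehler_transform \<sigma> a f) \<and>
    l2norm (gauss \<sigma>) (mehler_transform \<sigma> a f) \<le> l2norm (gauss \<sigma>) f"
proof (rule l2_Fatou)
  \<comment> \<open>A sequence of radii in \<open>[0, 1)\<close> that tends to 1.\<close>
  let ?r = "\<lambda>n. complex_of_real (1 - inverse (real (Suc n)))"
  have r: "cmod (?r n * a) < 1" for n
  proof -
    have "cmod (?r n * a) = \<bar>1 - inverse (real (Suc n))\<bar>"
      by (simp only: norm_mult a norm_of_real mult_1_right)
    also have "\<dots> < 1" by (auto simp: field_simps abs_if)
    finally show ?thesis .
  qed
  show "sq_integrable (gauss \<sigma>) (mehler_transform \<sigma> (?r n * a) f)" for n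
    by (rule mehler_transform_contraction(1)[OF \<sigma> r f])
  show "l2norm (gauss \<sigma>) (mehler_transform \<sigma> (?r n * a) f) \<le> l2norm (gauss \<sigma>) f" for n
    by (rule mehler_transform_contraction(2)[OF \<sigma> r f])
  show "mehler_transform \<sigma> a f \<in> borel_measurable (gauss \<sigma>)"
    using mehler_transform_measurable[OF \<sigma>, of f] f by (simp add: sq_integrable_def)
  show "AE y in gauss \<sigma>. (\<lambda>n. mehler_transform \<sigma> (?r n * a) f y) \<longlonglongrightarrow> mehler_transform \<sigma> a f y"
    by (intro AE_I2 integrable_mehler_compact_support(2)[OF \<sigma> a f supp])
qed

section \<open>Rotations of the Gaussian space\<close>

definition l2_tendsto :: "'a measure \<Rightarrow> ('i \<Rightarrow> 'a \<Rightarrow> complex) \<Rightarrow> ('a \<Rightarrow> complex) \<Rightarrow> 'i filter \<Rightarrow> bool" where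
  "l2_tendsto M f g F \<longleftrightarrow> sq_integrable M g \<and> (\<forall>\<^sub>F t in F. sq_integrable M (f t)) \<and>
    ((\<lambda>t. l2norm M (\<lambda>x. f t x - g x)) \<longlongrightarrow> 0) F"

text \<open>For \<open>|a| = 1\<close>, the graph of the isometry that extends \<open>coh \<sigma> t \<mapsto> coh \<sigma> (a * t)\<close>, described as the closure of the
  graph on combinations of coherent states.\<close>

definition rotated :: "real \<Rightarrow> complex \<Rightarrow> (real \<Rightarrow> complex) \<Rightarrow> (real \<Rightarrow> complex) \<Rightarrow> bool" where
  "rotated \<sigma> a f g \<longleftrightarrow> sq_integrable (gauss \<sigma>) f \<and> sq_integrable (gauss \<sigma>) g \<and>
    (\<forall>e>0. \<exists>xs. l2norm (gauss \<sigma>) (\<lambda>x. f x - comb \<sigma> 1 xs x) < e \<and>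
      l2norm (gauss \<sigma>) (\<lambda>x. g x - comb \<sigma> a xs x) < e)"

text \<open>Approximate \<open>f\<close> by combinations at geometric speed. Their images form a Cauchy sequence, because the
  parameter change is isometric and compatible with differences, and completeness gives the limit.\<close>

lemma rotated_exists:
  assumes \<sigma>: "\<sigma> > 0" and a: "cmod a = 1" and f: "sq_integrable (gauss \<sigma>) f"
  shows "\<exists>g. rotated \<sigma> a f g"
proof -
  let ?M = "gauss \<sigma>"
  have "\<exists>xs. l2norm ?M (\<lambda>x. f x - comb \<sigma> 1 xs x) < (1/4) ^ k / 2" for k :: nat
    by (intro comb_dense[OF \<sigma> f]) simp
  then obtain xs where xs: "\<And>k. l2norm ?M (\<lambda>x. f x - comb \<sigma> 1 (xs k) x) < (1/4) ^ k / 2"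
    by metis
  have "\<exists>g. sq_integrable ?M g \<and> (\<lambda>k. l2norm ?M (\<lambda>x. comb \<sigma> a (xs k) x - g x)) \<longlonglongrightarrow> 0"
  proof (rule l2_complete)
    show "sq_integrable ?M (comb \<sigma> a (xs k))" for k by (rule sq_integrable_comb[OF \<sigma>])
    fix k m :: nat assume km: "k \<le> m"
    have "l2norm ?M (\<lambda>x. comb \<sigma> a (xs m) x - comb \<sigma> a (xs k) x) =
        l2norm ?M (comb \<sigma> a (xs m @ map (\<lambda>(c, t). (- 1 * c, t)) (xs k)))"
      by (simp only: comb_diff[symmetric])
    also have "\<dots> = l2norm ?M (comb \<sigma> 1 (xs m @ map (\<lambda>(c, t). (- 1 * c, t)) (xs k)))"
      by (rule l2norm_comb_unimodular[OF \<sigma> a])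
    also have "\<dots> = l2norm ?M (\<lambda>x. comb \<sigma> 1 (xs m) x - comb \<sigma> 1 (xs k) x)"
      by (simp only: comb_diff[symmetric])
    also have "\<dots> \<le> l2norm ?M (\<lambda>x. comb \<sigma> 1 (xs m) x - f x) + l2norm ?M (\<lambda>x. f x - comb \<sigma> 1 (xs k) x)"
      by (intro l2norm_triangle_diff f sq_integrable_comb \<sigma>)
    also have "\<dots> \<le> (1/4) ^ m / 2 + (1/4) ^ k / 2"
      using xs[of m] xs[of k] l2norm_minus_commute[of ?M "comb \<sigma> 1 (xs m)" f] by linarith
    also have "\<dots> \<le> (1/4) ^ k"
    proof -
      have "(1/4::real) ^ m \<le> (1/4) ^ k" using km by (rule power_decreasing) auto
      then show ?thesis by linarith
    qed
    finally show "l2norm ?M (\<lambda>x. comb \<sigma> a (xs m) x - comb \<sigma> a (xs k) x) \<le> (1/4) ^ k" .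
  qed
  then obtain g where g: "sq_integrable ?M g" "(\<lambda>k. l2norm ?M (\<lambda>x. comb \<sigma> a (xs k) x - g x)) \<longlonglongrightarrow> 0"
    by blast
  have "\<exists>xs. l2norm ?M (\<lambda>x. f x - comb \<sigma> 1 xs x) < e \<and> l2norm ?M (\<lambda>x. g x - comb \<sigma> a xs x) < e"
    if e: "e > 0" for e
  proof -
    have "eventually (\<lambda>k. l2norm ?M (\<lambda>x. comb \<sigma> a (xs k) x - g x) < e) sequentially"
      using g(2) e by (rule order_tendstoD)
    moreover have "eventually (\<lambda>k. (1/4::real) ^ k < e) sequentially"
      by (rule order_tendstoD(2)[OF LIMSEQ_power_zero e]) simp
    ultimately have "eventually (\<lambda>k. l2norm ?M (\<lambda>x. comb \<sigma> a (xs k) x - g x) < e \<and> (1/4) ^ k < e) sequentially"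
      by eventually_elim simp
    then obtain k where k: "l2norm ?M (\<lambda>x. comb \<sigma> a (xs k) x - g x) < e" "(1/4) ^ k < e"
      by (auto simp: eventually_sequentially)
    have "(1/4::real) ^ k > 0" by simp
    then have "l2norm ?M (\<lambda>x. f x - comb \<sigma> 1 (xs k) x) < e"
      using xs[of k] k(2) by linarith
    then show ?thesis
      using k(1) l2norm_minus_commute[of ?M g "comb \<sigma> a (xs k)"] by auto
  qed
  then show ?thesis using f g(1) unfolding rotated_def by blast
qed

lemma rotated_norm:
  assumes \<sigma>: "\<sigma> > 0" and a: "cmod a = 1" and r: "rotated \<sigma> a f g"
  shows "l2norm (gauss \<sigma>) g = l2norm (gauss \<sigma>) f"
proof -
  let ?M = "gauss \<sigma>"
  have sq: "sq_integrable ?M f" "sq_integrable ?M g" using r by (auto simp: rotated_def)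
  have "\<bar>l2norm ?M g - l2norm ?M f\<bar> \<le> e" if "e > 0" for e
  proof -
    obtain xs where xs: "l2norm ?M (\<lambda>x. f x - comb \<sigma> 1 xs x) < e / 2"
        "l2norm ?M (\<lambda>x. g x - comb \<sigma> a xs x) < e / 2"
      using r \<open>e > 0\<close> unfolding rotated_def by (meson half_gt_zero)
    then show ?thesis
      using l2norm_diff_ge[OF sq(1) sq_integrable_comb[OF \<sigma>], of 1 xs]
        l2norm_diff_ge[OF sq(2) sq_integrable_comb[OF \<sigma>], of a xs]
        l2norm_comb_unimodular[OF \<sigma> a, of xs] by linarith
  qed
  then have "\<bar>l2norm ?M g - l2norm ?M f\<bar> \<le> 0" by (intro field_le_epsilon[of _ 0]) simp
  then show ?thesis by simp
qed

text \<open>Isometries preserve inner products, here of \<open>f\<close> with \<open>coh \<sigma> s\<close>.\<close>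

lemma rotated_inner:
  assumes \<sigma>: "\<sigma> > 0" and a: "cmod a = 1" and r: "rotated \<sigma> a f g"
  shows "l2inner (gauss \<sigma>) g (coh \<sigma> (a * s)) = l2inner (gauss \<sigma>) f (coh \<sigma> s)"
proof -
  let ?M = "gauss \<sigma>"
  \<comment> \<open>The summand 1 only makes the constant positive.\<close>
  let ?C = "l2norm ?M (coh \<sigma> (a * s)) + l2norm ?M (coh \<sigma> s) + 1"
  have C: "?C > 0" by (simp add: add_nonneg_pos)
  have sq: "sq_integrable ?M f" "sq_integrable ?M g" using r by (auto simp: rotated_def)
  have "cmod (l2inner ?M g (coh \<sigma> (a * s)) - l2inner ?M f (coh \<sigma> s)) \<le> e" if e: "e > 0" for e
  proof -
    have "e / ?C > 0" using e C by simp
    then obtain xs where xs: "l2norm ?M (\<lambda>x. f x - comb \<sigma> 1 xs x) < e / ?C"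
        "l2norm ?M (\<lambda>x. g x - comb \<sigma> a xs x) < e / ?C"
      using r unfolding rotated_def by blast
    have comb1: "comb \<sigma> z [(1, s)] = coh \<sigma> (z * s)" for z
      by (simp add: comb_Cons fun_eq_iff)
    have "l2inner ?M (comb \<sigma> a xs) (coh \<sigma> (a * s)) = l2inner ?M (comb \<sigma> 1 xs) (coh \<sigma> s)"
      using sums_unique2[OF l2inner_comb_sums[OF \<sigma>, of a xs "[(1, s)]"]]
        l2inner_comb_sums[OF \<sigma>, of 1 xs "[(1, s)]"] by (simp only: a comb1 norm_one mult_1)
    then have "l2inner ?M g (coh \<sigma> (a * s)) - l2inner ?M f (coh \<sigma> s) =
        l2inner ?M (\<lambda>x. g x - comb \<sigma> a xs x) (coh \<sigma> (a * s)) - l2inner ?M (\<lambda>x. f x - comb \<sigma> 1 xs x) (coh \<sigma> s)"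
      by (simp add: l2inner_diff_left sq sq_integrable_comb \<sigma> sq_integrable_coh)
    also have "cmod \<dots> \<le> cmod (l2inner ?M (\<lambda>x. g x - comb \<sigma> a xs x) (coh \<sigma> (a * s))) +
        cmod (l2inner ?M (\<lambda>x. f x - comb \<sigma> 1 xs x) (coh \<sigma> s))"
      by (rule norm_triangle_ineq4)
    also have "\<dots> \<le> l2norm ?M (\<lambda>x. g x - comb \<sigma> a xs x) * l2norm ?M (coh \<sigma> (a * s)) +
        l2norm ?M (\<lambda>x. f x - comb \<sigma> 1 xs x) * l2norm ?M (coh \<sigma> s)"
      by (intro add_mono norm_l2inner_le sq_integrable_diff sq sq_integrable_comb \<sigma> sq_integrable_coh)
    also have "\<dots> \<le> e / ?C * l2norm ?M (coh \<sigma> (a * s)) + e / ?C * l2norm ?M (coh \<sigma> s)"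
      using xs by (intro add_mono mult_right_mono) auto
    also have "\<dots> = e / ?C * (?C - 1)" by (simp add: algebra_simps add_divide_distrib)
    also have "\<dots> \<le> e / ?C * ?C" using e C by (intro mult_left_mono) auto
    also have "\<dots> = e" using C by simp
    finally show ?thesis .
  qed
  then have "cmod (l2inner ?M g (coh \<sigma> (a * s)) - l2inner ?M f (coh \<sigma> s)) \<le> 0"
    by (intro field_le_epsilon[of _ 0]) simp
  then show ?thesis by simp
qed

text \<open>Density: \<open>h\<close> is a limit of combinations that are all orthogonal to it.\<close>

lemma orthogonal_coh_imp_zero:
  assumes \<sigma>: "\<sigma> > 0" and h: "sq_integrable (gauss \<sigma>) h"
    and orth: "\<And>s. l2inner (gauss \<sigma>) h (coh \<sigma> s) = 0"
  shows "l2norm (gauss \<sigma>) h = 0"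
proof -
  let ?M = "gauss \<sigma>"
  have comb: "l2inner ?M h (comb \<sigma> 1 xs) = 0" for xs
  proof (induction xs)
    case Nil
    then show ?case by (simp add: l2inner_def)
  next
    case (Cons b xs)
    obtain c t where "b = (c, t)" by force
    then have "comb \<sigma> 1 (b # xs) = (\<lambda>x. c * coh \<sigma> t x + comb \<sigma> 1 xs x)"
      by (simp add: comb_Cons fun_eq_iff)
    then show ?case
      using l2inner_add_right[OF sq_integrable_cmult[OF sq_integrable_coh[OF \<sigma>]] sq_integrable_comb[OF \<sigma>] h]
        Cons orth by (simp add: l2inner_cmult_right)
  qed
  have "l2norm ?M h \<le> e" if e: "e > 0" for e
  proof (cases "l2norm ?M h = 0")
    case False
    obtain xs where xs: "l2norm ?M (\<lambda>x. h x - comb \<sigma> 1 xs x) < e"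
      using comb_dense[OF \<sigma> h e] by blast
    have "complex_of_real ((l2norm ?M h)\<^sup>2) = l2inner ?M (\<lambda>x. h x - comb \<sigma> 1 xs x) h"
      unfolding l2inner_self[symmetric] using comb[of xs] l2inner_commute[of ?M "comb \<sigma> 1 xs" h]
      by (simp add: l2inner_diff_left h sq_integrable_comb \<sigma>)
    then have "(l2norm ?M h)\<^sup>2 = cmod (l2inner ?M (\<lambda>x. h x - comb \<sigma> 1 xs x) h)"
      by (metis norm_of_real abs_of_nonneg zero_le_power2)
    also have "\<dots> \<le> l2norm ?M (\<lambda>x. h x - comb \<sigma> 1 xs x) * l2norm ?M h"
      by (intro norm_l2inner_le sq_integrable_diff h sq_integrable_comb \<sigma>)
    also have "\<dots> \<le> e * l2norm ?M h"
      using xs by (intro mult_right_mono) auto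
    finally show ?thesis
      using False l2norm_nonneg[of ?M h] by (simp add: power2_eq_square)
  qed (use e in simp)
  then have "l2norm ?M h \<le> 0" by (intro field_le_epsilon[of _ 0]) simp
  then show ?thesis using l2norm_nonneg[of ?M h] by linarith
qed

text \<open>Contractivity transfers convergence from combinations to \<open>f\<close>: the definition of \<open>rotated\<close> approximates
  \<open>f\<close> and \<open>g\<close> by the two values of one and the same formal combination.\<close>

lemma rotated_limit:
  assumes \<sigma>: "\<sigma> > 0" and r: "rotated \<sigma> a f g"
    and bound: "\<forall>\<^sub>F t in F. \<forall>u. sq_integrable (gauss \<sigma>) u \<longrightarrow>
      sq_integrable (gauss \<sigma>) (U t u) \<and> l2norm (gauss \<sigma>) (U t u) \<le> l2norm (gauss \<sigma>) u"
    and diff: "\<forall>\<^sub>F t in F. \<forall>u v x. sq_integrable (gauss \<sigma>) u \<longrightarrow> sq_integrable (gauss \<sigma>) v \<longrightarrow>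
      U t (\<lambda>x. u x - v x) x = U t u x - U t v x"
    and comb: "\<And>xs. l2_tendsto (gauss \<sigma>) (\<lambda>t. U t (comb \<sigma> 1 xs)) (comb \<sigma> a xs) F"
  shows "l2_tendsto (gauss \<sigma>) (\<lambda>t. U t f) g F"
proof -
  let ?M = "gauss \<sigma>"
  have sq: "sq_integrable ?M f" "sq_integrable ?M g" using r by (auto simp: rotated_def)
  have "((\<lambda>t. l2norm ?M (\<lambda>x. U t f x - g x)) \<longlongrightarrow> 0) F"
  proof (rule tendstoI)
    fix e :: real assume e: "e > 0"
    then have "e / 3 > 0" by simp
    then obtain xs where xs: "l2norm ?M (\<lambda>x. f x - comb \<sigma> 1 xs x) < e / 3"
        "l2norm ?M (\<lambda>x. g x - comb \<sigma> a xs x) < e / 3"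
      using r unfolding rotated_def by blast
    let ?d = "comb \<sigma> 1 xs" and ?d' = "comb \<sigma> a xs"
    have d: "sq_integrable ?M ?d" "sq_integrable ?M ?d'" by (intro sq_integrable_comb \<sigma>)+
    have "\<forall>\<^sub>F t in F. l2norm ?M (\<lambda>x. U t ?d x - ?d' x) < e / 3"
      by (rule order_tendstoD(2)[OF conjunct2[OF conjunct2[OF comb[of xs, unfolded l2_tendsto_def]]] \<open>e / 3 > 0\<close>])
    with bound diff show "\<forall>\<^sub>F t in F. dist (l2norm ?M (\<lambda>x. U t f x - g x)) 0 < e"
    proof eventually_elim
      case (elim t)
      have U: "sq_integrable ?M (U t f)" "sq_integrable ?M (U t ?d)" using elim(1) sq d by blast+
      have "l2norm ?M (\<lambda>x. U t f x - U t ?d x) = l2norm ?M (U t (\<lambda>x. f x - ?d x))"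
        using elim(2) sq d by (intro arg_cong[where f = "l2norm ?M"]) auto
      also have "\<dots> \<le> l2norm ?M (\<lambda>x. f x - ?d x)"
        using elim(1) sq_integrable_diff[OF sq(1) d(1)] by blast
      finally have 1: "l2norm ?M (\<lambda>x. U t f x - U t ?d x) < e / 3" using xs(1) by simp
      have 2: "l2norm ?M (\<lambda>x. ?d' x - g x) < e / 3" using xs(2) by (simp only: l2norm_minus_commute)
      have "l2norm ?M (\<lambda>x. U t f x - g x) < e"
        using l2norm_triangle_diff[OF U(1) U(2) sq(2)] l2norm_triangle_diff[OF U(2) d(2) sq(2)]
          1 2 elim(3) by linarith
      then show ?case by simp
    qed
  qed
  moreover have "\<forall>\<^sub>F t in F. sq_integrable ?M (U t f)"
    using bound by eventually_elim (use sq in blast)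
  ultimately show ?thesis using sq by (simp add: l2_tendsto_def)
qed

text \<open>Contractivity is \<open>mehler_transform_contraction_boundary\<close>. On a combination \<open>d\<close> of coherent states the
  full integral converges absolutely, so \<open>mehler_transform_comb\<close> identifies the pointwise limit as
  \<open>R\<close> grows. The distance to that limit is at most the norm of the part of \<open>d\<close> outside \<open>[-R, R]\<close>: the
  difference of two truncations is again the transform of a function with bounded support.\<close>

lemma l2_tendsto_truncated_mehler:
  assumes \<sigma>: "\<sigma> > 0" and a: "cmod a = 1" "a\<^sup>2 \<noteq> 1" and r: "rotated \<sigma> a f g"
  shows "l2_tendsto (gauss \<sigma>) (\<lambda>R. mehler_transform \<sigma> a (\<lambda>x. indicator {-R..R} x * f x)) g at_top"
proof (rule rotated_limit[OF \<sigma> r])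
  let ?M = "gauss \<sigma>"
  let ?U = "\<lambda>R f. mehler_transform \<sigma> a (\<lambda>x. indicator {-R..R} x * f x)"
  have supp: "indicator {-R..R} x * u x = 0" if "\<bar>x\<bar> > R" for R x and u :: "real \<Rightarrow> complex"
    using that by (auto simp: indicator_def)
  have ind: "sq_integrable ?M (\<lambda>x. indicator {-R..R} x * u x)" if "sq_integrable ?M u" for u and R :: real
    using that by (intro sq_integrable_restrict) simp_all
  have contr: "sq_integrable ?M (?U R u) \<and> l2norm ?M (?U R u) \<le> l2norm ?M (\<lambda>x. indicator {-R..R} x * u x)"
    if u: "sq_integrable ?M u" for R u
    by (rule mehler_transform_contraction_boundary[OF \<sigma> a ind[OF u]]) (rule supp)
  have bound: "sq_integrable ?M (?U R u) \<and> l2norm ?M (?U R u) \<le> l2norm ?M u" if u: "sq_integrable ?M u" for R u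
  proof -
    have "l2norm ?M (\<lambda>x. indicator {-R..R} x * u x) \<le> l2norm ?M u"
      by (intro l2norm_mono u) (auto simp: indicator_def)
    then show ?thesis using contr[OF u] by (meson order_trans)
  qed
  then show "\<forall>\<^sub>F R in at_top. \<forall>u. sq_integrable ?M u \<longrightarrow> sq_integrable ?M (?U R u) \<and> l2norm ?M (?U R u) \<le> l2norm ?M u"
    by (intro always_eventually) blast
  have int: "integrable ?M (\<lambda>x. indicator {-R..R} x * u x * mehler \<sigma> a x y)" if u: "sq_integrable ?M u" for R u y
    by (rule integrable_mehler_compact_support(1)[OF \<sigma> a ind[OF u]]) (rule supp)
  have diff: "?U R (\<lambda>x. u x - v x) y = ?U R u y - ?U R v y" if u: "sq_integrable ?M u" and v: "sq_integrable ?M v" for R u v y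
    using mehler_transform_diff[OF int[OF u] int[OF v]]
    by (simp add: right_diff_distrib)
  then show "\<forall>\<^sub>F R in at_top. \<forall>u v x. sq_integrable ?M u \<longrightarrow> sq_integrable ?M v \<longrightarrow>
      ?U R (\<lambda>x. u x - v x) x = ?U R u x - ?U R v x"
    by (intro always_eventually) blast
  fix xs
  let ?d = "comb \<sigma> 1 xs" and ?g = "comb \<sigma> a xs"
  have d: "sq_integrable ?M ?d" "sq_integrable ?M ?g" by (intro sq_integrable_comb \<sigma>)+
  then have [measurable]: "?d \<in> borel_measurable borel" by (simp add: sq_integrable_def)
  let ?tail = "\<lambda>R x. ?d x - indicator {-R..R} x * ?d x"
  have tail: "l2norm ?M (\<lambda>y. ?U R ?d y - ?g y) \<le> l2norm ?M (?tail R)" for R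
  proof -
    \<comment> \<open>Differences of truncations have bounded support, so they are contracted.\<close>
    let ?h = "\<lambda>n x. indicator {-R..R} x * ?d x - indicator {-(R + real n)..R + real n} x * ?d x"
    have h: "sq_integrable ?M (?h n)" for n by (intro sq_integrable_diff ind d)
    have hs: "?h n x = 0" if "\<bar>x\<bar> > R + real n" for n x using that by (auto simp: indicator_def)
    have hc: "sq_integrable ?M (mehler_transform \<sigma> a (?h n)) \<and> l2norm ?M (mehler_transform \<sigma> a (?h n)) \<le> l2norm ?M (?h n)" for n
      by (rule mehler_transform_contraction_boundary[OF \<sigma> a h]) (rule hs)
    have "sq_integrable ?M (\<lambda>y. ?U R ?d y - ?g y) \<and> l2norm ?M (\<lambda>y. ?U R ?d y - ?g y) \<le> l2norm ?M (?tail R)"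
    proof (rule l2_Fatou)
      show "sq_integrable ?M (mehler_transform \<sigma> a (?h n))" for n
        using hc by blast
      have "l2norm ?M (?h n) \<le> l2norm ?M (?tail R)" for n
        by (intro l2norm_mono sq_integrable_diff ind d) (auto simp: indicator_def)
      then show "l2norm ?M (mehler_transform \<sigma> a (?h n)) \<le> l2norm ?M (?tail R)" for n
        using hc by (meson order_trans)
      show "(\<lambda>y. ?U R ?d y - ?g y) \<in> borel_measurable ?M"
        using sq_integrable_diff[OF conjunct1[OF bound[OF d(1)]] d(2)] by (simp add: sq_integrable_def)
      show "AE y in ?M. (\<lambda>n. mehler_transform \<sigma> a (?h n) y) \<longlonglongrightarrow> ?U R ?d y - ?g y"
      proof (rule AE_I2)
        fix y
        have dm: "integrable ?M (\<lambda>x. ?d x * mehler \<sigma> a x y)" "mehler_transform \<sigma> a ?d y = ?g y"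
          using mehler_transform_comb[OF \<sigma> _ a(2), of xs y] a(1) by simp_all
        have "(\<lambda>n. \<integral>x. indicator {-(R + real n)..R + real n} x * ?d x * mehler \<sigma> a x y \<partial>?M) \<longlonglongrightarrow>
            (\<integral>x. ?d x * mehler \<sigma> a x y \<partial>?M)"
        proof (rule integral_dominated_convergence[OF _ _ integrable_norm[OF dm(1)]])
          show "AE x in ?M. (\<lambda>n. indicator {-(R + real n)..R + real n} x * ?d x * mehler \<sigma> a x y)
              \<longlonglongrightarrow> ?d x * mehler \<sigma> a x y"
          proof (rule AE_I2, rule tendsto_eventually)
            fix x
            obtain m :: nat where m: "\<bar>x\<bar> - R \<le> real m" using real_arch_simple by blast
            show "\<forall>\<^sub>F n in sequentially. indicator {-(R + real n)..R + real n} x * ?d x * mehler \<sigma> a x y =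
                ?d x * mehler \<sigma> a x y"
              unfolding eventually_sequentially
            proof (intro exI allI impI)
              fix n assume "m \<le> n"
              then have "x \<in> {-(R + real n)..R + real n}" using m by (auto simp: abs_le_iff)
              then show "indicator {-(R + real n)..R + real n} x * ?d x * mehler \<sigma> a x y = ?d x * mehler \<sigma> a x y"
                by simp
            qed
          qed
          show "AE x in ?M. cmod (indicator {-(R + real n)..R + real n} x * ?d x * mehler \<sigma> a x y)
              \<le> cmod (?d x * mehler \<sigma> a x y)" for n
            by (intro AE_I2) (simp add: indicator_def)
        qed simp_all
        then have "(\<lambda>n. ?U (R + real n) ?d y) \<longlonglongrightarrow> ?g y"
          by (simp add: dm(2)[symmetric] mehler_transform_def)
        moreover have "mehler_transform \<sigma> a (?h n) y = ?U R ?d y - ?U (R + real n) ?d y" for n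
          by (rule mehler_transform_diff[OF int[OF d(1)] int[OF d(1)]])
        ultimately show "(\<lambda>n. mehler_transform \<sigma> a (?h n) y) \<longlonglongrightarrow> ?U R ?d y - ?g y"
          by (simp only:) (intro tendsto_diff tendsto_const)
      qed
    qed
    then show ?thesis ..
  qed
  have d2: "integrable ?M (\<lambda>x. (cmod (?d x))\<^sup>2)" using d by (simp add: sq_integrable_def)
  have "((\<lambda>R. \<integral>x. (cmod (?tail R x))\<^sup>2 \<partial>?M) \<longlongrightarrow> (\<integral>x. 0 \<partial>?M)) at_top"
  proof (rule integral_dominated_convergence_at_top[OF _ _ d2])
    show "\<forall>\<^sub>F R in at_top. AE x in ?M. norm ((cmod (?tail R x))\<^sup>2) \<le> (cmod (?d x))\<^sup>2"
      by (intro always_eventually allI AE_I2) (simp add: indicator_def)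
    show "AE x in ?M. ((\<lambda>R. (cmod (?tail R x))\<^sup>2) \<longlongrightarrow> 0) at_top"
    proof (rule AE_I2, rule tendsto_eventually)
      fix x :: real
      show "\<forall>\<^sub>F R in at_top. (cmod (?tail R x))\<^sup>2 = 0"
        using eventually_ge_at_top[of "\<bar>x\<bar>"] by eventually_elim (auto simp: indicator_def)
    qed
  qed auto
  then have "((\<lambda>R. sqrt (\<integral>x. (cmod (?tail R x))\<^sup>2 \<partial>?M)) \<longlongrightarrow> sqrt (\<integral>x. 0 \<partial>?M)) at_top"
    by (rule tendsto_real_sqrt)
  then have "((\<lambda>R. l2norm ?M (?tail R)) \<longlongrightarrow> 0) at_top"
    by (simp add: l2norm_def)
  then have "((\<lambda>R. l2norm ?M (\<lambda>y. ?U R ?d y - ?g y)) \<longlongrightarrow> 0) at_top"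
    by (rule Lim_null_comparison[rotated])
      (intro always_eventually allI, simp only: real_norm_def abs_of_nonneg l2norm_nonneg tail)
  then show "l2_tendsto ?M (\<lambda>R. ?U R ?d) ?g at_top"
    using bound[OF d(1)] d(2) by (simp add: l2_tendsto_def)
qed

text \<open>Contractivity is \<open>mehler_transform_contraction\<close>, and on combinations the transform at \<open>r * a\<close> is just
  the parameter change by \<open>r * a\<close>, which is continuous in \<open>r\<close> by the formula for inner products of
  coherent states.\<close>

lemma l2_tendsto_radial_mehler:
  assumes \<sigma>: "\<sigma> > 0" and a: "cmod a = 1" and r: "rotated \<sigma> a f g"
  shows "l2_tendsto (gauss \<sigma>) (\<lambda>r. mehler_transform \<sigma> (of_real r * a) f) g (at_left 1)"
proof (rule rotated_limit[OF \<sigma> r])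
  let ?M = "gauss \<sigma>"
  let ?U = "\<lambda>r f. mehler_transform \<sigma> (of_real r * a) f"
  have ev: "\<forall>\<^sub>F r in at_left 1. 0 < r \<and> r < (1::real)"
    using eventually_at_left_real[of 0 "1::real"] by simp
  have lt: "cmod (of_real r * a) < 1" if "0 < r \<and> r < 1" for r
    using that a by (simp add: norm_mult)
  show "\<forall>\<^sub>F r in at_left 1. \<forall>u. sq_integrable ?M u \<longrightarrow> sq_integrable ?M (?U r u) \<and> l2norm ?M (?U r u) \<le> l2norm ?M u"
    using ev by eventually_elim (use mehler_transform_contraction[OF \<sigma> lt] in blast)
  show "\<forall>\<^sub>F r in at_left 1. \<forall>u v x. sq_integrable ?M u \<longrightarrow> sq_integrable ?M v \<longrightarrow>
      ?U r (\<lambda>x. u x - v x) x = ?U r u x - ?U r v x"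
    using ev by eventually_elim
      (use integrable_mult_sq[OF _ sq_integrable_mehler[OF \<sigma> lt]] mehler_transform_diff in blast)
  fix xs
  have coh: "((\<lambda>r. l2norm ?M (\<lambda>x. coh \<sigma> (of_real r * a * t) x - coh \<sigma> (a * t) x)) \<longlongrightarrow> 0) (at_left 1)" for t
  proof -
    let ?e = "\<lambda>u v. exp (2 * of_real \<sigma> * u * cnj v)"
    have "complex_of_real ((l2norm ?M (\<lambda>x. coh \<sigma> u x - coh \<sigma> v x))\<^sup>2) = ?e u u - ?e v u - (?e u v - ?e v v)" for u v
    proof -
      note s = sq_integrable_coh[OF \<sigma>]
      have "l2inner ?M w (\<lambda>x. coh \<sigma> u x - coh \<sigma> v x) = l2inner ?M w (coh \<sigma> u) - l2inner ?M w (coh \<sigma> v)"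
        if "sq_integrable ?M w" for w
        using l2inner_diff_left[OF s s that] l2inner_commute by (metis complex_cnj_diff)
      then show ?thesis
        unfolding l2inner_self[symmetric]
        by (simp only: l2inner_diff_left[OF s s sq_integrable_diff[OF s s]] s l2inner_coh[OF \<sigma>]) simp
    qed
    then have sq: "(l2norm ?M (\<lambda>x. coh \<sigma> u x - coh \<sigma> v x))\<^sup>2 = Re (?e u u - ?e v u - (?e u v - ?e v v))" for u v
      by (metis Re_complex_of_real)
    let ?R = "\<lambda>r. Re (?e (of_real r * a * t) (of_real r * a * t) - ?e (a * t) (of_real r * a * t)
        - (?e (of_real r * a * t) (a * t) - ?e (a * t) (a * t)))"
    have "((\<lambda>r. sqrt (?R r)) \<longlongrightarrow> sqrt (?R 1)) (at_left 1)"
      by (intro tendsto_intros)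
    moreover have "sqrt (?R 1) = 0" by (simp only: of_real_1 mult_1) simp
    moreover have "l2norm ?M (\<lambda>x. coh \<sigma> (of_real r * a * t) x - coh \<sigma> (a * t) x) = sqrt (?R r)" for r
      by (simp only: sq[symmetric] real_sqrt_abs abs_of_nonneg l2norm_nonneg)
    ultimately show ?thesis by (simp only:)
  qed
  have "((\<lambda>r. l2norm ?M (\<lambda>x. comb \<sigma> (of_real r * a) xs x - comb \<sigma> a xs x)) \<longlongrightarrow> 0) (at_left 1)"
  proof (induction xs)
    case Nil
    then show ?case by (simp add: l2norm_def)
  next
    case (Cons b xs)
    obtain c t where b: "b = (c, t)" by force
    let ?A = "\<lambda>r. l2norm ?M (\<lambda>x. coh \<sigma> (of_real r * a * t) x - coh \<sigma> (a * t) x)"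
    let ?B = "\<lambda>r. l2norm ?M (\<lambda>x. comb \<sigma> (of_real r * a) xs x - comb \<sigma> a xs x)"
    have le: "l2norm ?M (\<lambda>x. comb \<sigma> (of_real r * a) (b # xs) x - comb \<sigma> a (b # xs) x) \<le> cmod c * ?A r + ?B r" for r
    proof -
      have "(\<lambda>x. comb \<sigma> (of_real r * a) (b # xs) x - comb \<sigma> a (b # xs) x) =
         (\<lambda>x. c * (coh \<sigma> (of_real r * a * t) x - coh \<sigma> (a * t) x) + (comb \<sigma> (of_real r * a) xs x - comb \<sigma> a xs x))"
        by (simp add: b comb_Cons algebra_simps)
      then show ?thesis
        unfolding l2norm_cmult[symmetric]
        by (simp only:) (intro l2norm_triangle sq_integrable_cmult sq_integrable_diff sq_integrable_coh sq_integrable_comb \<sigma>)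
    qed
    have "((\<lambda>r. cmod c * ?A r + ?B r) \<longlongrightarrow> cmod c * 0 + 0) (at_left 1)"
      by (intro tendsto_add tendsto_mult_left coh Cons)
    then have "((\<lambda>r. cmod c * ?A r + ?B r) \<longlongrightarrow> 0) (at_left 1)" by simp
    then show ?case
      by (rule Lim_null_comparison[rotated])
        (intro always_eventually allI, simp only: real_norm_def abs_of_nonneg l2norm_nonneg le)
  qed
  moreover have eq: "\<forall>\<^sub>F r in at_left 1. ?U r (comb \<sigma> 1 xs) = comb \<sigma> (of_real r * a) xs"
    using ev
  proof eventually_elim
    case (elim r)
    have "cmod ((of_real r * a)\<^sup>2) < 1" using lt[OF elim] by (simp add: norm_power power_less_one_iff)
    then have "(of_real r * a)\<^sup>2 \<noteq> 1" by auto
    then show ?case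
      using mehler_transform_comb[OF \<sigma> less_imp_le[OF lt[OF elim]]] by (auto simp: fun_eq_iff)
  qed
  ultimately have "((\<lambda>r. l2norm ?M (\<lambda>x. ?U r (comb \<sigma> 1 xs) x - comb \<sigma> a xs x)) \<longlongrightarrow> 0) (at_left 1)"
    by (elim Lim_transform_eventually) (auto elim: eventually_mono)
  moreover have "\<forall>\<^sub>F r in at_left 1. sq_integrable ?M (?U r (comb \<sigma> 1 xs))"
    using eq by eventually_elim (simp add: sq_integrable_comb[OF \<sigma>])
  ultimately show "l2_tendsto ?M (\<lambda>r. ?U r (comb \<sigma> 1 xs)) (comb \<sigma> a xs) (at_left 1)"
    by (simp add: l2_tendsto_def sq_integrable_comb[OF \<sigma>])
qed

section \<open>Hermite polynomials as eigenvectors\<close>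

lemma poly_exp_bound:
  fixes p :: "real poly"
  shows "\<exists>C k. 0 \<le> C \<and> 0 \<le> k \<and> (\<forall>x. \<bar>poly p x\<bar> \<le> C * exp (k * \<bar>x\<bar>))"
proof (induction p)
  case 0
  show ?case by (intro exI[of _ 0]) simp
next
  case (pCons a p)
  then obtain C k where C: "0 \<le> C" "0 \<le> k" and le: "\<And>x. \<bar>poly p x\<bar> \<le> C * exp (k * \<bar>x\<bar>)" by blast
  have "\<bar>poly (pCons a p) x\<bar> \<le> (\<bar>a\<bar> + C) * exp ((k + 1) * \<bar>x\<bar>)" for x
  proof -
    have "\<bar>x\<bar> * \<bar>poly p x\<bar> \<le> exp \<bar>x\<bar> * (C * exp (k * \<bar>x\<bar>))"
      by (intro mult_mono le order_trans[OF _ exp_ge_add_one_self[of "\<bar>x\<bar>"]]) auto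
    also have "\<dots> = C * exp ((k + 1) * \<bar>x\<bar>)" by (simp add: ring_distribs exp_add)
    finally have 1: "\<bar>x * poly p x\<bar> \<le> C * exp ((k + 1) * \<bar>x\<bar>)" by (simp add: abs_mult)
    have "\<bar>a\<bar> * 1 \<le> \<bar>a\<bar> * exp ((k + 1) * \<bar>x\<bar>)"
      using C by (intro mult_left_mono) auto
    then show ?thesis using 1 abs_triangle_ineq[of a "x * poly p x"] by (simp add: ring_distribs)
  qed
  then show ?case using C by (intro exI[of _ "\<bar>a\<bar> + C"] exI[of _ "k + 1"]) auto
qed

lemma exp_abs_le: "exp (k * \<bar>x\<bar>) \<le> exp (k * x) + exp ((- k) * (x::real))"
  by (cases "x \<ge> 0") (auto simp: abs_if)

abbreviation gauss_deriv :: "real \<Rightarrow> nat \<Rightarrow> real \<Rightarrow> real" where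
  "gauss_deriv \<sigma> n \<equiv> (deriv ^^ n) (\<lambda>t. exp (- \<sigma> * t\<^sup>2))"

lemma gauss_deriv_poly: "\<exists>p. gauss_deriv \<sigma> n = (\<lambda>x. poly p x * exp (- \<sigma> * x\<^sup>2))"
proof (induction n)
  case 0
  show ?case by (intro exI[of _ 1]) simp
next
  case (Suc n)
  then obtain p where p: "gauss_deriv \<sigma> n = (\<lambda>x. poly p x * exp (- \<sigma> * x\<^sup>2))" by blast
  let ?q = "pderiv p + [:0, - 2 * \<sigma>:] * p"
  have "((\<lambda>x. poly p x * exp (- \<sigma> * x\<^sup>2)) has_real_derivative poly ?q x * exp (- \<sigma> * x\<^sup>2)) (at x)" for x
    by (auto intro!: derivative_eq_intros simp: algebra_simps)
  then have "deriv (gauss_deriv \<sigma> n) = (\<lambda>x. poly ?q x * exp (- \<sigma> * x\<^sup>2))"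
    unfolding p by (intro ext DERIV_imp_deriv)
  then show ?case by (intro exI[of _ ?q]) simp
qed

lemma gauss_deriv_has_derivative:
  "(gauss_deriv \<sigma> n has_real_derivative gauss_deriv \<sigma> (Suc n) x) (at x)"
proof -
  obtain p where p: "gauss_deriv \<sigma> n = (\<lambda>x. poly p x * exp (- \<sigma> * x\<^sup>2))"
    using gauss_deriv_poly by blast
  have "gauss_deriv \<sigma> n differentiable (at x)"
    unfolding p real_differentiable_def by (auto intro!: exI derivative_eq_intros)
  then show ?thesis by (simp add: DERIV_deriv_iff_real_differentiable)
qed

lemma gauss_deriv_bound:
  "\<exists>C k. 0 \<le> C \<and> 0 \<le> k \<and> (\<forall>x. \<bar>gauss_deriv \<sigma> n x\<bar> \<le> C * exp (k * \<bar>x\<bar>) * exp (- \<sigma> * x\<^sup>2))"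
proof -
  obtain p where p: "gauss_deriv \<sigma> n = (\<lambda>x. poly p x * exp (- \<sigma> * x\<^sup>2))"
    using gauss_deriv_poly by blast
  obtain C k where "0 \<le> C" "0 \<le> k" "\<And>x. \<bar>poly p x\<bar> \<le> C * exp (k * \<bar>x\<bar>)"
    using poly_exp_bound[of p] by blast
  then show ?thesis
    unfolding p by (intro exI[of _ C] exI[of _ k]) (auto simp: abs_mult intro!: mult_right_mono)
qed

lemma continuous_gauss_deriv: "continuous_on UNIV (gauss_deriv \<sigma> n)"
  by (rule DERIV_continuous_on[OF has_field_derivative_at_within[OF gauss_deriv_has_derivative]])

text \<open>This dominating function serves both for integrability and for the vanishing of the boundary terms
  in the integration by parts.\<close>

lemma gauss_deriv_exp_bound:
  "\<exists>C k. 0 \<le> C \<and> (\<forall>x. cmod (of_real (gauss_deriv \<sigma> n x) * exp (of_real x * s)) \<le>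
    C * (exp (k * x - \<sigma> * x\<^sup>2) + exp ((- k) * x - \<sigma> * x\<^sup>2)))"
proof -
  obtain C k where C: "0 \<le> C" "0 \<le> k"
    and le: "\<And>x. \<bar>gauss_deriv \<sigma> n x\<bar> \<le> C * exp (k * \<bar>x\<bar>) * exp (- \<sigma> * x\<^sup>2)"
    using gauss_deriv_bound by blast
  let ?k = "k + \<bar>Re s\<bar>"
  have "cmod (of_real (gauss_deriv \<sigma> n x) * exp (of_real x * s)) \<le>
    C * (exp (?k * x - \<sigma> * x\<^sup>2) + exp ((- ?k) * x - \<sigma> * x\<^sup>2))" for x
  proof -
    have "x * Re s \<le> \<bar>Re s\<bar> * \<bar>x\<bar>"
      by (metis abs_ge_self abs_mult mult.commute)
    then have "exp (x * Re s) \<le> exp (\<bar>Re s\<bar> * \<bar>x\<bar>)" by simp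
    then have "\<bar>gauss_deriv \<sigma> n x\<bar> * exp (x * Re s) \<le>
        (C * exp (k * \<bar>x\<bar>) * exp (- \<sigma> * x\<^sup>2)) * exp (\<bar>Re s\<bar> * \<bar>x\<bar>)"
      using C by (intro mult_mono le) auto
    also have "\<dots> = C * exp (- \<sigma> * x\<^sup>2) * exp (?k * \<bar>x\<bar>)"
      by (simp add: ring_distribs exp_add)
    also have "\<dots> \<le> C * exp (- \<sigma> * x\<^sup>2) * (exp (?k * x) + exp ((- ?k) * x))"
      using C by (intro mult_left_mono exp_abs_le) auto
    also have "\<dots> = C * (exp (?k * x - \<sigma> * x\<^sup>2) + exp ((- ?k) * x - \<sigma> * x\<^sup>2))"
      by (simp only: diff_conv_add_uminus exp_add mult_minus_left) (simp only: ring_distribs mult_ac)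
    finally show ?thesis by (simp add: norm_mult)
  qed
  then show ?thesis using C by blast
qed

lemma integrable_gauss_deriv_exp:
  assumes \<sigma>: "\<sigma> > 0"
  shows "integrable lborel (\<lambda>x. of_real (gauss_deriv \<sigma> n x) * exp (of_real x * s :: complex))"
proof -
  obtain C k where C: "0 \<le> C" and le: "\<And>x. cmod (of_real (gauss_deriv \<sigma> n x) * exp (of_real x * s)) \<le>
    C * (exp (k * x - \<sigma> * x\<^sup>2) + exp ((- k) * x - \<sigma> * x\<^sup>2))"
    using gauss_deriv_exp_bound by blast
  have "integrable lborel (\<lambda>x. C * (exp (k * x - \<sigma> * x\<^sup>2) + exp ((- k) * x - \<sigma> * x\<^sup>2)))"
    by (intro integrable_mult_right Bochner_Integration.integrable_add real_gaussian_integral(1) \<sigma>)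
  moreover have "continuous_on UNIV (\<lambda>x. of_real (gauss_deriv \<sigma> n x) * exp (of_real x * s :: complex))"
    by (intro continuous_intros continuous_gauss_deriv)
  then have "(\<lambda>x. of_real (gauss_deriv \<sigma> n x) * exp (of_real x * s :: complex)) \<in> borel_measurable lborel"
    using borel_measurable_continuous_onI by simp
  moreover have "AE x in lborel. cmod (of_real (gauss_deriv \<sigma> n x) * exp (of_real x * s)) \<le>
      norm (C * (exp (k * x - \<sigma> * x\<^sup>2) + exp ((- k) * x - \<sigma> * x\<^sup>2)))"
    by (intro AE_I2 order_trans[OF le]) simp
  ultimately show ?thesis by (rule Bochner_Integration.integrable_bound)
qed

lemma gaussian_exp_tendsto_0:
  assumes "\<sigma> > 0"
  shows "((\<lambda>x::real. exp (k * x - \<sigma> * x\<^sup>2)) \<longlongrightarrow> 0) at_top" "((\<lambda>x::real. exp (k * x - \<sigma> * x\<^sup>2)) \<longlongrightarrow> 0) at_bot"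
  using assms by real_asymp+

text \<open>Integration by parts on the whole line.\<close>

lemma gauss_deriv_exp_integral_Suc:
  assumes \<sigma>: "\<sigma> > 0"
  shows "(\<integral>x. of_real (gauss_deriv \<sigma> (Suc n) x) * exp (of_real x * s :: complex) \<partial>lborel) =
    - s * (\<integral>x. of_real (gauss_deriv \<sigma> n x) * exp (of_real x * s) \<partial>lborel)"
proof -
  let ?F = "\<lambda>x. of_real (gauss_deriv \<sigma> n x) * exp (of_real x * s :: complex)"
  let ?f = "\<lambda>x. of_real (gauss_deriv \<sigma> (Suc n) x) * exp (of_real x * s) +
    s * (of_real (gauss_deriv \<sigma> n x) * exp (of_real x * s))"
  have i: "integrable lborel ?f"
    by (intro Bochner_Integration.integrable_add integrable_mult_right integrable_gauss_deriv_exp \<sigma>)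
  obtain C k where C: "0 \<le> C" and le: "\<And>x. cmod (?F x) \<le>
    C * (exp (k * x - \<sigma> * x\<^sup>2) + exp ((- k) * x - \<sigma> * x\<^sup>2))"
    using gauss_deriv_exp_bound by blast
  have lim: "(?F \<longlongrightarrow> 0) F" if F: "F = at_top \<or> F = at_bot" for F
  proof (rule Lim_null_comparison)
    show "\<forall>\<^sub>F x in F. cmod (?F x) \<le> C * (exp (k * x - \<sigma> * x\<^sup>2) + exp ((- k) * x - \<sigma> * x\<^sup>2))"
      by (intro always_eventually allI le)
    have "((\<lambda>x. exp (c * x - \<sigma> * x\<^sup>2)) \<longlongrightarrow> 0) F" for c
      using F gaussian_exp_tendsto_0[OF \<sigma>, of c] by blast
    then have "((\<lambda>x. C * (exp (k * x - \<sigma> * x\<^sup>2) + exp ((- k) * x - \<sigma> * x\<^sup>2))) \<longlongrightarrow> C * (0 + 0)) F"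
      by (intro tendsto_intros)
    then show "((\<lambda>x. C * (exp (k * x - \<sigma> * x\<^sup>2) + exp ((- k) * x - \<sigma> * x\<^sup>2))) \<longlongrightarrow> 0) F" by simp
  qed
  have "(LBINT x=-\<infinity>..\<infinity>. ?f x) = 0 - 0"
  proof (rule interval_integral_FTC_integrable[where F = ?F])
    fix x
    have "((\<lambda>x. complex_of_real (gauss_deriv \<sigma> n x)) has_vector_derivative of_real (gauss_deriv \<sigma> (Suc n) x)) (at x)"
      by (rule has_vector_derivative_of_real[OF gauss_deriv_has_derivative])
    moreover have "((\<lambda>x. exp (of_real x * s)) has_vector_derivative (s * exp (of_real x * s))) (at x)"
      by (auto intro!: has_vector_derivative_real_field derivative_eq_intros)
    ultimately show "(?F has_vector_derivative ?f x) (at x)"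
      using has_vector_derivative_mult by (fastforce simp: algebra_simps)
    have "continuous_on UNIV ?f"
      by (intro continuous_intros continuous_gauss_deriv)
    then show "isCont ?f x" by (simp add: continuous_on_eq_continuous_at)
  next
    show "set_integrable lborel (einterval (-\<infinity>) \<infinity>) ?f"
      using i by (simp add: set_integrable_def einterval_def)
    show "((?F \<circ> real_of_ereal) \<longlongrightarrow> 0) (at_right (-\<infinity>))"
      unfolding ereal_tendsto_simps by (rule lim) simp
    show "((?F \<circ> real_of_ereal) \<longlongrightarrow> 0) (at_left \<infinity>)"
      unfolding ereal_tendsto_simps by (rule lim) simp
  qed simp
  then have "(\<integral>x. ?f x \<partial>lborel) = 0"
    by (simp add: interval_lebesgue_integral_def set_lebesgue_integral_def einterval_def)
  moreover have "(\<integral>x. ?f x \<partial>lborel) = (\<integral>x. of_real (gauss_deriv \<sigma> (Suc n) x) * exp (of_real x * s) \<partial>lborel) +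
      s * (\<integral>x. ?F x \<partial>lborel)"
    by (subst Bochner_Integration.integral_add)
      (simp_all only: integrable_mult_right integrable_gauss_deriv_exp[OF \<sigma>] integral_mult_right_zero)
  ultimately show ?thesis by (simp add: add_eq_0_iff)
qed

lemma sq_integrable_hermite:
  assumes \<sigma>: "\<sigma> > 0"
  shows "sq_integrable (gauss \<sigma>) (\<lambda>x. complex_of_real (hermite \<sigma> n x))"
proof -
  obtain C k where C: "0 \<le> C" "0 \<le> k"
    and le: "\<And>x. \<bar>gauss_deriv \<sigma> n x\<bar> \<le> C * exp (k * \<bar>x\<bar>) * exp (- \<sigma> * x\<^sup>2)"
    using gauss_deriv_bound by blast
  let ?b = "\<lambda>x. C\<^sup>2 * (cmod (exp (of_real (2 * k) * of_real x - 0 * of_real (x\<^sup>2))) +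
     cmod (exp (of_real (- (2 * k)) * of_real x - 0 * of_real (x\<^sup>2))))"
  show ?thesis
  proof (rule sq_integrable_bound)
    show "integrable (gauss \<sigma>) ?b"
      using \<sigma> by (intro integrable_mult_right Bochner_Integration.integrable_add integrable_norm gauss_exp_integral(1)) simp_all
    have "continuous_on UNIV (\<lambda>x. complex_of_real (hermite \<sigma> n x))"
      unfolding hermite_def by (intro continuous_intros continuous_gauss_deriv)
    then show "(\<lambda>x. complex_of_real (hermite \<sigma> n x)) \<in> borel_measurable (gauss \<sigma>)"
      unfolding measurable_gauss by (rule borel_measurable_continuous_onI)
    fix x
    have "\<bar>hermite \<sigma> n x\<bar> = exp (\<sigma> * x\<^sup>2) * \<bar>gauss_deriv \<sigma> n x\<bar>"
      by (simp add: hermite_def abs_mult power_abs)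
    also have "\<dots> \<le> exp (\<sigma> * x\<^sup>2) * (C * exp (k * \<bar>x\<bar>) * exp (- \<sigma> * x\<^sup>2))"
      by (intro mult_left_mono le) simp
    also have "\<dots> = C * exp (k * \<bar>x\<bar>)" by (simp add: exp_minus)
    finally have "(\<bar>hermite \<sigma> n x\<bar>)\<^sup>2 \<le> (C * exp (k * \<bar>x\<bar>))\<^sup>2" by (rule power_mono) simp
    also have "\<dots> = C\<^sup>2 * exp ((2 * k) * \<bar>x\<bar>)" by (simp add: power_mult_distrib exp_double[symmetric] mult.assoc)
    also have "\<dots> \<le> C\<^sup>2 * (exp ((2 * k) * x) + exp ((- (2 * k)) * x))"
      by (intro mult_left_mono exp_abs_le) simp
    finally show "(cmod (complex_of_real (hermite \<sigma> n x)))\<^sup>2 \<le> ?b x" by simp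
  qed
qed

text \<open>The factor \<open>exp (\<sigma> x\<^sup>2)\<close> in the Hermite polynomial cancels the weight, leaving the \<open>n\<close>-th derivative
  of the Gaussian against an exponential; \<open>n\<close> integrations by parts reduce to the mean of a coherent
  state, which is 1.\<close>

lemma l2inner_hermite_coh:
  assumes \<sigma>: "\<sigma> > 0"
  shows "l2inner (gauss \<sigma>) (\<lambda>x. complex_of_real (hermite \<sigma> n x)) (coh \<sigma> t) = (2 * of_real \<sigma> * cnj t) ^ n"
proof -
  let ?s = "2 * of_real \<sigma> * cnj t"
  let ?J = "\<lambda>n. \<integral>x. of_real (gauss_deriv \<sigma> n x) * exp (of_real x * ?s) \<partial>lborel"
  let ?K = "of_real (sqrt (\<sigma> / pi)) * exp (- of_real \<sigma> * (cnj t)\<^sup>2)"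
  have J: "?J n = (- ?s) ^ n * ?J 0" for n
  proof (induction n)
    case (Suc n)
    show ?case unfolding gauss_deriv_exp_integral_Suc[OF \<sigma>] Suc by simp
  qed simp
  have inner: "l2inner (gauss \<sigma>) (\<lambda>x. complex_of_real (hermite \<sigma> n x)) (coh \<sigma> t) = ?K * (-1) ^ n * ?J n" for n
  proof -
    have eq: "(sqrt (\<sigma> / pi) * exp (- \<sigma> * x\<^sup>2)) *\<^sub>R (complex_of_real (hermite \<sigma> n x) * coh \<sigma> (cnj t) x) =
        ?K * (-1) ^ n * (of_real (gauss_deriv \<sigma> n x) * exp (of_real x * ?s))" for x
    proof -
      have "sqrt (\<sigma> / pi) * exp (- \<sigma> * x\<^sup>2) * hermite \<sigma> n x = sqrt (\<sigma> / pi) * (-1) ^ n * gauss_deriv \<sigma> n x"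
        by (simp add: hermite_def exp_minus)
      moreover have "coh \<sigma> (cnj t) x = exp (- of_real \<sigma> * (cnj t)\<^sup>2) * exp (of_real x * ?s)"
        by (simp add: coh_def mult_exp_exp mult.commute)
      ultimately have "complex_of_real (sqrt (\<sigma> / pi) * exp (- \<sigma> * x\<^sup>2) * hermite \<sigma> n x) * coh \<sigma> (cnj t) x =
         of_real (sqrt (\<sigma> / pi) * (-1) ^ n * gauss_deriv \<sigma> n x) * (exp (- of_real \<sigma> * (cnj t)\<^sup>2) * exp (of_real x * ?s))"
        by (simp only:)
      then show ?thesis
        by (simp only: scaleR_conv_of_real of_real_mult of_real_power of_real_minus of_real_1 mult_ac)
    qed
    have [measurable]: "(\<lambda>x. complex_of_real (hermite \<sigma> n x)) \<in> borel_measurable borel"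
      using sq_integrable_hermite[OF \<sigma>, of n] by (simp add: sq_integrable_def)
    have "(\<lambda>x. complex_of_real (hermite \<sigma> n x) * coh \<sigma> (cnj t) x) \<in> borel_measurable borel"
      by measurable
    then show ?thesis
      unfolding l2inner_def cnj_coh by (simp only: integral_gauss[OF \<sigma>] eq integral_mult_right_zero)
  qed
  have "hermite \<sigma> 0 x = 1" for x by (simp add: hermite_def exp_minus)
  then have "l2inner (gauss \<sigma>) (\<lambda>x. complex_of_real (hermite \<sigma> 0 x)) (coh \<sigma> t) = 1"
    by (simp add: l2inner_def cnj_coh coh_integral(2)[OF \<sigma>])
  then have "?K * ?J 0 = 1" using inner[of 0] by (simp only: power_0 mult_1_right)
  moreover have "?K * (-1) ^ n * ?J n = ((-1) * (- ?s)) ^ n * (?K * ?J 0)"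
    unfolding J[of n] power_mult_distrib by (simp only: mult_ac)
  ultimately show ?thesis unfolding inner by simp
qed

text \<open>For \<open>s = a * s'\<close> the image \<open>g\<close> of \<open>h\<close> satisfies \<open>\<langle>g, coh s\<rangle> = \<langle>h, coh s'\<rangle>\<close>, which is
  \<open>(2 \<sigma> (cnj s')) ^ n\<close> up to the constant, that is \<open>a ^ n * \<langle>h, coh s\<rangle>\<close> as \<open>cnj s' = a * cnj s\<close>.
  So \<open>g\<close> and \<open>a ^ n * h\<close> have the same inner products with all coherent states.\<close>

lemma rotated_hermite:
  fixes c :: complex and n :: nat
  assumes \<sigma>: "\<sigma> > 0" and a: "cmod a = 1"
  defines "h \<equiv> \<lambda>x. c * complex_of_real (hermite \<sigma> n x)"
  shows "rotated \<sigma> a h (\<lambda>x. a ^ n * h x)"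
proof -
  let ?M = "gauss \<sigma>"
  have h: "sq_integrable ?M h" unfolding h_def by (intro sq_integrable_cmult sq_integrable_hermite \<sigma>)
  then have ah: "sq_integrable ?M (\<lambda>x. a ^ n * h x)" by (rule sq_integrable_cmult)
  have inner: "l2inner ?M h (coh \<sigma> s) = c * (2 * of_real \<sigma> * cnj s) ^ n" for s
    unfolding h_def by (simp only: l2inner_cmult_left l2inner_hermite_coh[OF \<sigma>])
  obtain g where g: "rotated \<sigma> a h g" using rotated_exists[OF \<sigma> a h] by blast
  have gsq: "sq_integrable ?M g" using g by (simp add: rotated_def)
  have aa: "a * cnj a = 1" using complex_norm_square[of a] a by simp
  have "l2norm ?M (\<lambda>x. g x - a ^ n * h x) = 0"
  proof (rule orthogonal_coh_imp_zero[OF \<sigma>])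
    show "sq_integrable ?M (\<lambda>x. g x - a ^ n * h x)" by (intro sq_integrable_diff gsq ah)
    fix s
    have s: "s = a * (cnj a * s)" using aa by (simp add: mult.assoc[symmetric])
    have "l2inner ?M g (coh \<sigma> s) = c * (2 * of_real \<sigma> * cnj (cnj a * s)) ^ n"
      using rotated_inner[OF \<sigma> a g, of "cnj a * s"] unfolding inner s[symmetric] .
    also have "\<dots> = a ^ n * (c * (2 * of_real \<sigma> * cnj s) ^ n)"
      by (simp add: power_mult_distrib)
    finally show "l2inner ?M (\<lambda>x. g x - a ^ n * h x) (coh \<sigma> s) = 0"
      by (simp add: l2inner_diff_left gsq ah sq_integrable_coh \<sigma> l2inner_cmult_left inner)
  qed
  then have z: "l2norm ?M (\<lambda>x. a ^ n * h x - g x) = 0" by (simp only: l2norm_minus_commute)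
  have "\<exists>xs. l2norm ?M (\<lambda>x. h x - comb \<sigma> 1 xs x) < e \<and> l2norm ?M (\<lambda>x. a ^ n * h x - comb \<sigma> a xs x) < e"
    if e: "e > 0" for e
  proof -
    obtain xs where xs: "l2norm ?M (\<lambda>x. h x - comb \<sigma> 1 xs x) < e" "l2norm ?M (\<lambda>x. g x - comb \<sigma> a xs x) < e"
      using g e unfolding rotated_def by blast
    have "l2norm ?M (\<lambda>x. a ^ n * h x - comb \<sigma> a xs x) < e"
      using l2norm_triangle_diff[OF ah gsq sq_integrable_comb[OF \<sigma>], of a xs] z xs(2) by linarith
    then show ?thesis using xs(1) by blast
  qed
  then show ?thesis using h ah unfolding rotated_def by blast
qed

section \<open>Bicomplex functions and their components\<close>

lemma bc_components_of_real [simp]: "bc_plus (of_real r) = of_real r" "bc_minus (of_real r) = of_real r"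
  by (simp_all add: of_real_def)

lemma bc_components_power [simp]: "bc_plus (Z ^ n) = bc_plus Z ^ n" "bc_minus (Z ^ n) = bc_minus Z ^ n"
  by (induction n) simp_all

lemma bc_eq_iff: "Z = W \<longleftrightarrow> bc_plus Z = bc_plus W \<and> bc_minus Z = bc_minus W"
  by (metis bc_idem_decomposition)

lemma L2_eq:
  assumes \<sigma>: "\<sigma> > 0"
  shows "f \<in> L2 \<sigma> \<longleftrightarrow> sq_integrable (gauss \<sigma>) f"
proof -
  have "integrable (gauss \<sigma>) (\<lambda>x. (cmod (f x))\<^sup>2) \<longleftrightarrow> integrable lborel (\<lambda>x. (cmod (f x))\<^sup>2 * exp (- \<sigma> * x\<^sup>2))"
    if [measurable]: "f \<in> borel_measurable borel"
  proof -
    have "integrable (gauss \<sigma>) (\<lambda>x. (cmod (f x))\<^sup>2) \<longleftrightarrow>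
        integrable lborel (\<lambda>x. (sqrt (\<sigma> / pi) * exp (- \<sigma> * x\<^sup>2)) *\<^sub>R (cmod (f x))\<^sup>2)"
      by (rule integrable_gauss[OF \<sigma>]) measurable
    also have "(\<lambda>x. (sqrt (\<sigma> / pi) * exp (- \<sigma> * x\<^sup>2)) *\<^sub>R (cmod (f x))\<^sup>2) =
        (\<lambda>x. sqrt (\<sigma> / pi) * ((cmod (f x))\<^sup>2 * exp (- \<sigma> * x\<^sup>2)))"
      by (simp add: mult_ac)
    finally show ?thesis using \<sigma> by simp
  qed
  then show ?thesis by (auto simp: L2_def sq_integrable_def)
qed

lemma gauss_weighted_inner:
  assumes \<sigma>: "\<sigma> > 0" and f: "sq_integrable (gauss \<sigma>) f"
  shows "of_real ((\<sigma> / pi) powr (1 / 2)) * (LINT x:UNIV|lborel. f x * cnj (f x) * of_real (exp (- \<sigma> * x\<^sup>2))) =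
    complex_of_real ((l2norm (gauss \<sigma>) f)\<^sup>2)"
proof -
  have [measurable]: "f \<in> borel_measurable borel" using f by (simp add: sq_integrable_def)
  have "(\<lambda>x. f x * cnj (f x)) \<in> borel_measurable borel"
    using integrable_inner[OF f f] by (auto dest: borel_measurable_integrable)
  then have "l2inner (gauss \<sigma>) f f = (\<integral>x. (sqrt (\<sigma> / pi) * exp (- \<sigma> * x\<^sup>2)) *\<^sub>R (f x * cnj (f x)) \<partial>lborel)"
    unfolding l2inner_def by (rule integral_gauss[OF \<sigma>])
  also have "(\<lambda>x. (sqrt (\<sigma> / pi) * exp (- \<sigma> * x\<^sup>2)) *\<^sub>R (f x * cnj (f x))) =
      (\<lambda>x. of_real (sqrt (\<sigma> / pi)) * (f x * cnj (f x) * of_real (exp (- \<sigma> * x\<^sup>2))))"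
    by (simp only: scaleR_conv_of_real of_real_mult mult_ac)
  finally show ?thesis
    using \<sigma> unfolding l2inner_self by (simp add: set_lebesgue_integral_def powr_half_sqrt)
qed

lemma L2T_norm_eq:
  assumes \<sigma>: "\<sigma> > 0" and "\<phi> \<in> L2T \<sigma>"
  shows "L2T_norm \<sigma> \<phi> = sqrt (((l2norm (gauss \<sigma>) (\<lambda>x. bc_plus (\<phi> x)))\<^sup>2 + (l2norm (gauss \<sigma>) (\<lambda>x. bc_minus (\<phi> x)))\<^sup>2) / 2)"
proof -
  have "sq_integrable (gauss \<sigma>) (\<lambda>x. bc_plus (\<phi> x))" "sq_integrable (gauss \<sigma>) (\<lambda>x. bc_minus (\<phi> x))"
    using assms by (simp_all add: L2T_def L2_eq)
  note this[THEN gauss_weighted_inner[OF \<sigma>]]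
  then show ?thesis
    by (simp add: L2T_norm_def L2T_inner_def bc_integral_def bc_star_def del: of_real_power)
qed

text \<open>The transform is only determined through a limit in norm, that is up to almost everywhere equality.\<close>

lemma l2_tendsto_unique:
  assumes "l2_tendsto M f g F" "l2_tendsto M f g' F" "F \<noteq> bot"
  shows "AE x in M. g x = g' x"
proof -
  have g: "sq_integrable M g" "sq_integrable M g'" using assms by (auto simp: l2_tendsto_def)
  let ?p = "\<lambda>t. l2norm M (\<lambda>x. f t x - g x) + l2norm M (\<lambda>x. f t x - g' x)"
  have "(?p \<longlongrightarrow> 0 + 0) F"
    using assms by (intro tendsto_add) (auto simp: l2_tendsto_def)
  moreover have "\<forall>\<^sub>F t in F. sq_integrable M (f t)" using assms by (simp add: l2_tendsto_def)
  then have "\<forall>\<^sub>F t in F. l2norm M (\<lambda>x. g x - g' x) \<le> ?p t"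
  proof eventually_elim
    case (elim t)
    then show ?case using l2norm_triangle_diff[OF g(1) elim g(2)] l2norm_minus_commute[of M g "f t"] by simp
  qed
  ultimately have "l2norm M (\<lambda>x. g x - g' x) \<le> 0 + 0"
    using assms(3) by (intro tendsto_lowerbound)
  then have "l2norm M (\<lambda>x. g x - g' x) = 0" using l2norm_nonneg[of M "\<lambda>x. g x - g' x"] by linarith
  then show ?thesis using l2norm_zero_iff_AE[OF sq_integrable_diff[OF g]] by simp
qed

lemma L2T_tendsto_iff:
  assumes \<sigma>: "\<sigma> > 0"
  shows "L2T_tendsto \<sigma> f g F \<longleftrightarrow>
    l2_tendsto (gauss \<sigma>) (\<lambda>t x. bc_plus (f t x)) (\<lambda>x. bc_plus (g x)) F \<and>
    l2_tendsto (gauss \<sigma>) (\<lambda>t x. bc_minus (f t x)) (\<lambda>x. bc_minus (g x)) F"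
    (is "?L \<longleftrightarrow> ?R")
proof -
  let ?M = "gauss \<sigma>"
  let ?p = "\<lambda>t. l2norm ?M (\<lambda>x. bc_plus (f t x) - bc_plus (g x))"
  let ?q = "\<lambda>t. l2norm ?M (\<lambda>x. bc_minus (f t x) - bc_minus (g x))"
  have norm: "L2T_norm \<sigma> (\<lambda>x. f t x - g x) = sqrt (((?p t)\<^sup>2 + (?q t)\<^sup>2) / 2)"
    if "f t \<in> L2T \<sigma>" "g \<in> L2T \<sigma>" for t
    using that by (subst L2T_norm_eq[OF \<sigma>]) (simp_all add: L2T_def L2_eq[OF \<sigma>] sq_integrable_diff)
  have lim: "((\<lambda>t. L2T_norm \<sigma> (\<lambda>x. f t x - g x)) \<longlongrightarrow> 0) F \<longleftrightarrow> (?p \<longlongrightarrow> 0) F \<and> (?q \<longlongrightarrow> 0) F"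
    if ev: "\<forall>\<^sub>F t in F. f t \<in> L2T \<sigma>" and g: "g \<in> L2T \<sigma>"
  proof
    assume *: "((\<lambda>t. L2T_norm \<sigma> (\<lambda>x. f t x - g x)) \<longlongrightarrow> 0) F"
    have l: "((\<lambda>t. sqrt 2 * L2T_norm \<sigma> (\<lambda>x. f t x - g x)) \<longlongrightarrow> 0) F"
      using tendsto_mult_left[OF *, of "sqrt 2"] by simp
    have "\<forall>\<^sub>F t in F. ?p t \<le> sqrt 2 * L2T_norm \<sigma> (\<lambda>x. f t x - g x) \<and> ?q t \<le> sqrt 2 * L2T_norm \<sigma> (\<lambda>x. f t x - g x)"
      using ev
    proof eventually_elim
      case (elim t)
      have "sqrt 2 * L2T_norm \<sigma> (\<lambda>x. f t x - g x) = sqrt ((?p t)\<^sup>2 + (?q t)\<^sup>2)"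
        unfolding norm[OF elim g] real_sqrt_mult[symmetric] by simp
      then show ?case by (simp only:) (auto intro: real_le_rsqrt)
    qed
    then have pq: "\<forall>\<^sub>F t in F. norm (?p t) \<le> sqrt 2 * L2T_norm \<sigma> (\<lambda>x. f t x - g x)"
        "\<forall>\<^sub>F t in F. norm (?q t) \<le> sqrt 2 * L2T_norm \<sigma> (\<lambda>x. f t x - g x)"
      by (auto elim: eventually_mono)
    then show "(?p \<longlongrightarrow> 0) F \<and> (?q \<longlongrightarrow> 0) F"
      using Lim_null_comparison[OF pq(1) l] Lim_null_comparison[OF pq(2) l] by blast
  next
    assume "(?p \<longlongrightarrow> 0) F \<and> (?q \<longlongrightarrow> 0) F"
    then have "((\<lambda>t. sqrt (((?p t)\<^sup>2 + (?q t)\<^sup>2) / 2)) \<longlongrightarrow> sqrt ((0\<^sup>2 + 0\<^sup>2) / 2)) F"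
      by (intro tendsto_intros) auto
    then have "((\<lambda>t. sqrt (((?p t)\<^sup>2 + (?q t)\<^sup>2) / 2)) \<longlongrightarrow> 0) F" by simp
    moreover have "\<forall>\<^sub>F t in F. sqrt (((?p t)\<^sup>2 + (?q t)\<^sup>2) / 2) = L2T_norm \<sigma> (\<lambda>x. f t x - g x)"
      using ev by eventually_elim (simp only: norm[OF _ g])
    ultimately show "((\<lambda>t. L2T_norm \<sigma> (\<lambda>x. f t x - g x)) \<longlongrightarrow> 0) F"
      by (rule Lim_transform_eventually)
  qed
  have "?L \<longleftrightarrow> g \<in> L2T \<sigma> \<and> (\<forall>\<^sub>F t in F. f t \<in> L2T \<sigma>) \<and> (?p \<longlongrightarrow> 0) F \<and> (?q \<longlongrightarrow> 0) F"
    unfolding L2T_tendsto_def using lim by blast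
  also have "\<dots> \<longleftrightarrow> ?R"
    by (auto simp: L2T_def L2_eq[OF \<sigma>] l2_tendsto_def eventually_conj_iff)
  finally show ?thesis .
qed

text \<open>The exponents agree since \<open>- \<sigma> x\<^sup>2 - \<sigma> a\<^sup>2 x\<^sup>2 / (1 - a\<^sup>2) = - \<sigma> x\<^sup>2 / (1 - a\<^sup>2)\<close>.\<close>

lemma frft_integral_eq_mehler_transform:
  fixes A :: "real set"
  assumes \<sigma>: "\<sigma> > 0" and a: "a\<^sup>2 \<noteq> 1" and f: "f \<in> borel_measurable borel" and A: "A \<in> sets borel"
  shows "of_real ((\<sigma> / pi) powr (1 / 2)) * inverse (csqrt (1 - a\<^sup>2)) *
      (LINT x:A|lborel. f x * exp (- (of_real \<sigma> * inverse (1 - a\<^sup>2)) * (of_real x - a * of_real y)\<^sup>2)) =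
    mehler_transform \<sigma> a (\<lambda>x. indicator A x * f x) y"
proof -
  note [measurable] = f A
  have a0: "1 - a\<^sup>2 \<noteq> 0" using a by simp
  have ex: "of_real (- \<sigma> * x\<^sup>2) +
      (- (of_real \<sigma> * (a\<^sup>2 * (of_real (x\<^sup>2) + of_real (y\<^sup>2)) - 2 * a * of_real x * of_real y)) / (1 - a\<^sup>2)) =
      - (of_real \<sigma> * inverse (1 - a\<^sup>2)) * (of_real x - a * of_real y)\<^sup>2" for x
    using a0 by (simp add: divide_simps) (simp add: power2_eq_square algebra_simps)
  have eq: "(sqrt (\<sigma> / pi) * exp (- \<sigma> * x\<^sup>2)) *\<^sub>R (indicator A x * f x * mehler \<sigma> a x y) =
      of_real (sqrt (\<sigma> / pi)) * inverse (csqrt (1 - a\<^sup>2)) *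
      (indicator A x *\<^sub>R (f x * exp (- (of_real \<sigma> * inverse (1 - a\<^sup>2)) * (of_real x - a * of_real y)\<^sup>2)))" for x
    unfolding ex[symmetric] exp_add mehler_def scaleR_conv_of_real of_real_mult exp_of_real
    by (simp add: divide_inverse indicator_def mult_ac flip: exp_of_real)
  have "mehler_transform \<sigma> a (\<lambda>x. indicator A x * f x) y =
     (\<integral>x. (sqrt (\<sigma> / pi) * exp (- \<sigma> * x\<^sup>2)) *\<^sub>R (indicator A x * f x * mehler \<sigma> a x y) \<partial>lborel)"
    unfolding mehler_transform_def by (rule integral_gauss[OF \<sigma>]) measurable
  also have "\<dots> = of_real (sqrt (\<sigma> / pi)) * inverse (csqrt (1 - a\<^sup>2)) *
      (LINT x:A|lborel. f x * exp (- (of_real \<sigma> * inverse (1 - a\<^sup>2)) * (of_real x - a * of_real y)\<^sup>2))"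
    unfolding eq set_lebesgue_integral_def by (rule integral_mult_right_zero)
  finally show ?thesis using \<sigma> by (simp add: powr_half_sqrt)
qed

lemma frft_on_components:
  assumes \<sigma>: "\<sigma> > 0" and \<psi>: "\<psi> \<in> L2T \<sigma>" and A: "A \<in> sets borel"
    and \<theta>: "(bc_plus \<theta>)\<^sup>2 \<noteq> 1" "(bc_minus \<theta>)\<^sup>2 \<noteq> 1"
  shows "bc_plus (frft_on A \<sigma> \<theta> \<psi> y) = mehler_transform \<sigma> (bc_plus \<theta>) (\<lambda>x. indicator A x * bc_plus (\<psi> x)) y"
    and "bc_minus (frft_on A \<sigma> \<theta> \<psi> y) = mehler_transform \<sigma> (bc_minus \<theta>) (\<lambda>x. indicator A x * bc_minus (\<psi> x)) y"
proof -
  have m: "(\<lambda>x. bc_plus (\<psi> x)) \<in> borel_measurable borel" "(\<lambda>x. bc_minus (\<psi> x)) \<in> borel_measurable borel"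
    using \<psi> by (simp_all add: L2T_def L2_def)
  show "bc_plus (frft_on A \<sigma> \<theta> \<psi> y) = mehler_transform \<sigma> (bc_plus \<theta>) (\<lambda>x. indicator A x * bc_plus (\<psi> x)) y"
    unfolding frft_integral_eq_mehler_transform[OF \<sigma> \<theta>(1) m(1) A, symmetric]
    by (simp add: frft_on_def divide_bicomplex_def inverse_bicomplex_def bc_sqrt_def bc_integral_def bc_exp_def)
  show "bc_minus (frft_on A \<sigma> \<theta> \<psi> y) = mehler_transform \<sigma> (bc_minus \<theta>) (\<lambda>x. indicator A x * bc_minus (\<psi> x)) y"
    unfolding frft_integral_eq_mehler_transform[OF \<sigma> \<theta>(2) m(2) A, symmetric]
    by (simp add: frft_on_def divide_bicomplex_def inverse_bicomplex_def bc_sqrt_def bc_integral_def bc_exp_def)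
qed

lemma l2_tendsto_cong:
  assumes "\<forall>\<^sub>F t in F. f t = f' t" "l2_tendsto M f g F"
  shows "l2_tendsto M f' g F"
proof -
  have "((\<lambda>t. l2norm M (\<lambda>x. f' t x - g x)) \<longlongrightarrow> 0) F"
    using assms(2) unfolding l2_tendsto_def
    by (elim conjE Lim_transform_eventually) (use assms(1) in \<open>auto elim: eventually_mono\<close>)
  moreover have "\<forall>\<^sub>F t in F. sq_integrable M (f' t)"
    using assms(1) conjunct1[OF conjunct2[OF assms(2)[unfolded l2_tendsto_def]]]
    by eventually_elim simp
  ultimately show ?thesis using assms(2) by (simp add: l2_tendsto_def)
qed

text \<open>Each of the two cases in the definition of the transform is one of the two limits of Mehler
  transforms, taken in both components.\<close>

lemma has_frft_rotated:
  assumes \<sigma>: "\<sigma> > 0" and \<theta>: "cmod (bc_plus \<theta>) = 1" "cmod (bc_minus \<theta>) = 1"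
    and r: "rotated \<sigma> (bc_plus \<theta>) (\<lambda>x. bc_plus (\<psi> x)) (\<lambda>x. bc_plus (g x))"
      "rotated \<sigma> (bc_minus \<theta>) (\<lambda>x. bc_minus (\<psi> x)) (\<lambda>x. bc_minus (g x))"
  shows "has_frft \<sigma> \<theta> \<psi> g"
proof -
  have \<psi>: "\<psi> \<in> L2T \<sigma>" using r by (simp add: rotated_def L2T_def L2_eq[OF \<sigma>])
  show ?thesis
  proof (cases "(1 - \<theta>\<^sup>2) dvd 1")
    case True
    then have ne: "(bc_plus \<theta>)\<^sup>2 \<noteq> 1" "(bc_minus \<theta>)\<^sup>2 \<noteq> 1" by (auto simp: bicomplex_unit_iff)
    have "L2T_tendsto \<sigma> (\<lambda>R. frft_on {-R..R} \<sigma> \<theta> \<psi>) g at_top"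
      unfolding L2T_tendsto_iff[OF \<sigma>]
      using l2_tendsto_truncated_mehler[OF \<sigma> \<theta>(1) ne(1) r(1)] l2_tendsto_truncated_mehler[OF \<sigma> \<theta>(2) ne(2) r(2)]
      by (simp add: frft_on_components[OF \<sigma> \<psi> _ ne])
    then show ?thesis using True by (simp add: has_frft_def)
  next
    case False
    have ev: "\<forall>\<^sub>F r in at_left 1. 0 < r \<and> r < (1::real)"
      using eventually_at_left_real[of 0 "1::real"] by simp
    have ne: "(of_real r * a)\<^sup>2 \<noteq> 1" if "0 < r \<and> r < 1" "cmod a = 1" for r and a :: complex
    proof -
      have "cmod ((of_real r * a)\<^sup>2) < 1"
        using that by (simp add: norm_power norm_mult power_less_one_iff)
      then show ?thesis by auto
    qed
    have comp: "bc_plus (r *\<^sub>R \<theta>) = of_real r * bc_plus \<theta>" "bc_minus (r *\<^sub>R \<theta>) = of_real r * bc_minus \<theta>" for r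
      by (simp_all add: scaleR_conv_of_real)
    have "\<forall>\<^sub>F r in at_left 1. mehler_transform \<sigma> (of_real r * bc_plus \<theta>) (\<lambda>x. bc_plus (\<psi> x)) =
        (\<lambda>y. bc_plus (frft_on UNIV \<sigma> (r *\<^sub>R \<theta>) \<psi> y))"
      using ev
    proof eventually_elim
      case (elim r)
      have "(bc_plus (r *\<^sub>R \<theta>))\<^sup>2 \<noteq> 1" "(bc_minus (r *\<^sub>R \<theta>))\<^sup>2 \<noteq> 1"
        unfolding comp using ne[OF elim] \<theta> by blast+
      from frft_on_components(1)[OF \<sigma> \<psi> _ this, of UNIV] show ?case
        by (simp add: comp fun_eq_iff del: bc_plus_arith)
    qed
    moreover have "\<forall>\<^sub>F r in at_left 1. mehler_transform \<sigma> (of_real r * bc_minus \<theta>) (\<lambda>x. bc_minus (\<psi> x)) =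
        (\<lambda>y. bc_minus (frft_on UNIV \<sigma> (r *\<^sub>R \<theta>) \<psi> y))"
      using ev
    proof eventually_elim
      case (elim r)
      have "(bc_plus (r *\<^sub>R \<theta>))\<^sup>2 \<noteq> 1" "(bc_minus (r *\<^sub>R \<theta>))\<^sup>2 \<noteq> 1"
        unfolding comp using ne[OF elim] \<theta> by blast+
      from frft_on_components(2)[OF \<sigma> \<psi> _ this, of UNIV] show ?case
        by (simp add: comp fun_eq_iff del: bc_minus_arith)
    qed
    ultimately have "L2T_tendsto \<sigma> (\<lambda>r. frft_on UNIV \<sigma> (r *\<^sub>R \<theta>) \<psi>) g (at_left 1)"
      unfolding L2T_tendsto_iff[OF \<sigma>]
      using l2_tendsto_radial_mehler[OF \<sigma> \<theta>(1) r(1)] l2_tendsto_radial_mehler[OF \<sigma> \<theta>(2) r(2)]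
      by (intro conjI) (rule l2_tendsto_cong; assumption)+
    then show ?thesis using False by (simp add: has_frft_def)
  qed
qed

lemma has_frft_unique:
  assumes \<sigma>: "\<sigma> > 0" and "has_frft \<sigma> \<theta> \<psi> g" "has_frft \<sigma> \<theta> \<psi> g'"
  shows "AE x in gauss \<sigma>. bc_plus (g x) = bc_plus (g' x)" "AE x in gauss \<sigma>. bc_minus (g x) = bc_minus (g' x)"
    and "g \<in> L2T \<sigma>" "g' \<in> L2T \<sigma>"
proof -
  have "\<exists>f (F :: real filter). F \<noteq> bot \<and> L2T_tendsto \<sigma> f g F \<and> L2T_tendsto \<sigma> f g' F"
  proof (cases "(1 - \<theta>\<^sup>2) dvd 1")
    case True
    then show ?thesis
      using assms(2,3) by (intro exI[of _ "\<lambda>R. frft_on {-R..R} \<sigma> \<theta> \<psi>"] exI[of _ at_top]) (simp add: has_frft_def)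
  next
    case False
    then show ?thesis
      using assms(2,3) by (intro exI[of _ "\<lambda>r. frft_on UNIV \<sigma> (r *\<^sub>R \<theta>) \<psi>"] exI[of _ "at_left 1"]) (simp add: has_frft_def)
  qed
  then obtain f and F :: "real filter" where F: "F \<noteq> bot" and *: "L2T_tendsto \<sigma> f g F" "L2T_tendsto \<sigma> f g' F"
    by blast
  show "g \<in> L2T \<sigma>" "g' \<in> L2T \<sigma>" using * by (auto simp: L2T_tendsto_def)
  show "AE x in gauss \<sigma>. bc_plus (g x) = bc_plus (g' x)" "AE x in gauss \<sigma>. bc_minus (g x) = bc_minus (g' x)"
    using *[unfolded L2T_tendsto_iff[OF \<sigma>]] l2_tendsto_unique[OF _ _ F] by blast+
qed

section \<open>The isometry and its eigenfunctions\<close>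

theorem corollary6p5:
  fixes \<sigma> :: real and \<theta> :: bicomplex
  assumes "\<sigma> > 0"
    and "\<theta> \<in> bc_torus"
    and "\<theta> \<noteq> 1" "\<theta> \<noteq> - 1" "\<theta> \<noteq> bc_i * bc_j" "\<theta> \<noteq> - (bc_i * bc_j)"
  shows "(\<forall>\<psi> \<in> L2T \<sigma>. has_frft \<sigma> \<theta> \<psi> (frft \<sigma> \<theta> \<psi>) \<and>
            L2T_norm \<sigma> (frft \<sigma> \<theta> \<psi>) = L2T_norm \<sigma> \<psi>) \<and>
         (\<forall>n. AE y in lborel.
            frft \<sigma> \<theta> (hermite_psi \<sigma> n) y = \<theta> ^ n * hermite_psi \<sigma> n y)"
proof (intro conjI ballI allI)
  note \<sigma> = assms(1)
  have \<theta>: "cmod (bc_plus \<theta>) = 1" "cmod (bc_minus \<theta>) = 1"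
    using assms(2) by (auto simp: bc_torus_def)
  have frft: "has_frft \<sigma> \<theta> \<psi> (frft \<sigma> \<theta> \<psi>)" if "has_frft \<sigma> \<theta> \<psi> g" for \<psi> g
    unfolding frft_def using that by (rule someI[where P = "has_frft \<sigma> \<theta> \<psi>"])
  {
    fix \<psi> assume \<psi>: "\<psi> \<in> L2T \<sigma>"
    then have "sq_integrable (gauss \<sigma>) (\<lambda>x. bc_plus (\<psi> x))" "sq_integrable (gauss \<sigma>) (\<lambda>x. bc_minus (\<psi> x))"
      by (simp_all add: L2T_def L2_eq[OF \<sigma>])
    then obtain u v where r: "rotated \<sigma> (bc_plus \<theta>) (\<lambda>x. bc_plus (\<psi> x)) u" "rotated \<sigma> (bc_minus \<theta>) (\<lambda>x. bc_minus (\<psi> x)) v"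
      using rotated_exists[OF \<sigma> \<theta>(1)] rotated_exists[OF \<sigma> \<theta>(2)] by blast
    have g: "has_frft \<sigma> \<theta> \<psi> (\<lambda>x. bc_idem (u x) (v x))"
      using r by (intro has_frft_rotated[OF \<sigma> \<theta>]) simp_all
    then show has: "has_frft \<sigma> \<theta> \<psi> (frft \<sigma> \<theta> \<psi>)" by (rule frft)
    note U = has_frft_unique[OF \<sigma> has g]
    have m: "(\<lambda>x. bc_plus (frft \<sigma> \<theta> \<psi> x)) \<in> borel_measurable (gauss \<sigma>)" "(\<lambda>x. bc_minus (frft \<sigma> \<theta> \<psi> x)) \<in> borel_measurable (gauss \<sigma>)"
        "u \<in> borel_measurable (gauss \<sigma>)" "v \<in> borel_measurable (gauss \<sigma>)"
      using U(3,4) by (simp_all add: L2T_def L2_def)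
    have "l2norm (gauss \<sigma>) (\<lambda>x. bc_plus (frft \<sigma> \<theta> \<psi> x)) = l2norm (gauss \<sigma>) u"
        "l2norm (gauss \<sigma>) (\<lambda>x. bc_minus (frft \<sigma> \<theta> \<psi> x)) = l2norm (gauss \<sigma>) v"
      using U(1,2) by (intro l2norm_cong_AE m; simp)+
    then show "L2T_norm \<sigma> (frft \<sigma> \<theta> \<psi>) = L2T_norm \<sigma> \<psi>"
      using rotated_norm[OF \<sigma> \<theta>(1) r(1)] rotated_norm[OF \<sigma> \<theta>(2) r(2)]
      by (simp add: L2T_norm_eq[OF \<sigma>] U(3) \<psi>)
  }
  fix n
  let ?h = "hermite_psi \<sigma> n" and ?c = "complex_of_real ((1 / (2 ^ n * \<sigma> ^ n * fact n)) powr (1 / 2))"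
  have comp: "bc_plus (?h x) = ?c * of_real (hermite \<sigma> n x)" "bc_minus (?h x) = ?c * of_real (hermite \<sigma> n x)" for x
    by (simp_all only: hermite_psi_def bc_components_of_real) (simp_all only: of_real_mult)
  have h: "has_frft \<sigma> \<theta> ?h (\<lambda>y. \<theta> ^ n * ?h y)"
  proof (rule has_frft_rotated[OF \<sigma> \<theta>])
    show "rotated \<sigma> (bc_plus \<theta>) (\<lambda>x. bc_plus (?h x)) (\<lambda>x. bc_plus (\<theta> ^ n * ?h x))"
      unfolding bc_plus_arith bc_components_power comp by (rule rotated_hermite[OF \<sigma> \<theta>(1)])
    show "rotated \<sigma> (bc_minus \<theta>) (\<lambda>x. bc_minus (?h x)) (\<lambda>x. bc_minus (\<theta> ^ n * ?h x))"
      unfolding bc_minus_arith bc_components_power comp by (rule rotated_hermite[OF \<sigma> \<theta>(2)])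
  qed
  have "AE y in gauss \<sigma>. frft \<sigma> \<theta> ?h y = \<theta> ^ n * ?h y"
    using has_frft_unique(1,2)[OF \<sigma> frft[OF h] h] by eventually_elim (simp add: bc_eq_iff)
  then show "AE y in lborel. frft \<sigma> \<theta> ?h y = \<theta> ^ n * ?h y"
    unfolding AE_gauss_iff[OF \<sigma>] .
qed

end
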